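(* The mapping $\mu\mapsto\Pi_\mu=\Pi_{W_{\mathrm I},\mu}$ is a bijection of $\mathsf P_{\mathrm L}^*(\mathcal S_{\mathrm I})$ onto the set $\mathcal{IO}_\infty$ of interval order limits.
   Context: Posets are non-empty. $\mathcal P$ is the set of unlabelled finite posets. For finite posets $Q,P$, $t(Q,P)$ is the proportion of all maps $\varphi:Q\to P$ such that $x<_Q y\Rightarrow \varphi(x)<_P\varphi(y)$. A sequence of finite posets $P_n$ with $|P_n|\to\infty$ converges if $t(Q,P_n)$ converges for every finite poset $Q$. The discrete space $\mathcal P$ embeds as an open dense subspace of a compact metric space $\overline{\mathcal P}$ such that, for a sequence $P_n$ of finite posets with $|P_n|\to\infty$, $t(Q,P_n)$ converges for every finite poset $Q$ iff $P_n$ converges in $\overline{\mathcal P}$; concretely, $\overline{\mathcal P}$ is the closure of the image of $P\mapsto\bigl((t(Q,P))_{Q\in\mathcal P},1/|P|\bigr)$ in $[0,1]^{\mathcal P}\times[0,1]$. Elements of $\mathcal P_\infty:=\overline{\mathcal P}\setminus\mathcal P$ are poset limits. Each $t(Q,\cdot)$ extends continuously to $\overline{\mathcal P}$, and a poset limit $\Pi$ is determined by the numbers $t(Q,\Pi)$, $Q\in\mathcal P$. A finite poset $P$ has an interval order if there are non-empty intervals $I_p\subset\mathbb R$, $p\in P$, such that $p<q$ iff $I_p$ lies entirely to the left of $I_q$. $\mathcal{IO}_\infty$ is the set of interval order limits, i.e. poset limits that are limits of sequences of finite interval orders. $\mathcal S_{\mathrm I}=\{(x,y):0\le x\le y\le1\}$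 (identified with closed intervals $[x,y]\subseteq[0,1]$), with partial order $(x_1,y_1)\prec(x_2,y_2)$ iff $y_1<x_2$, and $W_{\mathrm I}(\mathbf x_1,\mathbf x_2)=1$ if $\mathbf x_1\prec\mathbf x_2$ and $0$ otherwise. For a Borel probability measure $\mu$ on $\mathcal S_{\mathrm I}$, $\Pi_\mu=\Pi_{W_{\mathrm I},\mu}$ is the unique poset limit with $t(Q,\Pi_\mu)=\int_{\mathcal S_{\mathrm I}^{|Q|}}\prod_{ij:\,i<_Qj}W_{\mathrm I}(\mathbf x_i,\mathbf x_j)\,d\mu(\mathbf x_1)\cdots d\mu(\mathbf x_{|Q|})$ for all $Q\in\mathcal P$. The left [right] marginal $\mu_{\mathrm L}$ [$\mu_{\mathrm R}$] of $\mu$ is its image under projection onto the first [second] coordinate; $\lambda$ is Lebesgue measure. $\mathsf P_{\mathrm L}(\mathcal S_{\mathrm I})$ is the set of Borel probability measures $\mu$ on $\mathcal S_{\mathrm I}$ with $\mu_{\mathrm L}=\lambda$ on $[0,1]$. $\mathsf P_{\mathrm L}^*(\mathcal S_{\mathrm I})$ is the set of $\mu\in\mathsf P_{\mathrm L}(\mathcal S_{\mathrm I})$ such that whenever $(a,b)$ is an open subinterval of $(0,1)$ with $\mu_{\mathrm R}(a,b)=0$, the restriction of $\mu$ to $(a,b)\times[0,1]$ is a product measure $\lambda\times\nu_{a,b}$ for some measure $\nu_{a,b}$ on $[0,1]$ (here $\mu$ is regarded as a measure on $[0,1]^2$). *)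

theory Defs
  imports "HOL-Probability.Probability"
begin

section \<open>Finite posets\<close>

text \<open>
  A labelled finite poset is a non-empty finite reflexive partial order on a set of naturals,
  which is recovered as the field of the relation; every finite poset is isomorphic to one of these.
\<close>

typedef fposet = "{r :: nat rel. Partial_order r \<and> finite (Field r) \<and> Field r \<noteq> {}}"
proof
  show "{(0, 0)} \<in> {r :: nat rel. Partial_order r \<and> finite (Field r) \<and> Field r \<noteq> {}}"
    by (auto simp: order_on_defs refl_on_def trans_def antisym_def Field_def)
qed

definition pcarrier :: "fposet \<Rightarrow> nat set" where
  "pcarrier P = Field (Rep_fposet P)"

definition plt :: "fposet \<Rightarrow> nat \<Rightarrow> nat \<Rightarrow> bool" where
  "plt P x y \<longleftrightarrow> (x, y) \<in> Rep_fposet P \<and> x \<noteq> y"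

definition poset_iso :: "fposet \<Rightarrow> fposet \<Rightarrow> bool" where
  "poset_iso P Q \<longleftrightarrow> (\<exists>f. bij_betw f (pcarrier P) (pcarrier Q) \<and>
     (\<forall>x\<in>pcarrier P. \<forall>y\<in>pcarrier P. plt P x y \<longleftrightarrow> plt Q (f x) (f y)))"

lemma finite_pcarrier [simp]: "finite (pcarrier P)"
  using Rep_fposet[of P] by (simp add: pcarrier_def)

lemma plt_pcarrier: "plt P x y \<Longrightarrow> x \<in> pcarrier P \<and> y \<in> pcarrier P"
  by (auto simp: plt_def pcarrier_def Field_def)

lemma poset_isoE:
  assumes "poset_iso P Q"
  obtains f g where "bij_betw f (pcarrier P) (pcarrier Q)" "bij_betw g (pcarrier Q) (pcarrier P)"
    "\<And>x y. plt P x y \<Longrightarrow> plt Q (f x) (f y)" "\<And>x y. plt Q x y \<Longrightarrow> plt P (g x) (g y)"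
    "\<And>x. x \<in> pcarrier P \<Longrightarrow> g (f x) = x" "\<And>y. y \<in> pcarrier Q \<Longrightarrow> f (g y) = y"
proof -
  obtain f where f: "bij_betw f (pcarrier P) (pcarrier Q)"
    "\<forall>x\<in>pcarrier P. \<forall>y\<in>pcarrier P. plt P x y \<longleftrightarrow> plt Q (f x) (f y)"
    using assms unfolding poset_iso_def by blast
  define g where "g = inv_into (pcarrier P) f"
  have g: "bij_betw g (pcarrier Q) (pcarrier P)"
    using f(1) unfolding g_def by (rule bij_betw_inv_into)
  have gf: "g (f x) = x" if "x \<in> pcarrier P" for x
    using f(1) that unfolding g_def by (rule bij_betw_inv_into_left)
  have fg: "f (g y) = y" if "y \<in> pcarrier Q" for y
    using f(1) that unfolding g_def by (rule bij_betw_inv_into_right)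
  have 1: "plt Q (f x) (f y)" if "plt P x y" for x y
    using f(2) that plt_pcarrier by blast
  have 2: "plt P (g x) (g y)" if "plt Q x y" for x y
  proof -
    have xy: "x \<in> pcarrier Q" "y \<in> pcarrier Q"
      using plt_pcarrier that by auto
    then have "g x \<in> pcarrier P" "g y \<in> pcarrier P"
      using g by (auto dest: bij_betwE)
    then show ?thesis using f(2) fg xy that by simp
  qed
  show ?thesis by (rule that[OF f(1) g 1 2 gf fg])
qed

lemma equivp_poset_iso: "equivp poset_iso"
proof (rule equivpI)
  show "reflp poset_iso"
    unfolding reflp_def poset_iso_def by (metis bij_betw_id id_apply)
  show "symp poset_iso"
  proof (rule sympI)
    fix P Q assume "poset_iso P Q"
    then obtain f g where *: "bij_betw g (pcarrier Q) (pcarrier P)"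
      "\<And>x y. plt P x y \<Longrightarrow> plt Q (f x) (f y)" "\<And>x y. plt Q x y \<Longrightarrow> plt P (g x) (g y)"
      "\<And>y. y \<in> pcarrier Q \<Longrightarrow> f (g y) = y"
      by (elim poset_isoE) blast
    then show "poset_iso Q P"
      unfolding poset_iso_def by (intro exI[of _ g]) metis
  qed
  show "transp poset_iso"
  proof (rule transpI)
    fix P Q R assume "poset_iso P Q" "poset_iso Q R"
    then obtain f g where f: "bij_betw f (pcarrier P) (pcarrier Q)"
        "\<forall>x\<in>pcarrier P. \<forall>y\<in>pcarrier P. plt P x y \<longleftrightarrow> plt Q (f x) (f y)"
      and g: "bij_betw g (pcarrier Q) (pcarrier R)"
        "\<forall>x\<in>pcarrier Q. \<forall>y\<in>pcarrier Q. plt Q x y \<longleftrightarrow> plt R (g x) (g y)"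
      unfolding poset_iso_def by auto
    have "\<forall>x\<in>pcarrier P. f x \<in> pcarrier Q"
      using f(1) by (auto dest: bij_betwE)
    then show "poset_iso P R"
      unfolding poset_iso_def
      using bij_betw_trans[OF f(1) g(1)] f(2) g(2) by (intro exI[of _ "g \<circ> f"]) auto
  qed
qed

quotient_type uposet = fposet / poset_iso
  by (rule equivp_poset_iso)

definition order_maps :: "fposet \<Rightarrow> fposet \<Rightarrow> (nat \<Rightarrow> nat) set" where
  "order_maps Q P =
     {\<phi> \<in> pcarrier Q \<rightarrow>\<^sub>E pcarrier P. \<forall>x y. plt Q x y \<longrightarrow> plt P (\<phi> x) (\<phi> y)}"

lemma finite_order_maps [simp]: "finite (order_maps Q P)"
  unfolding order_maps_def by (simp add: finite_PiE)

lemma card_order_maps_le: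
  assumes "poset_iso Q Q'" "poset_iso P P'"
  shows "card (order_maps Q P) \<le> card (order_maps Q' P')"
proof -
  obtain f g where f: "bij_betw f (pcarrier Q) (pcarrier Q')" "bij_betw g (pcarrier Q') (pcarrier Q)"
    "\<And>x y. plt Q x y \<Longrightarrow> plt Q' (f x) (f y)" "\<And>x y. plt Q' x y \<Longrightarrow> plt Q (g x) (g y)"
    "\<And>x. x \<in> pcarrier Q \<Longrightarrow> g (f x) = x" "\<And>y. y \<in> pcarrier Q' \<Longrightarrow> f (g y) = y"
    by (rule poset_isoE[OF assms(1)]) (rule that)
  obtain h k where h: "bij_betw h (pcarrier P) (pcarrier P')" "bij_betw k (pcarrier P') (pcarrier P)"
    "\<And>x y. plt P x y \<Longrightarrow> plt P' (h x) (h y)" "\<And>x y. plt P' x y \<Longrightarrow> plt P (k x) (k y)"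
    "\<And>x. x \<in> pcarrier P \<Longrightarrow> k (h x) = x" "\<And>y. y \<in> pcarrier P' \<Longrightarrow> h (k y) = y"
    by (rule poset_isoE[OF assms(2)]) (rule that)
  have fc: "f x \<in> pcarrier Q'" if "x \<in> pcarrier Q" for x
    using f(1) that by (auto dest: bij_betwE)
  have gc: "g x \<in> pcarrier Q" if "x \<in> pcarrier Q'" for x
    using f(2) that by (auto dest: bij_betwE)
  have hc: "h x \<in> pcarrier P'" if "x \<in> pcarrier P" for x
    using h(1) that by (auto dest: bij_betwE)
  define F where "F \<phi> = restrict (\<lambda>x. h (\<phi> (g x))) (pcarrier Q')" for \<phi>
  have "inj_on F (order_maps Q P)"
  proof (rule inj_onI)
    fix \<phi> \<psi> assume \<phi>: "\<phi> \<in> order_maps Q P" and \<psi>: "\<psi> \<in> order_maps Q P" and eq: "F \<phi> = F \<psi>"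
    have "\<phi> x = \<psi> x" if x: "x \<in> pcarrier Q" for x
    proof -
      have "h (\<phi> x) = h (\<psi> x)"
        using fun_cong[OF eq, of "f x"] fc[OF x] f(5)[OF x] by (simp add: F_def)
      moreover have "\<phi> x \<in> pcarrier P" "\<psi> x \<in> pcarrier P"
        using \<phi> \<psi> x by (auto simp: order_maps_def)
      ultimately show ?thesis by (metis h(5))
    qed
    moreover have "\<phi> \<in> extensional (pcarrier Q)" "\<psi> \<in> extensional (pcarrier Q)"
      using \<phi> \<psi> by (auto simp: order_maps_def PiE_def)
    ultimately show "\<phi> = \<psi>" by (intro extensionalityI) auto
  qed
  moreover have "F ` order_maps Q P \<subseteq> order_maps Q' P'"
  proof safe
    fix \<phi> assume \<phi>: "\<phi> \<in> order_maps Q P"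
    have "F \<phi> \<in> pcarrier Q' \<rightarrow>\<^sub>E pcarrier P'"
      using \<phi> gc hc by (auto simp: F_def order_maps_def PiE_def Pi_def)
    moreover have "plt P' (F \<phi> x) (F \<phi> y)" if "plt Q' x y" for x y
      using that plt_pcarrier[OF that] f(4) h(3) \<phi> by (auto simp: F_def order_maps_def)
    ultimately show "F \<phi> \<in> order_maps Q' P'" by (simp add: order_maps_def)
  qed
  ultimately show ?thesis by (rule card_inj_on_le) simp
qed

lemma poset_iso_sym: "poset_iso P Q \<Longrightarrow> poset_iso Q P"
  using equivp_symp[OF equivp_poset_iso] .

lemma poset_iso_card: "poset_iso P Q \<Longrightarrow> card (pcarrier P) = card (pcarrier Q)"
  by (auto simp: poset_iso_def intro: bij_betw_same_card)

definition order_density :: "fposet \<Rightarrow> fposet \<Rightarrow> real" where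
  "order_density Q P =
     real (card (order_maps Q P)) / real (card (pcarrier Q \<rightarrow>\<^sub>E pcarrier P))"

lift_definition t_poset :: "uposet \<Rightarrow> uposet \<Rightarrow> real" is order_density
proof -
  fix Q Q' P P' assume *: "poset_iso Q Q'" "poset_iso P P'"
  have "card (order_maps Q P) = card (order_maps Q' P')"
    using card_order_maps_le[OF *] card_order_maps_le[OF *[THEN poset_iso_sym]] by simp
  then show "order_density Q P = order_density Q' P'"
    using *[THEN poset_iso_card] by (simp add: order_density_def card_PiE)
qed

lift_definition size_poset :: "uposet \<Rightarrow> nat" is "\<lambda>P. card (pcarrier P)"
  by (rule poset_iso_card)

definition has_interval_order :: "fposet \<Rightarrow> bool" where
  "has_interval_order P \<longleftrightarrow> (\<exists>I :: nat \<Rightarrow> real set.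
     (\<forall>p\<in>pcarrier P. is_interval (I p) \<and> I p \<noteq> {}) \<and>
     (\<forall>p\<in>pcarrier P. \<forall>q\<in>pcarrier P. plt P p q \<longleftrightarrow> (\<forall>x\<in>I p. \<forall>y\<in>I q. x < y)))"

lemma has_interval_order_iso:
  assumes "poset_iso P Q" "has_interval_order P"
  shows "has_interval_order Q"
proof -
  obtain I :: "nat \<Rightarrow> real set" where I: "\<forall>p\<in>pcarrier P. is_interval (I p) \<and> I p \<noteq> {}"
    "\<forall>p\<in>pcarrier P. \<forall>q\<in>pcarrier P. plt P p q \<longleftrightarrow> (\<forall>x\<in>I p. \<forall>y\<in>I q. x < y)"
    using assms(2) unfolding has_interval_order_def by blast
  obtain g where g: "bij_betw g (pcarrier Q) (pcarrier P)"
    "\<forall>x\<in>pcarrier Q. \<forall>y\<in>pcarrier Q. plt Q x y \<longleftrightarrow> plt P (g x) (g y)"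
    using poset_iso_sym[OF assms(1)] unfolding poset_iso_def by blast
  have "g x \<in> pcarrier P" if "x \<in> pcarrier Q" for x
    using g(1) that by (auto dest: bij_betwE)
  then show ?thesis
    unfolding has_interval_order_def using I g(2) by (intro exI[of _ "I \<circ> g"]) auto
qed

lift_definition interval_order :: "uposet \<Rightarrow> bool" is has_interval_order
  using has_interval_order_iso poset_iso_sym by blast

section \<open>Poset limits\<close>

text \<open>
  The ambient space carries the product topology. On the closure, the continuous extension
  of \<open>t_poset Q\<close> is the coordinate projection \<open>t_ext Q\<close>.
\<close>

definition poset_embed :: "uposet \<Rightarrow> (uposet \<Rightarrow> real) \<times> real" where
  "poset_embed P = ((\<lambda>Q. t_poset Q P), 1 / real (size_poset P))"

definition poset_completion :: "((uposet \<Rightarrow> real) \<times> real) set" where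
  "poset_completion = closure (range poset_embed)"

definition poset_limits :: "((uposet \<Rightarrow> real) \<times> real) set" where
  "poset_limits = poset_completion - range poset_embed"

definition t_ext :: "uposet \<Rightarrow> (uposet \<Rightarrow> real) \<times> real \<Rightarrow> real" where
  "t_ext Q X = fst X Q"

definition interval_order_limits :: "((uposet \<Rightarrow> real) \<times> real) set" where
  "interval_order_limits = {X \<in> poset_limits.
     \<exists>P. (\<forall>n. interval_order (P n)) \<and> (\<lambda>n. poset_embed (P n)) \<longlonglongrightarrow> X}"

definition kernel_density :: "('a \<Rightarrow> 'a \<Rightarrow> real) \<Rightarrow> 'a measure \<Rightarrow> fposet \<Rightarrow> real" where
  "kernel_density W \<mu> Q =
     (\<integral>x. (\<Prod>(i, j)\<in>{(i, j). plt Q i j}. W (x i) (x j)) \<partial>(\<Pi>\<^sub>M i\<in>pcarrier Q. \<mu>))"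

text \<open>
  Quantifying over labelled representatives \<open>Q\<close> avoids choosing one for each unlabelled poset.
\<close>

definition kernel_limit :: "('a \<Rightarrow> 'a \<Rightarrow> real) \<Rightarrow> 'a measure \<Rightarrow> (uposet \<Rightarrow> real) \<times> real" where
  "kernel_limit W \<mu> =
     (THE X. X \<in> poset_limits \<and> (\<forall>Q. t_ext (abs_uposet Q) X = kernel_density W \<mu> Q))"

section \<open>The interval kernel and its measures\<close>

definition S_I :: "(real \<times> real) set" where
  "S_I = {(x, y). 0 \<le> x \<and> x \<le> y \<and> y \<le> 1}"

definition prec_I :: "real \<times> real \<Rightarrow> real \<times> real \<Rightarrow> bool" where
  "prec_I p q \<longleftrightarrow> snd p < fst q"

definition W_I :: "real \<times> real \<Rightarrow> real \<times> real \<Rightarrow> real" where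
  "W_I p q = (if prec_I p q then 1 else 0)"

definition interval_limit :: "(real \<times> real) measure \<Rightarrow> (uposet \<Rightarrow> real) \<times> real" where
  "interval_limit \<mu> = kernel_limit W_I \<mu>"

definition left_marginal :: "(real \<times> real) measure \<Rightarrow> real measure" where
  "left_marginal \<mu> = distr \<mu> (restrict_space borel {0..1}) fst"

definition right_marginal :: "(real \<times> real) measure \<Rightarrow> real measure" where
  "right_marginal \<mu> = distr \<mu> (restrict_space borel {0..1}) snd"

definition P_L :: "(real \<times> real) measure set" where
  "P_L = {\<mu>. prob_space \<mu> \<and> sets \<mu> = sets (restrict_space borel S_I) \<and>
     left_marginal \<mu> = restrict_space lborel {0..1}}"

definition on_square :: "(real \<times> real) measure \<Rightarrow> (real \<times> real) measure" where
  "on_square \<mu> = distr \<mu> (restrict_space borel ({0..1} \<times> {0..1})) (\<lambda>p. p)"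

text \<open>
  Sigma-finiteness of \<open>\<nu>\<close> only ensures that \<open>\<Otimes>\<^sub>M\<close> is the genuine product measure;
  for \<open>a < b\<close> comparing total masses forces \<open>\<nu>\<close> to be a probability measure anyway.
\<close>

definition P_L_star :: "(real \<times> real) measure set" where
  "P_L_star = {\<mu> \<in> P_L. \<forall>a b. 0 \<le> a \<and> a < b \<and> b \<le> 1 \<and>
       emeasure (right_marginal \<mu>) {a<..<b} = 0 \<longrightarrow>
     (\<exists>\<nu>. sigma_finite_measure \<nu> \<and> sets \<nu> = sets (restrict_space borel {0..1}) \<and>
        restrict_space (on_square \<mu>) ({a<..<b} \<times> {0..1}) =
          restrict_space lborel {a<..<b} \<Otimes>\<^sub>M \<nu>)}"

end

theory Submission
  imports Defs
begin

text \<open>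
  \<^emph>\<open>Every measure gives a limit.\<close> Since the left marginal is continuous, \<open>y\<^sub>i \<noteq> x\<^sub>j\<close> almost surely
  for independent intervals, so the kernel is almost surely continuous and densities pass to limits
  by dominated convergence as soon as the intervals converge almost surely.

  \<^emph>\<open>Every limit comes from a measure.\<close> A finite interval order has the same densities as a suitable
  measure with uniform left marginal; these measures have a convergent subsequence. Redistributing
  the left endpoints uniformly inside each gap of the right marginal does not affect the order,
  hence not the densities.

  \<^emph>\<open>The measure is determined.\<close> An interval \<open>[x, y]\<close> has the proportion \<open>G x = \<mu>\<^sub>R [0, x)\<close> of intervals
  to its left and the proportion \<open>1 - y\<close> to its right. The mixed moments of these two numbers are
  densities of posets, so the joint law of \<open>G x\<close> and \<open>y\<close> is determined. This recovers \<open>x\<close> except inside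
  the gaps, where it is uniform and independent of \<open>y\<close>.
\<close>

section \<open>Kernel densities\<close>

text \<open>Two obstacles shape the argument. A poset compares a left endpoint only with right
  endpoints, so densities cannot see how left endpoints are arranged inside a gap of the right
  marginal; a uniform left marginal alone leaves this freedom, and \<open>P_L_star\<close> removes
  it. And \<open>W_I\<close> jumps at ties, so weak convergence of laws does not pass to densities
  directly; therefore laws are realised as images of real random variables on one common probability
  space, where weak convergence becomes convergence almost everywhere.

  One device serves two purposes, the randomised rank of a variable \<open>Z\<close>. With
  \<open>Z\<close> the left endpoint in a finite order, it turns a discrete law into the uniform
  one. With \<open>Z = G x\<close>, the atoms are the level sets of \<open>G\<close> of positive
  length, that is, the gaps, and ranking redistributes the left endpoint uniformly in each of them.

  The mixed moments are densities of posets with one distinguished element: given its interval, the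
  conditions on all other elements are independent.\<close>

lemma measurable_fst_snd_borel [measurable]:
  "fst \<in> borel_measurable (borel :: (real \<times> real) measure)"
  "snd \<in> borel_measurable (borel :: (real \<times> real) measure)"
  by (auto intro!: borel_measurable_continuous_onI continuous_intros)

lemma AE_pair_fst:
  assumes "sigma_finite_measure N" "AE x in M. P x"
  shows "AE z in M \<Otimes>\<^sub>M N. P (fst z)"
proof -
  interpret sigma_finite_measure N by fact
  obtain A where A: "A \<in> sets M" "emeasure M A = 0" "{x \<in> space M. \<not> P x} \<subseteq> A"
    using assms(2) by (auto elim: AE_E)
  show ?thesis
    using A by (intro AE_I[of _ _ "A \<times> space N"]) (auto simp: emeasure_pair_measure_Times
      space_pair_measure)
qed

lemma AE_pair_snd:
  assumes "sigma_finite_measure N" "AE x in N. P x"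
  shows "AE z in M \<Otimes>\<^sub>M N. P (snd z)"
proof -
  interpret sigma_finite_measure N by fact
  obtain A where A: "A \<in> sets N" "emeasure N A = 0" "{x \<in> space N. \<not> P x} \<subseteq> A"
    using assms(2) by (auto elim: AE_E)
  show ?thesis
    using A by (intro AE_I[of _ _ "space M \<times> A"]) (auto simp: emeasure_pair_measure_Times
      space_pair_measure)
qed

text \<open>Two different coordinates of a product sample are independent with law \<open>M\<close>,
  so a null set of pairs stays null when it is tested on them. Since \<open>plt\<close> is
  irreflexive, this applies to every relation of a poset.\<close>

lemma AE_PiM_pair:
  fixes M :: "'a measure"
  assumes M: "prob_space M" and I: "finite I" "i \<in> I" "j \<in> I" "i \<noteq> j"
    and ae: "AE z in M \<Otimes>\<^sub>M M. P (fst z) (snd z)"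
  shows "AE x in PiM I (\<lambda>_. M). P (x i) (x j)"
proof -
  interpret prob_space M by fact
  interpret product_prob_space "\<lambda>_. M" I by standard
  have m: "(\<lambda>x. (x i, x j)) \<in> PiM I (\<lambda>_. M) \<rightarrow>\<^sub>M M \<Otimes>\<^sub>M M"
    using I by measurable
  have eq: "M \<Otimes>\<^sub>M M = distr (PiM I (\<lambda>_. M)) (M \<Otimes>\<^sub>M M) (\<lambda>x. (x i, x j))"
  proof (rule pair_measure_eqI)
    fix A B assume AB: "A \<in> sets M" "B \<in> sets M"
    have "emeasure (distr (PiM I (\<lambda>_. M)) (M \<Otimes>\<^sub>M M) (\<lambda>x. (x i, x j))) (A \<times> B)
      = emeasure (PiM I (\<lambda>_. M)) {x \<in> space (PiM I (\<lambda>_. M)). \<forall>l\<in>{i,j}. x l \<in> (if l = i then A else B)}"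
      using AB m I by (subst emeasure_distr) (auto intro!: arg_cong2[where f=emeasure])
    also have "\<dots> = (\<Prod>l\<in>{i,j}. emeasure M (if l = i then A else B))"
      using AB I by (intro emeasure_PiM_Collect) auto
    also have "\<dots> = emeasure M A * emeasure M B"
      using I by simp
    finally show "emeasure M A * emeasure M B =
       emeasure (distr (PiM I (\<lambda>_. M)) (M \<Otimes>\<^sub>M M) (\<lambda>x. (x i, x j))) (A \<times> B)" by simp
  qed (simp_all, (rule prob_space_imp_sigma_finite[OF M])+)
  then have "AE z in distr (PiM I (\<lambda>_. M)) (M \<Otimes>\<^sub>M M) (\<lambda>x. (x i, x j)). P (fst z) (snd z)"
    using ae by (subst eq[symmetric])
  from AE_distrD[OF m this] show ?thesis by simp
qed

lemma finite_plt [simp]: "finite {(i, j). plt Q i j}"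
  by (rule finite_subset[of _ "pcarrier Q \<times> pcarrier Q"]) (auto dest: plt_pcarrier)

lemma plt_irrefl: "\<not> plt Q i i"
  by (simp add: plt_def)

lemma AE_PiM_plt:
  assumes M: "prob_space M" and ae: "AE z in M \<Otimes>\<^sub>M M. P (fst z) (snd z)"
  shows "AE x in PiM (pcarrier Q) (\<lambda>_. M). \<forall>e\<in>{(i, j). plt Q i j}. P (x (fst e)) (x (snd e))"
proof (rule AE_finite_allI[OF finite_plt])
  fix e assume "e \<in> {(i, j). plt Q i j}"
  then have "fst e \<in> pcarrier Q" "snd e \<in> pcarrier Q" "fst e \<noteq> snd e"
    using plt_pcarrier plt_irrefl by auto
  then show "AE x in PiM (pcarrier Q) (\<lambda>_. M). P (x (fst e)) (x (snd e))"
    by (intro AE_PiM_pair M ae) auto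
qed

lemma measurable_kernel_prod:
  assumes W: "case_prod W \<in> borel_measurable (M \<Otimes>\<^sub>M M)"
  shows "(\<lambda>x. \<Prod>(i, j)\<in>{(i, j). plt Q i j}. W (x i) (x j) :: real)
    \<in> borel_measurable (PiM (pcarrier Q) (\<lambda>_. M))"
proof (rule borel_measurable_prod, clarify)
  fix i j assume "plt Q i j"
  then have "(\<lambda>x. (x i, x j)) \<in> PiM (pcarrier Q) (\<lambda>_. M) \<rightarrow>\<^sub>M M \<Otimes>\<^sub>M M"
    using plt_pcarrier by (intro measurable_Pair measurable_component_singleton) auto
  from measurable_compose[OF this W]
  show "(\<lambda>x. W (x i) (x j)) \<in> borel_measurable (PiM (pcarrier Q) (\<lambda>_. M))" by simp
qed

text \<open>Sampling from an image measure is applying \<open>f\<close> to every coordinate of a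
  sample from \<open>M\<close>; this moves a density to whatever probability space is most
  convenient.\<close>

lemma kernel_density_distr:
  assumes M: "prob_space M" and f: "f \<in> M \<rightarrow>\<^sub>M N"
    and W: "case_prod W \<in> borel_measurable (N \<Otimes>\<^sub>M N)"
  shows "kernel_density W (distr M N f) Q = kernel_density (\<lambda>p q. W (f p) (f q)) M Q"
proof -
  interpret prob_space M by fact
  have "PiM (pcarrier Q) (\<lambda>_. distr M N f)
    = distr (PiM (pcarrier Q) (\<lambda>_. M)) (PiM (pcarrier Q) (\<lambda>_. N)) (compose (pcarrier Q) f)"
  proof -
    \<comment> \<open>As a target, a measure enters \<open>distr\<close> only through its
      sigma-algebra, so \<open>distr M N f\<close> and \<open>N\<close> are interchangeable
      there.\<close>
    have [simp]: "distr M (distr M N f) f = distr M N f"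
      by (rule distr_cong) auto
    have [simp]: "distr A (PiM (pcarrier Q) (\<lambda>_. distr M N f)) h = distr A (PiM (pcarrier Q) (\<lambda>_. N)) h"
      for A :: "(nat \<Rightarrow> 'a) measure" and h
      by (rule distr_cong) (simp_all, intro sets_PiM_cong, simp_all)
    show ?thesis
      using distr_PiM_finite_prob_space'[of "pcarrier Q" "\<lambda>_. M" "\<lambda>_. distr M N f" f] M f
        prob_space_distr[OF f] by auto
  qed
  moreover have "compose (pcarrier Q) f \<in> PiM (pcarrier Q) (\<lambda>_. M) \<rightarrow>\<^sub>M PiM (pcarrier Q) (\<lambda>_. N)"
    using f unfolding compose_def by measurable
  ultimately show ?thesis
    unfolding kernel_density_def
    by (simp only: integral_distr[OF _ measurable_kernel_prod[OF W]])
      (auto simp: compose_def intro!: measurable_kernel_prod[OF W] Bochner_Integration.integral_cong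
        prod.cong dest!: plt_pcarrier)
qed

lemma kernel_density_cong_AE:
  assumes M: "prob_space M"
    and U: "case_prod U \<in> borel_measurable (M \<Otimes>\<^sub>M M)" and V: "case_prod V \<in> borel_measurable (M \<Otimes>\<^sub>M M)"
    and ae: "AE z in M \<Otimes>\<^sub>M M. U (fst z) (snd z) = V (fst z) (snd z)"
  shows "kernel_density U M Q = kernel_density V M Q"
  unfolding kernel_density_def
proof (rule integral_cong_AE)
  have "AE x in PiM (pcarrier Q) (\<lambda>_. M). \<forall>e\<in>{(i, j). plt Q i j}. U (x (fst e)) (x (snd e))
    = V (x (fst e)) (x (snd e))"
    using AE_PiM_plt[OF M ae] .
  then show "AE x in PiM (pcarrier Q) (\<lambda>_. M). (\<Prod>(i, j)\<in>{(i, j). plt Q i j}. U (x i) (x j))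
    = (\<Prod>(i, j)\<in>{(i, j). plt Q i j}. V (x i) (x j))"
    by eventually_elim (auto intro!: prod.cong)
qed (intro measurable_kernel_prod U V)+

text \<open>A poset has finitely many relations, so convergence for almost every pair gives
  convergence of the product, which the constant 1 dominates.\<close>

lemma kernel_density_tendsto:
  fixes W :: "nat \<Rightarrow> 'a \<Rightarrow> 'a \<Rightarrow> real"
  assumes M: "prob_space M"
    and W: "\<And>n. case_prod (W n) \<in> borel_measurable (M \<Otimes>\<^sub>M M)" and V:
      "case_prod V \<in> borel_measurable (M \<Otimes>\<^sub>M M)"
    and bd: "\<And>n p q. \<bar>W n p q\<bar> \<le> 1"
    and ae: "AE z in M \<Otimes>\<^sub>M M. (\<lambda>n. W n (fst z) (snd z)) \<longlonglongrightarrow> V (fst z) (snd z)"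
  shows "(\<lambda>n. kernel_density (W n) M Q) \<longlonglongrightarrow> kernel_density V M Q"
  unfolding kernel_density_def
proof (rule integral_dominated_convergence[where w="\<lambda>_. 1"])
  interpret prob_space M by fact
  interpret product_prob_space "\<lambda>_. M" "pcarrier Q" by standard
  have "AE x in PiM (pcarrier Q) (\<lambda>_. M). \<forall>e\<in>{(i, j). plt Q i j}.
     (\<lambda>n. W n (x (fst e)) (x (snd e))) \<longlonglongrightarrow> V (x (fst e)) (x (snd e))"
    using AE_PiM_plt[OF M ae] .
  then show "AE x in PiM (pcarrier Q) (\<lambda>_. M). (\<lambda>n. \<Prod>(i, j)\<in>{(i, j). plt Q i j}. W n (x i) (x j))
    \<longlonglongrightarrow> (\<Prod>(i, j)\<in>{(i, j). plt Q i j}. V (x i) (x j))"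
    by eventually_elim (auto intro!: tendsto_prod)
  show "AE x in PiM (pcarrier Q) (\<lambda>_. M). norm (\<Prod>(i, j)\<in>{(i, j). plt Q i j}. W n (x i) (x j)) \<le> 1" for n
    using bd by (auto simp: abs_prod intro!: AE_I2 prod_le_1)
  show "integrable (PiM (pcarrier Q) (\<lambda>_. M)) (\<lambda>_. 1 :: real)" 
    by simp
qed (intro measurable_kernel_prod W V)+

lemma W_I_comp_measurable:
  assumes [measurable]: "f \<in> borel_measurable M"
  shows "(\<lambda>(p, q). W_I (f p) (f q)) \<in> borel_measurable (M \<Otimes>\<^sub>M M)"
proof -
  have [measurable]: "(\<lambda>p. fst (f p)) \<in> borel_measurable M" "(\<lambda>p. snd (f p)) \<in> borel_measurable M"
    by (rule measurable_compose[OF assms]; measurable)+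
  show ?thesis
    unfolding W_I_def prec_I_def by measurable
qed

text \<open>\<open>W_I\<close> only looks at the sign of a left endpoint minus a right endpoint. If
  the limit of this difference is not 0, the sign is eventually constant and the kernel eventually
  equals its limit; \<open>ne\<close> makes the remaining case null.\<close>

lemma kernel_density_W_I_tendsto:
  fixes f :: "nat \<Rightarrow> 'a \<Rightarrow> real \<times> real"
  assumes M: "prob_space M"
    and f: "\<And>n. f n \<in> borel_measurable M" and g: "g \<in> borel_measurable M"
    and conv: "AE p in M. (\<lambda>n. f n p) \<longlonglongrightarrow> g p"
    and ne: "AE z in M \<Otimes>\<^sub>M M. snd (g (fst z)) \<noteq> fst (g (snd z))"
  shows "(\<lambda>n. kernel_density (\<lambda>p q. W_I (f n p) (f n q)) M Q) \<longlonglongrightarrow> kernel_density (\<lambda>p q. W_I (g p) (g q)) M Q"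
proof (rule kernel_density_tendsto[OF M])
  interpret prob_space M by fact
  interpret pair_prob_space M M ..
  have 1: "AE z in M \<Otimes>\<^sub>M M. (\<lambda>n. f n (fst z)) \<longlonglongrightarrow> g (fst z)"
    by (intro AE_pair_fst conv prob_space_imp_sigma_finite M)
  have 2: "AE z in M \<Otimes>\<^sub>M M. (\<lambda>n. f n (snd z)) \<longlonglongrightarrow> g (snd z)"
    by (intro AE_pair_snd conv prob_space_imp_sigma_finite M)
  from 1 2 ne show "AE z in M \<Otimes>\<^sub>M M. (\<lambda>n. W_I (f n (fst z)) (f n (snd z))) \<longlonglongrightarrow> W_I (g (fst z)) (g (snd z))"
  proof eventually_elim
    case (elim z)
    have t: "(\<lambda>n. fst (f n (snd z)) - snd (f n (fst z))) \<longlonglongrightarrow> fst (g (snd z)) - snd (g (fst z))"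
      by (intro tendsto_intros elim)
    show ?case
    proof (cases "snd (g (fst z)) < fst (g (snd z))")
      case True
      then have "\<forall>\<^sub>F n in sequentially. 0 < fst (f n (snd z)) - snd (f n (fst z))"
        using order_tendstoD(1)[OF t, of 0] by simp
      then show ?thesis
        using True by (intro tendsto_eventually) (auto simp: W_I_def prec_I_def elim!: eventually_mono)
    next
      case False
      then have "\<forall>\<^sub>F n in sequentially. fst (f n (snd z)) - snd (f n (fst z)) < 0"
        using order_tendstoD(2)[OF t, of 0] elim(3) by simp
      then show ?thesis
        using False by (intro tendsto_eventually) (auto simp: W_I_def prec_I_def elim!: eventually_mono)
    qed
  qed
qed (auto simp: W_I_def intro!: W_I_comp_measurable[unfolded W_I_def] f g)

section \<open>A space-filling curve\<close>

text \<open>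
  Schoenberg's plane-filling curve: \<open>bump\<close> has period \<open>2\<close> and takes the value of the leading digit on
  the numbers whose ternary expansion uses only the digits \<open>0\<close> and \<open>2\<close>. The curve transports
  Helly's and Skorohod's theorems from the real line to the triangle \<open>S_I\<close>.
\<close>

definition bump :: "real \<Rightarrow> real" where
  "bump t = max 0 (min 1 (1 / 2 - cos (pi * t)))"

definition ternary :: "(nat \<Rightarrow> nat) \<Rightarrow> real" where
  "ternary e = (\<Sum>j. 2 * real (e j) / 3 ^ Suc j)"

lemma ternary_bounds:
  assumes "\<And>j. e j \<le> 1"
  shows "summable (\<lambda>j. 2 * real (e j) / 3 ^ Suc j)" "0 \<le> ternary e" "ternary e \<le> 1"
proof -
  have s: "(\<lambda>j. 2 / 3 * (1 / 3) ^ j :: real) sums (2 / 3 * (1 / (1 - 1 / 3)))"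
    by (intro sums_mult geometric_sums) simp
  have le: "2 * real (e j) / 3 ^ Suc j \<le> 2 / 3 * (1 / 3) ^ j" for j
    using assms[of j] by (simp add: power_divide field_simps)
  show sm: "summable (\<lambda>j. 2 * real (e j) / 3 ^ Suc j)"
    using le by (intro summable_comparison_test'[OF sums_summable[OF s]]) auto
  show "0 \<le> ternary e"
    unfolding ternary_def by (intro suminf_nonneg sm) auto
  have "ternary e \<le> (\<Sum>j. 2 / 3 * (1 / 3) ^ j)"
    unfolding ternary_def by (intro suminf_le le sm sums_summable[OF s])
  also have "\<dots> = 1" using sums_unique[OF s] by simp
  finally show "ternary e \<le> 1" .
qed

lemma ternary_unfold:
  assumes "\<And>j. e j \<le> 1"
  shows "ternary e = 2 * real (e 0) / 3 + ternary (\<lambda>j. e (Suc j)) / 3"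
proof -
  have "ternary e = (\<Sum>j. 2 * real (e (Suc j)) / 3 ^ Suc (Suc j)) + 2 * real (e 0) / 3"
    using suminf_split_head[OF ternary_bounds(1), of e] assms by (simp add: ternary_def)
  also have "(\<Sum>j. 2 * real (e (Suc j)) / 3 ^ Suc (Suc j)) = (\<Sum>j. 2 * real (e (Suc j)) / 3 ^ Suc j / 3)"
    by (simp add: field_simps)
  also have "\<dots> = ternary (\<lambda>j. e (Suc j)) / 3"
    unfolding ternary_def
    by (rule suminf_divide) (rule ternary_bounds(1), rule assms)
  finally show ?thesis by simp
qed

lemma bump_periodic: "bump (x + 2 * real n) = bump x"
proof -
  have "pi * (x + 2 * real n) = pi * x + real n * (2 * pi)"
    by (simp add: algebra_simps)
  moreover have "cos (pi * x + real n * (2 * pi)) = cos (pi * x)"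
    using cos.plus_of_nat[of "pi * x" n] by simp
  ultimately show ?thesis
    unfolding bump_def by (simp only:)
qed

text \<open>Multiplying by 3 moves the leading digit into the integer part as an even number, which
  the period 2 removes. The leading digit itself decides whether the argument is at most 1/3 or at
  least 2/3, and there the truncated cosine is exactly 0 or 1.\<close>

lemma bump_ternary:
  assumes "\<And>j. e j \<le> 1"
  shows "bump (3 ^ k * ternary e) = real (e k)"
  using assms
proof (induction k arbitrary: e)
  case 0
  define r where "r = ternary (\<lambda>j. e (Suc j))"
  have r: "0 \<le> r" "r \<le> 1"
    unfolding r_def by (rule ternary_bounds, rule 0)+
  have t: "ternary e = 2 * real (e 0) / 3 + r / 3"
    using ternary_unfold[of e, OF 0] by (simp add: r_def)
  consider "e 0 = 0" | "e 0 = 1" using 0[of 0] by linarith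
  then show ?case
  proof cases
    case 1
    have "cos (pi / 3) \<le> cos (pi * ternary e)"
    proof (rule cos_monotone_0_pi_le)
      show "0 \<le> pi * ternary e" using r t by simp
      show "pi * ternary e \<le> pi / 3"
        using mult_left_mono[of "ternary e" "1 / 3" pi] r t 1 by simp
    qed simp
    then show ?thesis using 1 by (simp add: bump_def cos_60)
  next
    case 2
    have "cos (pi * ternary e) \<le> cos (pi - pi / 3)"
    proof (rule cos_monotone_0_pi_le)
      show "pi * ternary e \<le> pi"
        using mult_left_mono[of "ternary e" 1 pi] r t 2 by simp
      show "pi - pi / 3 \<le> pi * ternary e"
        using mult_left_mono[of "2 / 3" "ternary e" pi] r t 2 by simp
    qed simp
    then show ?thesis using 2 by (simp add: bump_def cos_120)
  qed
next
  case (Suc k)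
  have "3 ^ Suc k * ternary e = 3 ^ k * ternary (\<lambda>j. e (Suc j)) + 2 * real (3 ^ k * e 0)"
    by (subst ternary_unfold[of e, OF Suc.prems]) (simp add: field_simps)
  then have "bump (3 ^ Suc k * ternary e) = bump (3 ^ k * ternary (\<lambda>j. e (Suc j)))"
    by (simp only: bump_periodic)
  also have "\<dots> = real (e (Suc k))" by (rule Suc.IH) (rule Suc.prems)
  finally show ?case .
qed

definition binary_digit :: "real \<Rightarrow> nat \<Rightarrow> nat" where
  "binary_digit x k = nat (\<lfloor>2 ^ Suc k * x\<rfloor> mod 2)"

lemma binary_digit_le: "binary_digit x k \<le> 1"
proof -
  have "\<lfloor>2 ^ Suc k * x\<rfloor> mod 2 \<le> 1" by simp
  then show ?thesis by (simp add: binary_digit_def nat_le_iff)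
qed

lemma binary_digit_sums:
  assumes "0 \<le> x" "x < 1"
  shows "(\<lambda>k. real (binary_digit x k) / 2 ^ Suc k) sums x"
proof -
  \<comment> \<open>The partial sum is the dyadic truncation of \<open>x\<close>; that
    \<open>x\<close> is in \<open>[0, 1)\<close> makes this right for the empty sum.\<close>
  have eq: "(\<Sum>k<n. real (binary_digit x k) / 2 ^ Suc k) = \<lfloor>2 ^ n * x\<rfloor> / 2 ^ n" for n
  proof (induction n)
    case 0
    then show ?case using assms by (simp add: floor_eq_iff)
  next
    case (Suc n)
    have "\<lfloor>2 ^ Suc n * x\<rfloor> div 2 = \<lfloor>2 ^ Suc n * x / 2\<rfloor>"
      by (simp add: floor_divide_real_eq_div[of 2, symmetric])
    also have "\<dots> = \<lfloor>2 ^ n * x\<rfloor>" by simp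
    finally have "\<lfloor>2 ^ Suc n * x\<rfloor> = 2 * \<lfloor>2 ^ n * x\<rfloor> + \<lfloor>2 ^ Suc n * x\<rfloor> mod 2"
      by (metis mult_div_mod_eq)
    then have "real_of_int \<lfloor>2 ^ Suc n * x\<rfloor> = 2 * real_of_int \<lfloor>2 ^ n * x\<rfloor> + real (binary_digit x n)"
      unfolding binary_digit_def by (metis of_int_add of_int_mult of_int_numeral of_nat_nat
          pos_mod_sign zero_less_numeral)
    then show ?case unfolding sum.lessThan_Suc Suc.IH by (simp add: field_simps)
  qed
  have "(\<lambda>n. \<lfloor>2 ^ n * x\<rfloor> / 2 ^ n) \<longlonglongrightarrow> x"
  proof (rule tendsto_sandwich)
    show "\<forall>\<^sub>F n in sequentially. x - (1 / 2) ^ n \<le> \<lfloor>2 ^ n * x\<rfloor> / 2 ^ n"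
    proof (intro always_eventually allI)
      fix n
      have "2 ^ n * x - 1 \<le> \<lfloor>2 ^ n * x\<rfloor>" by linarith
      then have "(2 ^ n * x - 1) / 2 ^ n \<le> \<lfloor>2 ^ n * x\<rfloor> / 2 ^ n" by (intro divide_right_mono) auto
      then show "x - (1 / 2) ^ n \<le> \<lfloor>2 ^ n * x\<rfloor> / 2 ^ n"
        by (simp add: power_divide diff_divide_distrib)
    qed
    show "\<forall>\<^sub>F n in sequentially. \<lfloor>2 ^ n * x\<rfloor> / 2 ^ n \<le> x"
      by (intro always_eventually allI) (simp add: divide_le_eq mult.commute)
    show "(\<lambda>n. x - (1 / 2) ^ n) \<longlonglongrightarrow> x"
      using tendsto_diff[OF tendsto_const LIMSEQ_realpow_zero[of "1 / 2"], of x] by simp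
  qed auto
  then show ?thesis unfolding sums_def eq .
qed

text \<open>The terms are at most \<open>(1 / 2) ^ Suc n\<close> whatever the frequencies
  \<open>a k\<close>, so the convergence is uniform.\<close>

lemma bump_series_continuous:
  fixes a :: "nat \<Rightarrow> real"
  shows "continuous_on UNIV (\<lambda>t. \<Sum>k. bump (a k * t) / 2 ^ Suc k)"
proof -
  have b: "\<bar>bump t\<bar> \<le> 1" for t by (auto simp: bump_def)
  have "uniform_limit UNIV (\<lambda>n t. \<Sum>k<n. bump (a k * t) / 2 ^ Suc k) (\<lambda>t. \<Sum>k. bump (a k * t) / 2 ^ Suc k)
    sequentially"
  proof (rule Weierstrass_m_test)
    show "norm (bump (a n * x) / 2 ^ Suc n) \<le> (1 / 2) ^ Suc n" for n x
      using b[of "a n * x"] by (simp add: power_divide divide_simps)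
    show "summable (\<lambda>n. (1 / 2 :: real) ^ Suc n)"
      using summable_geometric[of "1 / 2 :: real"] by simp
  qed
  then show ?thesis
  proof (rule uniform_limit_theorem[rotated])
    show "\<forall>\<^sub>F n in sequentially. continuous_on UNIV (\<lambda>t. \<Sum>k<n. bump (a k * t) / 2 ^ Suc k)"
      unfolding bump_def by (intro always_eventually allI continuous_intros) auto
  qed simp
qed

text \<open>\<open>s\<close> is only a measurable section of the continuous \<open>\<rho>\<close>.
  That is enough: \<open>s\<close> pushes measures to the line, limits are taken there, and
  \<open>\<rho>\<close> carries them back, with values in \<open>S_I\<close> even at points outside
  the range of \<open>s\<close>.\<close>

lemma space_filling_curve:
  obtains \<rho> :: "real \<Rightarrow> real \<times> real" and s :: "real \<times> real \<Rightarrow> real"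
  where "continuous_on UNIV \<rho>" "\<And>t. \<rho> t \<in> S_I" "s \<in> borel_measurable borel"
    "\<And>p. p \<in> S_I \<Longrightarrow> \<rho> (s p) = p" "\<And>p. 0 \<le> s p" "\<And>p. s p \<le> 1"
proof -
  \<comment> \<open>Halving the coordinates keeps them in \<open>[0, 1)\<close>, where \<open>binary_digit\<close> is faithful.\<close>
  define e where "e p k = (if even k then binary_digit (fst p / 2) (k div 2) else binary_digit (snd p /
    2) (k div 2))"
    for p :: "real \<times> real" and k
  define s where "s p = ternary (e p)" for p
  \<comment> \<open>The factor 2 undoes the halving; the even ternary digits carry the first
    coordinate and the odd ones the second.\<close>
  define c where "c i t = max 0 (min 1 (2 * (\<Sum>k. bump (3 ^ (2 * k + i) * t) / 2 ^ Suc k)))" for i :: nat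
    and t :: real
  \<comment> \<open>Sorting the two values folds the square onto the triangle and fixes the points
    that are already in it.\<close>
  define \<rho> where "\<rho> t = (min (c 0 t) (c 1 t), max (c 0 t) (c 1 t))" for t
  have e1: "e p k \<le> 1" for p k
    using binary_digit_le by (simp add: e_def)
  have [continuous_intros]: "continuous_on UNIV (c i)" for i
    unfolding c_def by (intro continuous_intros bump_series_continuous)
  have "continuous_on UNIV \<rho>"
    unfolding \<rho>_def by (intro continuous_intros)
  moreover have "\<rho> t \<in> S_I" for t
  proof -
    have "0 \<le> c i t" "c i t \<le> 1" for i
      by (auto simp: c_def)
    then show ?thesis by (auto simp: \<rho>_def S_I_def min_def max_def)
  qed
  moreover have "s \<in> borel_measurable borel"
  proof -
    have [measurable]: "(\<lambda>x. real (binary_digit x k)) \<in> borel_measurable borel" for k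
    proof -
      have "(\<lambda>x::real. \<lfloor>2 ^ Suc k * x\<rfloor>) \<in> borel \<rightarrow>\<^sub>M count_space UNIV"
        by measurable
      from measurable_compose[OF this, of "\<lambda>i. real (nat (i mod 2))" borel]
      show ?thesis by (simp add: binary_digit_def)
    qed
    have [measurable]: "(\<lambda>p. real (e p k)) \<in> borel_measurable borel" for k
      unfolding e_def by (cases "even k") (simp_all, measurable)
    show ?thesis
      unfolding s_def ternary_def by measurable
  qed
  moreover have "\<rho> (s p) = p" if p: "p \<in> S_I" for p
  proof -
    obtain x y where xy: "p = (x, y)" "0 \<le> x" "x \<le> y" "y \<le> 1"
      using p by (auto simp: S_I_def)
    have "(\<Sum>k. bump (3 ^ (2 * k + 0) * s p) / 2 ^ Suc k) = (\<Sum>k. real (e p (2 * k + 0)) / 2 ^ Suc k)"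
      unfolding s_def by (simp only: bump_ternary[of "e p", OF e1])
    also have "\<dots> = x / 2"
      using binary_digit_sums[of "x / 2"] xy by (simp add: e_def sums_iff)
    finally have 0: "c 0 (s p) = x" using xy by (simp add: c_def)
    have "(\<Sum>k. bump (3 ^ (2 * k + 1) * s p) / 2 ^ Suc k) = (\<Sum>k. real (e p (2 * k + 1)) / 2 ^ Suc k)"
      unfolding s_def by (simp only: bump_ternary[of "e p", OF e1])
    also have "\<dots> = y / 2"
      using binary_digit_sums[of "y / 2"] xy by (simp add: e_def sums_iff)
    finally have "c 1 (s p) = y" using xy by (simp add: c_def)
    with 0 xy show ?thesis by (simp add: \<rho>_def)
  qed
  moreover have "0 \<le> s p" "s p \<le> 1" for p
    unfolding s_def by (rule ternary_bounds, rule e1)+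
  ultimately show ?thesis by (rule that)
qed

section \<open>Finite posets and their limits\<close>

definition strict_poset :: "nat set \<Rightarrow> (nat \<Rightarrow> nat \<Rightarrow> bool) \<Rightarrow> fposet" where
  "strict_poset A lt = Abs_fposet {(x, y). x \<in> A \<and> y \<in> A \<and> (x = y \<or> lt x y)}"

lemma strict_poset:
  assumes A: "finite A" "A \<noteq> {}"
    and irr: "\<And>x. x \<in> A \<Longrightarrow> \<not> lt x x"
    and tr: "\<And>x y z. x \<in> A \<Longrightarrow> y \<in> A \<Longrightarrow> z \<in> A \<Longrightarrow> lt x y \<Longrightarrow> lt y z \<Longrightarrow> lt x z"
  shows "pcarrier (strict_poset A lt) = A"
    and "plt (strict_poset A lt) x y \<longleftrightarrow> x \<in> A \<and> y \<in> A \<and> lt x y"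
proof -
  let ?r = "{(x, y). x \<in> A \<and> y \<in> A \<and> (x = y \<or> lt x y)}"
  have F: "Field ?r = A"
    by (auto simp: Field_def)
  have "Partial_order ?r"
    unfolding order_on_defs F
  proof (intro conjI)
    show "trans ?r" using tr by (auto intro!: transI)
    show "antisym ?r" using irr tr by (auto intro!: antisymI)
  qed (auto simp: refl_on_def)
  then have R: "Rep_fposet (strict_poset A lt) = ?r"
    unfolding strict_poset_def using A F by (intro Abs_fposet_inverse) simp
  show "pcarrier (strict_poset A lt) = A"
    unfolding pcarrier_def R F ..
  show "plt (strict_poset A lt) x y \<longleftrightarrow> x \<in> A \<and> y \<in> A \<and> lt x y"
    unfolding plt_def R using irr by auto
qed

lemma pcarrier_nonempty [simp]: "pcarrier P \<noteq> {}"
  using Rep_fposet[of P] by (simp add: pcarrier_def)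

lemma plt_trans: "plt P x y \<Longrightarrow> plt P y z \<Longrightarrow> plt P x z"
  using Rep_fposet[of P] unfolding plt_def order_on_defs by (auto dest: transD antisymD)

text \<open>A uniformly chosen map is a family of independent uniform elements indexed by
  \<open>Q\<close>. Finite posets and measures on intervals thus become instances of the same
  functional.\<close>

lemma order_density_kernel:
  "order_density Q P = kernel_density (\<lambda>p q.
    if plt P p q then 1 else 0) (uniform_count_measure (pcarrier P)) Q"
proof -
  let ?U = "uniform_count_measure (pcarrier P)" and ?I = "pcarrier Q"
  let ?n = "card (pcarrier P)"
  interpret prob_space ?U
    by (rule prob_space_uniform_count_measure) auto
  interpret finite_product_prob_space "\<lambda>_. ?U" ?I by standard auto
  let ?M = "PiM ?I (\<lambda>_. ?U)"
  have sp: "space ?M = ?I \<rightarrow>\<^sub>E pcarrier P"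
    by (simp add: space_PiM space_uniform_count_measure)
  have sing: "{\<phi>} \<in> sets ?M \<and> measure ?M {\<phi>} = (1 / ?n) ^ card ?I" if "\<phi> \<in> ?I \<rightarrow>\<^sub>E pcarrier P" for \<phi>
  proof -
    have eq: "{\<phi>} = (\<Pi>\<^sub>E i\<in>?I. {\<phi> i})"
      using that by (auto simp: PiE_def Pi_def extensional_def fun_eq_iff) metis
    have c: "\<phi> i \<in> pcarrier P" if "i \<in> ?I" for i
      using that \<open>\<phi> \<in> ?I \<rightarrow>\<^sub>E pcarrier P\<close> by auto
    have m: "measure ?M (\<Pi>\<^sub>E i\<in>?I. {\<phi> i}) = (\<Prod>i\<in>?I. measure ?U {\<phi> i})"
      using c by (intro finite_measure_PiM_emb) (auto simp: sets_uniform_count_measure)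
    have "measure ?U {\<phi> i} = 1 / ?n" if "i \<in> ?I" for i
      using c[OF that] by (subst measure_uniform_count_measure) auto
    with m have "measure ?M (\<Pi>\<^sub>E i\<in>?I. {\<phi> i}) = (1 / ?n) ^ card ?I" by simp
    moreover have "(\<Pi>\<^sub>E i\<in>?I. {\<phi> i}) \<in> sets ?M"
      using c by (intro sets_PiM_I_finite) (auto simp: sets_uniform_count_measure)
    ultimately show ?thesis by (simp add: eq[symmetric])
  qed
  have sub: "order_maps Q P \<subseteq> ?I \<rightarrow>\<^sub>E pcarrier P"
    by (auto simp: order_maps_def)
  have "kernel_density (\<lambda>p q. if plt P p q then 1 else 0) ?U Q
    = (\<integral>x. indicator (order_maps Q P) x \<partial>?M)"
    unfolding kernel_density_def
  proof (rule Bochner_Integration.integral_cong[OF refl])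
    fix x assume x: "x \<in> space ?M"
    show "(\<Prod>(i, j)\<in>{(i, j). plt Q i j}. if plt P (x i) (x j) then 1 else 0)
      = (indicator (order_maps Q P) x :: real)"
    proof (cases "x \<in> order_maps Q P")
      case True
      then show ?thesis by (auto simp: order_maps_def intro!: prod.neutral)
    next
      case False
      then obtain i j where ij: "plt Q i j" "\<not> plt P (x i) (x j)"
        using x by (auto simp: order_maps_def sp)
      then show ?thesis
        using False by (auto intro!: prod_zero bexI[of _ "(i, j)"])
    qed
  qed
  also have "\<dots> = measure ?M (order_maps Q P)"
    using sub by (simp add: sp[symmetric] Int_absorb2)
  also have "\<dots> = (\<Sum>\<phi>\<in>order_maps Q P. measure ?M {\<phi>})"
    using sing sub by (intro measure_eq_sum_singleton) (auto simp: emeasure_eq_measure)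
  also have "\<dots> = (\<Sum>\<phi>\<in>order_maps Q P. (1 / ?n) ^ card ?I)"
    using sing sub by (intro sum.cong) auto
  also have "\<dots> = order_density Q P"
    by (simp add: order_density_def card_PiE power_divide)
  finally show ?thesis ..
qed

text \<open>Every poset of size \<open>N\<close> can be relabelled by \<open>{..<N}\<close>, which
  leaves finitely many relations.\<close>

lemma finite_uposet_size: "finite {u. size_poset u = N}"
proof (rule finite_subset)
  show "{u. size_poset u = N} \<subseteq> (\<lambda>r. abs_uposet (Abs_fposet r)) ` Pow ({..<N} \<times> {..<N})"
  proof safe
    fix u assume u: "N = size_poset u"
    obtain P where P: "u = abs_uposet P"
      by (metis Quotient_abs_rep[OF Quotient_uposet])
    have "card (pcarrier P) = card {..<N}"
      using u P by (simp add: size_poset.abs_eq)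
    then obtain f where f: "bij_betw f (pcarrier P) {..<N}"
      using finite_same_card_bij[of "pcarrier P" "{..<N}"] by auto
    define g where "g = inv_into (pcarrier P) f"
    have g: "bij_betw g {..<N} (pcarrier P)"
      unfolding g_def by (rule bij_betw_inv_into[OF f])
    have gf: "g (f x) = x" if "x \<in> pcarrier P" for x
      unfolding g_def using f that by (rule bij_betw_inv_into_left)
    have fN: "f x \<in> {..<N}" if "x \<in> pcarrier P" for x
      using f that by (auto dest: bij_betwE)
    define lt where "lt x y = plt P (g x) (g y)" for x y
    have ne: "{..<N} \<noteq> {}" using f by (auto simp: bij_betw_def)
    have lt: "pcarrier (strict_poset {..<N} lt) = {..<N}"
      "plt (strict_poset {..<N} lt) x y \<longleftrightarrow> x \<in> {..<N} \<and> y \<in> {..<N} \<and> lt x y" for x y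
    proof -
      have irr: "\<not> lt x x" and tr: "lt x y \<Longrightarrow> lt y z \<Longrightarrow> lt x z" for x y z
        by (auto simp: lt_def plt_irrefl intro: plt_trans)
      note * = strict_poset[of "{..<N}" lt, OF finite_lessThan ne irr tr]
      show "pcarrier (strict_poset {..<N} lt) = {..<N}" by (rule *(1))
      show "plt (strict_poset {..<N} lt) x y \<longleftrightarrow> x \<in> {..<N} \<and> y \<in> {..<N} \<and> lt x y" by (rule *(2))
    qed
    have "poset_iso P (strict_poset {..<N} lt)"
      unfolding poset_iso_def lt using f fN by (intro exI[of _ f]) (auto simp: lt_def gf)
    then have "u = abs_uposet (strict_poset {..<N} lt)"
      unfolding P by (simp add: uposet.abs_eq_iff)
    then show "u \<in> (\<lambda>r. abs_uposet (Abs_fposet r)) ` Pow ({..<size_poset u} \<times> {..<size_poset u})"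
      unfolding strict_poset_def u by (auto intro!: image_eqI)
  qed
qed simp

lemma size_poset_pos: "size_poset u > 0"
  by transfer (simp add: card_gt_0_iff)

text \<open>The embedded posets of size at most \<open>m\<close> form a finite, hence closed set. A
  point of the closure outside the range therefore has second coordinate in
  \<open>[0, 1 / (m + 1)]\<close>, for every \<open>m\<close>. So a poset limit carries no
  information beyond its densities.\<close>

lemma snd_poset_limits:
  assumes X: "X \<in> poset_limits"
  shows "snd X = 0"
proof -
  have *: "snd X \<in> {0..1 / real (Suc m)}" for m
  proof -
    let ?A = "poset_embed ` (\<Union>N\<in>{..m}. {u. size_poset u = N})"
    let ?C = "{X :: (uposet \<Rightarrow> real) \<times> real. snd X \<in> {0..1 / real (Suc m)}}"
    have C: "closed ?C"
      unfolding vimage_def[symmetric] by (intro closed_vimage_snd closed_real_atLeastAtMost)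
    have A: "closed ?A"
    proof -
      have "closed {f}" for f :: "(uposet \<Rightarrow> real) \<times> real"
      proof -
        have eq: "{f} = (\<Inter>u. {g. fst g u = fst f u}) \<inter> {g. snd g = snd f}"
          by (auto simp: prod_eq_iff fun_eq_iff)
        have cont: "continuous_on UNIV (\<lambda>g :: (uposet \<Rightarrow> real) \<times> real. fst g u)" for u
          by (rule continuous_on_product_then_coordinatewise[OF continuous_on_fst[OF continuous_on_id]])
        show ?thesis
          unfolding eq by (intro closed_Int closed_INT ballI closed_Collect_eq continuous_on_const cont
            continuous_on_snd continuous_on_id)
      qed
      moreover have "finite ?A"
        by (intro finite_imageI finite_UN_I finite_uposet_size) simp
      ultimately have "closed (\<Union>f\<in>?A. {f})"
        by (intro closed_UN ballI)
      then show ?thesis unfolding UN_singleton .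
    qed
    have "range poset_embed \<subseteq> ?A \<union> ?C"
    proof (rule image_subsetI)
      fix u
      show "poset_embed u \<in> ?A \<union> ?C"
      proof (cases "size_poset u \<le> m")
        case True
        then show ?thesis by (intro UnI1 imageI) simp
      next
        case False
        then have "1 / real (size_poset u) \<le> 1 / real (Suc m)"
          by (intro divide_left_mono mult_pos_pos) auto
        then show ?thesis by (intro UnI2) (simp add: poset_embed_def)
      qed
    qed
    then have "closure (range poset_embed) \<subseteq> ?A \<union> ?C"
      by (intro closure_minimal closed_Un A C)
    then have "X \<in> ?A \<union> ?C"
      using X unfolding poset_limits_def poset_completion_def by blast
    moreover have "X \<notin> ?A"
      using X unfolding poset_limits_def by blast
    ultimately show ?thesis by blast
  qed
  have "snd X \<le> 0"
  proof (rule ccontr)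
    assume "\<not> snd X \<le> 0"
    then obtain m where "inverse (real (Suc m)) < snd X"
      using reals_Archimedean[of "snd X"] by (auto simp: not_le)
    then show False using *[of m] by (simp add: inverse_eq_divide)
  qed
  then show ?thesis using *[of 0] by simp
qed

lemma tendsto_funI:
  fixes f :: "'a \<Rightarrow> 'b \<Rightarrow> 'c::topological_space"
  assumes "\<And>i. ((\<lambda>x. f x i) \<longlongrightarrow> l i) F"
  shows "(f \<longlongrightarrow> l) F"
proof -
  have "limitin (product_topology (\<lambda>_. euclidean) UNIV) f l F"
    unfolding limitin_componentwise using assms by (auto simp: extensional_def)
  then show ?thesis
    by (simp only: euclidean_product_topology limitin_canonical_iff)
qed

text \<open>The third part is the uniqueness that gives the \<open>THE\<close> in
  \<open>kernel_limit\<close> its value: \<open>snd\<close> vanishes on all limits and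
  \<open>fst\<close> is the family of densities.\<close>

lemma interval_order_limitI:
  assumes io: "\<And>n. has_interval_order (P n)"
    and size: "filterlim (\<lambda>n. card (pcarrier (P n))) at_top sequentially"
    and conv: "\<And>Q. (\<lambda>n. order_density Q (P n)) \<longlonglongrightarrow> kernel_density W \<mu> Q"
  shows "kernel_limit W \<mu> \<in> interval_order_limits"
    and "t_ext (abs_uposet Q) (kernel_limit W \<mu>) = kernel_density W \<mu> Q"
    and "\<And>X. X \<in> poset_limits \<Longrightarrow> (\<And>Q. t_ext (abs_uposet Q) X = kernel_density W \<mu> Q) \<Longrightarrow> X = kernel_limit W \<mu>"
proof -
  define X where "X = ((\<lambda>u. kernel_density W \<mu> (rep_uposet u)), 0 :: real)"
  let ?P = "\<lambda>n. abs_uposet (P n)"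
  have rep: "abs_uposet (rep_uposet u) = u" for u
    by (rule Quotient_abs_rep[OF Quotient_uposet])
  \<comment> \<open>Densities of isomorphic \<open>Q\<close> agree because they are limits of the
    same sequence, so the choice made by \<open>rep_uposet\<close> does no harm.\<close>
  have kd: "kernel_density W \<mu> (rep_uposet (abs_uposet Q)) = kernel_density W \<mu> Q" for Q
  proof (rule LIMSEQ_unique[OF _ conv])
    have "order_density (rep_uposet (abs_uposet Q)) (P n) = order_density Q (P n)" for n
      by (metis rep t_poset.abs_eq)
    then show "(\<lambda>n. order_density Q (P n)) \<longlonglongrightarrow> kernel_density W \<mu> (rep_uposet (abs_uposet Q))"
      using conv[of "rep_uposet (abs_uposet Q)"] by simp
  qed
  have lim: "(\<lambda>n. poset_embed (?P n)) \<longlonglongrightarrow> X"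
    unfolding poset_embed_def X_def
  proof (intro tendsto_Pair tendsto_funI)
    fix u
    have "t_poset u (?P n) = order_density (rep_uposet u) (P n)" for n
      by (metis rep t_poset.abs_eq)
    then show "(\<lambda>n. t_poset u (?P n)) \<longlonglongrightarrow> kernel_density W \<mu> (rep_uposet u)"
      using conv by simp
    show "(\<lambda>n. 1 / real (size_poset (?P n))) \<longlonglongrightarrow> 0"
      unfolding size_poset.abs_eq
      by (rule tendsto_divide_0[OF tendsto_const])
        (intro filterlim_at_top_imp_at_infinity filterlim_compose[OF filterlim_real_sequentially size])
  qed
  have "X \<in> closure (range poset_embed)"
    using lim by (intro Lim_in_closed_set[OF closed_closure _ _ lim])
      (auto intro!: always_eventually closure_subset[THEN subsetD])
  moreover have "X \<notin> range poset_embed"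
  proof
    assume "X \<in> range poset_embed"
    then obtain u where "1 / real (size_poset u) = 0"
      by (auto simp: X_def poset_embed_def)
    then show False using size_poset_pos[of u] by simp
  qed
  ultimately have pl: "X \<in> poset_limits"
    by (simp add: poset_limits_def poset_completion_def)
  have t: "t_ext (abs_uposet Q) X = kernel_density W \<mu> Q" for Q
    by (simp add: t_ext_def X_def kd)
  have uniq: "Y = X" if Y: "Y \<in> poset_limits" "\<And>Q. t_ext (abs_uposet Q) Y = kernel_density W \<mu> Q" for Y
  proof (rule prod_eqI)
    show "snd Y = snd X" using snd_poset_limits[OF Y(1)] by (simp add: X_def)
    show "fst Y = fst X"
    proof
      fix u
      show "fst Y u = fst X u"
        using Y(2)[of "rep_uposet u"] t[of "rep_uposet u"] by (simp add: rep t_ext_def)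
    qed
  qed
  have X: "kernel_limit W \<mu> = X"
    unfolding kernel_limit_def by (rule the_equality) (use pl t uniq in blast)+
  show "kernel_limit W \<mu> \<in> interval_order_limits"
    unfolding X interval_order_limits_def mem_Collect_eq using pl lim io
    by (intro conjI exI[of _ ?P]) (simp_all add: interval_order.abs_eq)
  show "t_ext (abs_uposet Q) (kernel_limit W \<mu>) = kernel_density W \<mu> Q"
    unfolding X by (rule t)
  show "\<And>X. X \<in> poset_limits \<Longrightarrow> (\<And>Q. t_ext (abs_uposet Q) X = kernel_density W \<mu> Q) \<Longrightarrow> X = kernel_limit W \<mu>"
    unfolding X by (rule uniq)
qed

section \<open>Randomised ranks\<close>

abbreviation U01 :: "real measure" where
  "U01 \<equiv> uniform_measure lborel {0..1}"

lemma prob_space_U01: "prob_space U01"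
  by (rule prob_space_uniform_measure) auto

lemma real_distribution_U01: "real_distribution U01"
  by (rule real_distribution.intro[OF prob_space_U01]) (simp add: real_distribution_axioms_def)

lemma U01_sigma_finite: "sigma_finite_measure U01"
  by (rule prob_space_imp_sigma_finite[OF prob_space_U01])

lemma measure_U01_Icc: "0 \<le> a \<Longrightarrow> a \<le> b \<Longrightarrow> b \<le> 1 \<Longrightarrow> measure U01 {a..b} = b - a"
  by (subst measure_uniform_measure) (auto simp: Int_absorb1)

lemma AE_U01: "AE u in U01. u \<in> {0..1}"
  by (rule AE_uniform_measureI) auto

lemma AE_U01_neq: "AE u in U01. u \<noteq> c"
proof (rule AE_uniform_measureI)
  show "AE x in lborel. x \<in> {0..1} \<longrightarrow> x \<noteq> c"
    using AE_lborel_singleton[of c] by eventually_elim simp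
qed simp

definition rank_below :: "'a measure \<Rightarrow> ('a \<Rightarrow> real) \<Rightarrow> real \<Rightarrow> real" where
  "rank_below M Z z = measure M {q \<in> space M. Z q < z}"

definition rank_upto :: "'a measure \<Rightarrow> ('a \<Rightarrow> real) \<Rightarrow> real \<Rightarrow> real" where
  "rank_upto M Z z = measure M {q \<in> space M. Z q \<le> z}"

text \<open>
  The randomised probability integral transform; it is uniform even when \<open>Z\<close> has atoms.
\<close>

definition random_rank :: "'a measure \<Rightarrow> ('a \<Rightarrow> real) \<Rightarrow> 'a \<times> real \<Rightarrow> real" where
  "random_rank M Z = (\<lambda>(p, u). rank_below M Z (Z p) + u * (rank_upto M Z (Z p) - rank_below M Z (Z p)))"

context prob_space begin

lemma rank_bounds: "0 \<le> rank_below M Z z" "rank_below M Z z \<le> 1" "0 \<le> rank_upto M Z z" "rank_upto M Z z \<le> 1"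
  by (auto simp: rank_below_def rank_upto_def)

lemma rank_below_le_upto:
  assumes [measurable]: "Z \<in> borel_measurable M"
  shows "rank_below M Z z \<le> rank_upto M Z z" 
  unfolding rank_below_def rank_upto_def by (intro finite_measure_mono) auto

lemma rank_upto_le_below:
  assumes [measurable]: "Z \<in> borel_measurable M" and "y < z"
  shows "rank_upto M Z y \<le> rank_below M Z z" 
  unfolding rank_below_def rank_upto_def using assms(2) by (intro finite_measure_mono) auto

lemma rank_below_mono:
  assumes [measurable]: "Z \<in> borel_measurable M"
  shows "mono (rank_below M Z)" 
  unfolding rank_below_def by (intro monoI finite_measure_mono) auto

lemma rank_upto_mono:
  assumes [measurable]: "Z \<in> borel_measurable M"
  shows "mono (rank_upto M Z)" 
  unfolding rank_upto_def by (intro monoI finite_measure_mono) auto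

lemma random_rank_measurable [measurable]:
  assumes [measurable]: "Z \<in> borel_measurable M"
  shows "random_rank M Z \<in> borel_measurable (M \<Otimes>\<^sub>M U01)"
proof -
  have [measurable]: "rank_below M Z \<in> borel_measurable borel" "rank_upto M Z \<in> borel_measurable borel"
    by (intro borel_measurable_mono rank_below_mono rank_upto_mono assms)+
  have [measurable]: "sets U01 = sets borel" by simp
  have [measurable]: "snd \<in> borel_measurable (M \<Otimes>\<^sub>M U01)"
    using measurable_snd[of M U01] by (simp cong: measurable_cong_sets)
  show ?thesis
    unfolding random_rank_def split_beta by measurable
qed

lemma random_rank_between:
  assumes Z: "Z \<in> borel_measurable M" and u: "0 \<le> u" "u \<le> 1"
  shows "rank_below M Z (Z p) \<le> random_rank M Z (p, u)" "random_rank M Z (p, u) \<le> rank_upto M Z (Z p)"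
proof -
  have *: "0 \<le> rank_upto M Z (Z p) - rank_below M Z (Z p)"
    using rank_below_le_upto[OF Z] by simp
  show "rank_below M Z (Z p) \<le> random_rank M Z (p, u)"
    using * u by (simp add: random_rank_def)
  show "random_rank M Z (p, u) \<le> rank_upto M Z (Z p)"
    using mult_right_mono[OF u(2) *] by (simp add: random_rank_def)
qed

text \<open>Let \<open>q\<close> be the \<open>c\<close>-quantile of \<open>Z\<close> and
  \<open>\<pi>\<close> the mass of its atom there. Up to boundary points, the rank is below
  \<open>c\<close> if \<open>Z < q\<close>, or if \<open>Z = q\<close> and \<open>u\<close> is below
  the fraction \<open>r\<close> of the atom that is needed to reach \<open>c\<close>; the two masses
  add up to \<open>c\<close>.\<close>

lemma random_rank_uniform:
  assumes Z [measurable]: "Z \<in> borel_measurable M"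
  shows "distr (M \<Otimes>\<^sub>M U01) borel (random_rank M Z) = U01"
proof -
  interpret U: prob_space U01 by (rule prob_space_U01)
  interpret T: pair_prob_space M U01 ..
  let ?T = "M \<Otimes>\<^sub>M U01" and ?X = "random_rank M Z"
  let ?D = "distr ?T borel ?X"
  interpret D: real_distribution ?D
    by (rule real_distribution.intro) (auto intro: T.prob_space_distr simp: real_distribution_axioms_def)
  interpret \<nu>: cdf_distribution "distr M borel Z"
    unfolding cdf_distribution_def by (rule real_distribution.intro) (auto intro: prob_space_distr simp:
      real_distribution_axioms_def)
  have cdf: "cdf (distr M borel Z) z = rank_upto M Z z" for z
    by (simp add: cdf_def rank_upto_def measure_distr vimage_def Int_def conj_commute)
  have bel: "measure (distr M borel Z) {..<z} = rank_below M Z z" for z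
    by (simp add: rank_below_def measure_distr vimage_def Int_def conj_commute)
  have aeU: "AE z in ?T. snd z \<in> {0..1}"
    by (rule AE_pair_snd[OF U01_sigma_finite AE_U01])
  have times: "measure ?T (A \<times> B) = measure M A * measure U01 B" if "A \<in> sets M" "B \<in> sets borel" for A B
    using that by (simp add: U.emeasure_pair_measure_Times measure_def enn2real_mult)
  \<comment> \<open>Proving two inequalities, one strict and one weak, avoids discussing the null events where \<open>?X = c\<close>.\<close>
  have main: "measure ?T {z \<in> space ?T. ?X z < c} \<le> c \<and> c \<le> measure ?T {z \<in> space ?T. ?X z \<le> c}"
    if c: "0 < c" "c < 1" for c
  proof -
    define q where "q = \<nu>.I c"
    have q1: "c \<le> rank_upto M Z q"
      using \<nu>.pseudoinverse[of c q] c by (simp add: cdf q_def)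
    have q2: "rank_upto M Z z < c" if "z < q" for z
      using \<nu>.pseudoinverse[of c z] c that by (simp add: cdf q_def not_le[symmetric])
    have q3: "rank_below M Z q \<le> c"
    proof (rule tendsto_upperbound)
      show "(rank_upto M Z \<longlongrightarrow> rank_below M Z q) (at_left q)"
        using \<nu>.cdf_at_left[of q] unfolding bel by (simp add: cdf[abs_def] filterlim_def)
      show "\<forall>\<^sub>F z in at_left q. rank_upto M Z z \<le> c"
        using q2 by (auto simp: eventually_at_filter intro!: always_eventually less_imp_le)
    qed simp
    define \<pi> where "\<pi> = rank_upto M Z q - rank_below M Z q"
    have \<pi>: "0 \<le> \<pi>" "c \<le> rank_below M Z q + \<pi>"
      using q1 rank_below_le_upto[OF Z, of q] by (auto simp: \<pi>_def)
    \<comment> \<open>The value of \<open>u\<close> at which the rank crosses \<open>c\<close> on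
      the atom. Without an atom the quotient is 0, which is harmless since \<open>Z = q\<close> is
      then a null event.\<close>
    define r where "r = (c - rank_below M Z q) / \<pi>"
    have r: "0 \<le> r" "r \<le> 1"
      using \<pi> q3 by (auto simp: r_def divide_le_eq_1)
    let ?A1 = "{p \<in> space M. Z p < q}" and ?A2 = "{p \<in> space M. Z p = q}"
    have m1: "measure M ?A1 = rank_below M Z q" by (simp add: rank_below_def)
    have m2: "measure M ?A2 = \<pi>"
    proof -
      have "measure M ({p \<in> space M. Z p \<le> q} - {p \<in> space M. Z p < q}) = \<pi>"
        unfolding \<pi>_def rank_upto_def rank_below_def by (intro finite_measure_Diff) auto
      moreover have "{p \<in> space M. Z p \<le> q} - {p \<in> space M. Z p < q} = ?A2" by auto
      ultimately show ?thesis by simp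
    qed
    have V: "measure ?T (?A1 \<times> {0..1} \<union> ?A2 \<times> {0..r}) = rank_below M Z q + \<pi> * r"
    proof -
      have "measure ?T (?A1 \<times> {0..1} \<union> ?A2 \<times> {0..r})
        = measure ?T (?A1 \<times> {0..1}) + measure ?T (?A2 \<times> {0..r})"
        by (intro T.finite_measure_Union) auto
      also have "\<dots> = rank_below M Z q + \<pi> * r"
        using r by (subst (1 2) times) (auto simp: m1 m2 measure_U01_Icc)
      finally show ?thesis .
    qed
    have "c \<le> rank_below M Z q + \<pi> * r"
      using \<pi> by (cases "\<pi> = 0") (auto simp: r_def)
    also have "\<dots> \<le> measure ?T {z \<in> space ?T. ?X z \<le> c}"
      unfolding V[symmetric]
    proof (rule T.finite_measure_mono)
      show "?A1 \<times> {0..1} \<union> ?A2 \<times> {0..r} \<subseteq> {z \<in> space ?T. ?X z \<le> c}"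
      proof (rule subrelI)
        fix p u assume "(p, u) \<in> ?A1 \<times> {0..1} \<union> ?A2 \<times> {0..r}"
        then have "p \<in> space M \<and> Z p < q \<and> 0 \<le> u \<and> u \<le> 1 \<or> p \<in> space M \<and> Z p = q \<and> 0 \<le> u \<and> u \<le> r"
          by auto
        then show "(p, u) \<in> {z \<in> space ?T. ?X z \<le> c}"
        proof (elim disjE conjE)
          assume "p \<in> space M" "Z p < q" "0 \<le> u" "u \<le> 1"
          then show ?thesis
            using random_rank_between(2)[OF Z, of u p] q2[of "Z p"] by (auto simp: space_pair_measure)
        next
          assume u: "p \<in> space M" "Z p = q" "0 \<le> u" "u \<le> r"
          have "u * \<pi> \<le> c - rank_below M Z q"
            using u(4) \<pi> q3 by (cases "\<pi> = 0") (auto simp: r_def pos_le_divide_eq)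
          then show ?thesis
            using u by (auto simp: space_pair_measure random_rank_def \<pi>_def)
        qed
      qed
    qed measurable
    finally have lo: "c \<le> measure ?T {z \<in> space ?T. ?X z \<le> c}" .
    have hi: "measure ?T {z \<in> space ?T. ?X z < c} \<le> c"
    proof -
      have Zq: "Z p \<le> q" if "?X (p, u) < c" "0 \<le> u" "u \<le> 1" for p u
      proof (rule ccontr)
        assume "\<not> Z p \<le> q"
        then have "c \<le> rank_below M Z (Z p)"
          using q1 rank_upto_le_below[OF Z, of q "Z p"] by simp
        then show False using random_rank_between(1)[OF Z, of u p] that by simp
      qed
      show ?thesis
      proof (cases "\<pi> = 0")
        case True
        have "measure ?T {z \<in> space ?T. ?X z < c} \<le> measure ?T (?A1 \<times> UNIV \<union> ?A2 \<times> UNIV)"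
          using aeU by (intro T.finite_measure_mono_AE) (auto simp: space_pair_measure dest!: Zq)
        also have "\<dots> = measure ?T (?A1 \<times> UNIV) + measure ?T (?A2 \<times> UNIV)"
          by (intro T.finite_measure_Union) auto
        also have "\<dots> = rank_below M Z q"
          using True U.prob_space by (subst (1 2) times) (auto simp: m1 m2)
        finally show ?thesis using q3 by simp
      next
        case False
        have "measure ?T {z \<in> space ?T. ?X z < c} \<le> measure ?T (?A1 \<times> {0..1} \<union> ?A2 \<times> {0..r})"
        proof (intro T.finite_measure_mono_AE)
          show "AE z in ?T. z \<in> {z \<in> space ?T. ?X z < c} \<longrightarrow> z \<in> ?A1 \<times> {0..1} \<union> ?A2 \<times> {0..r}"
            using aeU
          proof eventually_elim
            case (elim z)
            obtain p u where z: "z = (p, u)" by (cases z)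
            show ?case
            proof
              assume X: "z \<in> {z \<in> space ?T. ?X z < c}"
              have "u \<le> r" if "Z p = q"
                using X that False \<pi> z by (auto simp: random_rank_def \<pi>_def r_def pos_le_divide_eq)
              then show "z \<in> ?A1 \<times> {0..1} \<union> ?A2 \<times> {0..r}"
                using X Zq[of p u] elim z by (auto simp: space_pair_measure)
            qed
          qed
        qed auto
        also have "\<dots> = c" unfolding V using False by (simp add: r_def)
        finally show ?thesis .
      qed
    qed
    show ?thesis using lo hi by simp
  qed
  have cdfD: "cdf ?D c = measure ?T {z \<in> space ?T. ?X z \<le> c}" for c
    by (simp add: cdf_def measure_distr vimage_def Int_def conj_commute)
  \<comment> \<open>The lower bound at \<open>c\<close> and the upper bounds for the events
    \<open>?X < d\<close> with \<open>d > c\<close> squeeze the distribution function.\<close>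
  have eq: "cdf ?D c = c" if c: "0 < c" "c < 1" for c
  proof (rule antisym)
    show "c \<le> cdf ?D c" using main[OF c] by (simp add: cdfD)
    show "cdf ?D c \<le> c"
    proof (rule dense_ge_bounded[OF c(2)])
      fix d assume d: "c < d" "d < 1"
      have "cdf ?D c \<le> measure ?T {z \<in> space ?T. ?X z < d}"
        unfolding cdfD
      proof (rule T.finite_measure_mono)
        show "{z \<in> space ?T. ?X z \<le> c} \<subseteq> {z \<in> space ?T. ?X z < d}" using d by auto
      qed measurable
      also have "\<dots> \<le> d" using main[of d] d c by simp
      finally show "cdf ?D c \<le> d" .
    qed
  qed
  show ?thesis
  proof (rule cdf_unique)
    show "real_distribution ?D" by unfold_locales
    show "real_distribution U01" by (rule real_distribution_U01)
    show "cdf ?D = cdf U01"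
    proof
      fix c
      have U: "cdf U01 c = (if c < 0 then 0 else if c \<le> 1 then c else 1)"
      proof -
        have "cdf U01 c = measure lborel ({0..1} \<inter> {..c})"
          unfolding cdf_def by (subst measure_uniform_measure) auto
        also have "{0..1} \<inter> {..c} = (if c < 0 then {} else {0..min 1 c})" by auto
        finally show ?thesis by auto
      qed
      \<comment> \<open>Outside the open unit interval the value follows from the inner ones by
        monotonicity.\<close>
      consider "c \<le> 0" | "0 < c" "c < 1" | "1 \<le> c" by linarith
      then show "cdf ?D c = cdf U01 c"
      proof cases
        case 1
        have "cdf ?D c \<le> 0"
        proof (rule dense_ge_bounded[of 0 1])
          fix d :: real assume "0 < d" "d < 1"
          then show "cdf ?D c \<le> d" using eq[of d] D.cdf_nondecreasing[of c d] 1 by simp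
        qed simp
        then show ?thesis using D.cdf_nonneg[of c] 1 by (auto simp: U)
      next
        case 2
        then show ?thesis using eq by (simp add: U)
      next
        case 3
        have "1 \<le> cdf ?D c"
        proof (rule dense_le_bounded[of 0 1])
          fix d :: real assume "0 < d" "d < 1"
          then show "d \<le> cdf ?D c" using eq[of d] D.cdf_nondecreasing[of d c] 3 by simp
        qed simp
        then show ?thesis using D.cdf_bounded_prob[of c] 3 by (auto simp: U)
      qed
    qed
  qed
qed

end

section \<open>Measures with uniform left marginal\<close>

lemma measurable_uniform_count_pair:
  assumes "finite A"
  shows "(f :: _ \<Rightarrow> real) \<in> borel_measurable (uniform_count_measure A \<Otimes>\<^sub>M uniform_count_measure A)"
proof -
  have s: "sets (uniform_count_measure A) = sets (count_space A)"
    by (simp add: sets_uniform_count_measure)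
  have eq: "sets (uniform_count_measure A \<Otimes>\<^sub>M uniform_count_measure A) = sets (count_space (A \<times> A))"
    using sets_pair_measure_cong[OF s s] pair_measure_countable[of A A] assms
    by (simp only: countable_finite)
  show ?thesis unfolding measurable_cong_sets[OF eq refl] by simp
qed

lemma S_I_sets [measurable]: "S_I \<in> sets borel"
proof -
  have "S_I = {p \<in> space borel. 0 \<le> fst p \<and> fst p \<le> snd p \<and> snd p \<le> 1}"
    by (auto simp: S_I_def)
  also have "\<dots> \<in> sets borel" by measurable
  finally show ?thesis .
qed

text \<open>Moves everything to measures on the whole line and plane, where distribution functions
  and characteristic functions are available; \<open>left_marginal\<close> itself lives on
  \<open>{0..1}\<close>.\<close>

lemma P_L_D:
  assumes "\<mu> \<in> P_L"
  shows "prob_space \<mu>" "sets \<mu> = sets (restrict_space borel S_I)" "space \<mu> = S_I"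
    "(\<lambda>p. p) \<in> borel_measurable \<mu>" "fst \<in> borel_measurable \<mu>" "snd \<in> borel_measurable \<mu>"
    "distr \<mu> borel fst = U01"
proof -
  show "prob_space \<mu>" and s: "sets \<mu> = sets (restrict_space borel S_I)"
    using assms by (auto simp: P_L_def)
  show sp: "space \<mu> = S_I"
    using sets_eq_imp_space_eq[OF s] by (simp add: space_restrict_space)
  show m: "(\<lambda>p. p) \<in> borel_measurable \<mu>"
    unfolding measurable_cong_sets[OF s refl] by (intro measurable_restrict_space1) simp
  show mf: "fst \<in> borel_measurable \<mu>" and "snd \<in> borel_measurable \<mu>"
    by (rule measurable_compose[OF m], measurable)+
  show "distr \<mu> borel fst = U01"
  proof (rule measure_eqI)
    fix A :: "real set" assume "A \<in> sets (distr \<mu> borel fst)"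
    then have A: "A \<in> sets borel" by simp
    have mf': "fst \<in> \<mu> \<rightarrow>\<^sub>M restrict_space borel {0..1}"
      using mf sp by (intro measurable_restrict_space2) (auto simp: S_I_def)
    have A': "A \<inter> {0..1} \<in> sets (restrict_space borel {0..1})"
      using A by (auto simp: sets_restrict_space)
    have "emeasure (distr \<mu> borel fst) A = emeasure (left_marginal \<mu>) (A \<inter> {0..1})"
      unfolding left_marginal_def using A A' mf mf' sp
      by (simp add: emeasure_distr) (auto intro!: arg_cong[where f="emeasure \<mu>"] simp: S_I_def)
    also have "\<dots> = emeasure (restrict_space lborel {0..1}) (A \<inter> {0..1})"
      using assms by (simp add: P_L_def)
    also have "\<dots> = emeasure U01 A"
      using A by (simp add: emeasure_restrict_space Int_commute divide_ennreal_def)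
    finally show "emeasure (distr \<mu> borel fst) A = emeasure U01 A" .
  qed simp
qed

lemma W_I_borel: "case_prod W_I \<in> borel_measurable (borel \<Otimes>\<^sub>M borel)"
  using W_I_comp_measurable[of "\<lambda>p. p" borel] by simp

text \<open>The way to build members of \<open>P_L\<close>: a random interval with uniform left
  endpoint on any probability space. Its densities can then be computed on that space.\<close>

lemma P_L_distr:
  assumes T: "prob_space T" and g: "g \<in> borel_measurable T" and S: "\<And>z. z \<in> space T \<Longrightarrow> g z \<in> S_I"
    and U: "distr T borel (\<lambda>z. fst (g z)) = U01"
  shows "distr T (restrict_space borel S_I) g \<in> P_L"
    and "kernel_density W_I (distr T (restrict_space borel S_I) g) Q
      = kernel_density (\<lambda>p q. W_I (g p) (g q)) T Q"
proof -
  interpret prob_space T by fact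
  let ?N = "restrict_space borel S_I :: (real \<times> real) measure"
  have g': "g \<in> T \<rightarrow>\<^sub>M ?N"
    using g S by (intro measurable_restrict_space2) auto
  have f: "fst \<in> ?N \<rightarrow>\<^sub>M restrict_space borel {0..1}"
    by (intro measurable_restrict_space2 measurable_restrict_space1) (auto simp: space_restrict_space
      S_I_def)
  have fg: "(\<lambda>z. fst (g z)) \<in> T \<rightarrow>\<^sub>M restrict_space borel {0..1}"
    using measurable_compose[OF g' f] .
  have fgb: "(\<lambda>z. fst (g z)) \<in> borel_measurable T"
    using g by measurable
  have "left_marginal (distr T ?N g) = distr T (restrict_space borel {0..1}) (\<lambda>z. fst (g z))"
    unfolding left_marginal_def by (simp add: distr_distr[OF _ g'] f comp_def)
  also have "\<dots> = restrict_space lborel {0..1}"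
  proof (rule measure_eqI)
    fix A assume "A \<in> sets (distr T (restrict_space borel {0..1}) (\<lambda>z. fst (g z)))"
    then have A: "A \<subseteq> {0..1}" "A \<in> sets borel" "A \<in> sets (restrict_space borel {0..1})"
      by (auto simp: sets_restrict_space)
    have "emeasure (distr T (restrict_space borel {0..1}) (\<lambda>z. fst (g z))) A
      = emeasure (distr T borel (\<lambda>z. fst (g z))) A"
      using A fg fgb by (simp add: emeasure_distr)
    also have "\<dots> = emeasure (restrict_space lborel {0..1}) A"
      unfolding U using A by (simp add: emeasure_restrict_space Int_absorb1 divide_ennreal_def)
    finally show "emeasure (distr T (restrict_space borel {0..1}) (\<lambda>z. fst (g z))) A
      = emeasure (restrict_space lborel {0..1}) A" .
  qed (simp add: sets_restrict_space)
  finally show "distr T ?N g \<in> P_L"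
    unfolding P_L_def using prob_space_distr[OF g'] by simp
  have "(\<lambda>p. p) \<in> borel_measurable ?N"
    by (intro measurable_restrict_space1) simp
  from W_I_comp_measurable[OF this]
  show "kernel_density W_I (distr T ?N g) Q = kernel_density (\<lambda>p q. W_I (g p) (g q)) T Q"
    by (intro kernel_density_distr[OF T g']) simp
qed

text \<open>For a fixed first point \<open>x\<close> the uniform variable avoids the single value
  \<open>c x\<close>, and Fubini integrates this. It is the reason why ties are null.\<close>

lemma AE_pair_uniform_neq:
  assumes T: "prob_space T" and c: "c \<in> borel_measurable T" and X: "X \<in> borel_measurable T"
    and U: "distr T borel X = U01"
  shows "AE z in T \<Otimes>\<^sub>M T. c (fst z) \<noteq> (X (snd z) :: real)"
proof -
  note [measurable] = c X
  interpret T: prob_space T by fact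
  interpret pair_prob_space T T ..
  have "AE y in T. c x \<noteq> X y" for x
  proof -
    have "AE u in distr T borel X. u \<noteq> c x"
      unfolding U by (rule AE_U01_neq)
    from AE_distrD[OF X this] show ?thesis by (auto elim: eventually_mono)
  qed
  then show ?thesis
    by (intro AE_pair_measure) auto
qed

text \<open>The given intervals may be open or unbounded, so their own endpoints are of no use. For
  each pair, points of the two intervals are chosen that witness the failure of \<open>plt\<close>
  if it fails; the hull of the finitely many points chosen in \<open>I p\<close> is a closed
  interval, and these hulls have the same order.\<close>

lemma interval_order_endpoints:
  assumes "has_interval_order P"
  obtains a b :: "nat \<Rightarrow> real" where "\<And>p. p \<in> pcarrier P \<Longrightarrow> a p \<le> b p"
    "\<And>p q. p \<in> pcarrier P \<Longrightarrow> q \<in> pcarrier P \<Longrightarrow> plt P p q \<longleftrightarrow> b p < a q"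
proof -
  let ?V = "pcarrier P"
  obtain I :: "nat \<Rightarrow> real set" where I': "\<forall>p\<in>?V. is_interval (I p) \<and> I p \<noteq> {}"
    "\<forall>p\<in>?V. \<forall>q\<in>?V. plt P p q \<longleftrightarrow> (\<forall>x\<in>I p. \<forall>y\<in>I q. x < y)"
    using assms unfolding has_interval_order_def by (elim exE conjE)
  have I: "I p \<noteq> {}" "plt P p q \<longleftrightarrow> (\<forall>x\<in>I p. \<forall>y\<in>I q. x < y)" if "p \<in> ?V" "q \<in> ?V" for p q
    using I' that by auto
  \<comment> \<open>Vacuous off the carrier, so that the witnesses can be chosen as total
    functions.\<close>
  define R where "R p q x y \<longleftrightarrow> (p \<in> ?V \<and> q \<in> ?V \<longrightarrow> x \<in> I p \<and> y \<in> I q \<and> (plt P p q \<or> y \<le> x))" for p q x y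
  have "\<exists>x y. R p q x y" for p q
  proof (cases "p \<in> ?V \<and> q \<in> ?V")
    case True
    then have pq: "p \<in> ?V" "q \<in> ?V" by auto
    obtain x y where xy: "x \<in> I p" "y \<in> I q" using I(1)[OF pq] I(1)[OF pq(2) pq(1)] by blast
    show ?thesis
    proof (cases "plt P p q")
      case True
      then show ?thesis unfolding R_def using xy by blast
    next
      case False
      then obtain x y where "x \<in> I p" "y \<in> I q" "\<not> x < y" using I(2)[OF pq] by auto
      then show ?thesis unfolding R_def not_less by blast
    qed
  qed (auto simp: R_def)
  then obtain x y where "R p q (x p q) (y p q)" for p q
    by metis
  then have xy: "p \<in> ?V \<Longrightarrow> q \<in> ?V \<Longrightarrow> x p q \<in> I p \<and> y p q \<in> I q \<and> (plt P p q \<or> y p q \<le> x p q)" for p q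
    unfolding R_def by simp
  define E where "E p = x p ` ?V \<union> (\<lambda>q. y q p) ` ?V" for p
  have E: "finite (E p)" "E p \<noteq> {}" for p
    by (auto simp: E_def)
  have EI: "E p \<subseteq> I p" if "p \<in> ?V" for p
    using xy that by (auto simp: E_def)
  show ?thesis
  proof (rule that[of "\<lambda>p. Min (E p)" "\<lambda>p. Max (E p)"])
    show "Min (E p) \<le> Max (E p)" for p
      using E[of p] by (meson Max_ge Min_in)
    fix p q assume pq: "p \<in> ?V" "q \<in> ?V"
    show "plt P p q \<longleftrightarrow> Max (E p) < Min (E q)"
    proof
      assume "plt P p q"
      then show "Max (E p) < Min (E q)"
        using I(2)[OF pq] EI[OF pq(1)] EI[OF pq(2)] Max_in[OF E[of p]] Min_in[OF E[of q]] by blast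
    next
      assume *: "Max (E p) < Min (E q)"
      have "x p q \<in> E p" "y p q \<in> E q"
        using pq by (auto simp: E_def)
      then have "x p q < y p q"
        using * Max_ge[OF E(1), of "x p q" p] Min_le[OF E(1), of "y p q" q] by linarith
      then show "plt P p q" using xy[OF pq] by auto
    qed
  qed
qed

text \<open>
  The left endpoints become randomised ranks, and each right endpoint becomes the proportion of left
  endpoints that it dominates; almost surely this preserves the order.
\<close>

lemma interval_order_in_P_L:
  assumes "has_interval_order P"
  obtains \<mu> where "\<mu> \<in> P_L" "\<And>Q. kernel_density W_I \<mu> Q = order_density Q P"
proof -
  let ?V = "pcarrier P"
  obtain a b where ab: "\<And>p. p \<in> ?V \<Longrightarrow> a p \<le> b p"
    "\<And>p q. p \<in> ?V \<Longrightarrow> q \<in> ?V \<Longrightarrow> plt P p q \<longleftrightarrow> b p < (a q :: real)"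
    using interval_order_endpoints[OF assms] by metis
  let ?M = "uniform_count_measure ?V"
  have pM: "prob_space ?M" by (rule prob_space_uniform_count_measure) auto
  interpret M: prob_space ?M by fact
  have setsM: "sets ?M = sets (count_space ?V)"
    by (simp add: sets_uniform_count_measure)
  have meas: "f \<in> ?M \<rightarrow>\<^sub>M N \<longleftrightarrow> f \<in> ?V \<rightarrow> space N" for f and N :: "'b measure"
    by (simp add: measurable_cong_sets[OF setsM refl])
  have a: "a \<in> borel_measurable ?M" by (simp add: meas)
  interpret U: prob_space U01 by (rule prob_space_U01)
  interpret T: pair_prob_space ?M U01 ..
  let ?T = "?M \<Otimes>\<^sub>M U01"
  let ?X = "random_rank ?M a"
  \<comment> \<open>The second branch concerns a null set; it is there because \<open>g\<close> must
    take values in \<open>S_I\<close> everywhere.\<close>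
  define g where "g z = (if snd z \<in> {0..1} then (?X z, rank_upto ?M a (b (fst z))) else (0, 0))"
    for z :: "nat \<times> real"
  have [measurable]: "?X \<in> borel_measurable ?T" by (rule M.random_rank_measurable[OF a])
  have [measurable]: "(\<lambda>p. rank_upto ?M a (b p)) \<in> borel_measurable ?M" by (simp add: meas)
  have [measurable]: "snd \<in> borel_measurable ?T"
    using measurable_snd[of ?M U01] by (simp cong: measurable_cong_sets)
  have g: "g \<in> borel_measurable ?T"
    unfolding g_def borel_prod[symmetric] by measurable
  have aeU: "AE z in ?T. snd z \<in> {0..1}"
    by (rule AE_pair_snd[OF U01_sigma_finite AE_U01])
  have S: "g z \<in> S_I" if "z \<in> space ?T" for z
  proof (cases "snd z \<in> {0..1}")
    case True
    obtain p u where z: "z = (p, u)" by (cases z)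
    have p: "p \<in> ?V" using that z by (simp add: space_pair_measure space_uniform_count_measure)
    have u: "0 \<le> u" "u \<le> 1" using True z by auto
    note M.random_rank_between[OF a u, of p] M.rank_bounds
    moreover have "rank_upto ?M a (a p) \<le> rank_upto ?M a (b p)"
      using M.rank_upto_mono[OF a] ab(1)[OF p] by (auto dest: monoD)
    ultimately show ?thesis
      using True unfolding z g_def S_I_def by (auto intro: order_trans)
  qed (unfold g_def, simp add: S_I_def del: atLeastAtMost_iff)
  have fg: "AE z in ?T. fst (g z) = ?X z"
    using aeU by eventually_elim (simp add: g_def)
  have U: "distr ?T borel (\<lambda>z. fst (g z)) = U01"
  proof -
    have "distr ?T borel (\<lambda>z. fst (g z)) = distr ?T borel ?X"
      using fg g by (intro distr_cong_AE) auto
    then show ?thesis using M.random_rank_uniform[OF a] by simp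
  qed
  let ?\<mu> = "distr ?T (restrict_space borel S_I) g"
  have "kernel_density W_I ?\<mu> Q = order_density Q P" for Q
  proof -
    let ?w = "\<lambda>p q. if plt P p q then 1 else 0 :: real"
    have w: "case_prod ?w \<in> borel_measurable (?M \<Otimes>\<^sub>M ?M)"
      by (rule measurable_uniform_count_pair) simp
    have "kernel_density W_I ?\<mu> Q = kernel_density (\<lambda>p q. W_I (g p) (g q)) ?T Q"
      by (rule P_L_distr[OF T.prob_space_axioms g S U])
    also have "\<dots> = kernel_density (\<lambda>p q. ?w (fst p) (fst q)) ?T Q"
    proof (rule kernel_density_cong_AE[OF T.prob_space_axioms W_I_comp_measurable[OF g]])
      have "(\<lambda>z. (fst (fst z), fst (snd z))) \<in> ?T \<Otimes>\<^sub>M ?T \<rightarrow>\<^sub>M ?M \<Otimes>\<^sub>M ?M"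
        by measurable
      from measurable_compose[OF this w]
      show "(\<lambda>(p, q). ?w (fst p) (fst q)) \<in> borel_measurable (?T \<Otimes>\<^sub>M ?T)"
        by (simp add: split_beta)
      have 1: "AE z in ?T \<Otimes>\<^sub>M ?T. snd (g (fst z)) \<noteq> fst (g (snd z))"
        by (rule AE_pair_uniform_neq[OF T.prob_space_axioms _ _ U]) (use g in measurable)
      have 2: "AE z in ?T \<Otimes>\<^sub>M ?T. snd (fst z) \<in> {0..1}"
        by (rule AE_pair_fst[OF prob_space_imp_sigma_finite[OF T.prob_space_axioms] aeU])
      have 3: "AE z in ?T \<Otimes>\<^sub>M ?T. snd (snd z) \<in> {0..1}"
        by (rule AE_pair_snd[OF prob_space_imp_sigma_finite[OF T.prob_space_axioms] aeU])
      from 1 2 3 AE_space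
      show "AE z in ?T \<Otimes>\<^sub>M ?T. W_I (g (fst z)) (g (snd z)) = ?w (fst (fst z)) (fst (snd z))"
      proof eventually_elim
        case (elim z)
        obtain p u q v where z: "z = ((p, u), (q, v))" by (cases z) (metis surj_pair)
        have V: "p \<in> ?V" "q \<in> ?V"
          using elim(4) z by (auto simp: space_pair_measure space_uniform_count_measure)
        have uv: "0 \<le> v" "v \<le> 1" using elim(3) z by auto
        have gz: "g (fst z) = (?X (p, u), rank_upto ?M a (b p))" "g (snd z)
          = (?X (q, v), rank_upto ?M a (b q))"
          using elim(2,3) z by (auto simp: g_def)
        \<comment> \<open>The rank of \<open>q\<close> lies between the masses of left endpoints
          \<open>< a q\<close> and \<open>\<le> a q\<close>. If \<open>b p < a q\<close>, the first
          is at least \<open>rank_upto ?M a (b p)\<close>, and ties are already excluded; otherwise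
          the second is at most that.\<close>
        have "rank_upto ?M a (b p) < ?X (q, v) \<longleftrightarrow> b p < a q"
        proof
          assume "b p < a q"
          then have "rank_upto ?M a (b p) \<le> ?X (q, v)"
            using M.rank_upto_le_below[OF a] M.random_rank_between(1)[OF a uv, of q] by (meson order_trans)
          then show "rank_upto ?M a (b p) < ?X (q, v)"
            using elim(1) gz by simp
        next
          assume *: "rank_upto ?M a (b p) < ?X (q, v)"
          show "b p < a q"
          proof (rule ccontr)
            assume "\<not> b p < a q"
            then have "rank_upto ?M a (a q) \<le> rank_upto ?M a (b p)"
              using monoD[OF M.rank_upto_mono[OF a], of "a q" "b p"] by simp
            then show False using * M.random_rank_between(2)[OF a uv, of q] by simp
          qed
        qed
        then show ?case
          using ab(2)[OF V] gz z by (simp add: W_I_def prec_I_def)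
      qed
    qed
    also have "\<dots> = kernel_density ?w (distr ?T ?M fst) Q"
      by (rule kernel_density_distr[OF T.prob_space_axioms measurable_fst w, symmetric])
    also have "\<dots> = order_density Q P"
      by (simp add: U.distr_pair_fst order_density_kernel)
    finally show ?thesis .
  qed
  moreover have "?\<mu> \<in> P_L"
    by (rule P_L_distr(1)[OF T.prob_space_axioms g S U])
  ultimately show ?thesis by (rule that[rotated])
qed

section \<open>Approximation and compactness\<close>

text \<open>A density depends on the measure only through its law on the plane, so
  \<open>\<mu>\<close> may be replaced by any random interval with that law.\<close>

lemma kernel_density_P_L_distr:
  assumes \<mu>: "\<mu> \<in> P_L" and T: "prob_space T" and f: "f \<in> borel_measurable T"
    and eq: "distr T borel f = distr \<mu> borel (\<lambda>p. p)"
  shows "kernel_density (\<lambda>p q. W_I (f p) (f q)) T Q = kernel_density W_I \<mu> Q"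
  using kernel_density_distr[OF T f W_I_borel, of Q]
    kernel_density_distr[OF P_L_D(1)[OF \<mu>] P_L_D(4)[OF \<mu>] W_I_borel, of Q]
  by (simp add: eq)

lemma fst_uniform_P_L_distr:
  assumes \<mu>: "\<mu> \<in> P_L" and f: "f \<in> borel_measurable T"
    and eq: "distr T borel f = distr \<mu> borel (\<lambda>p. p)"
  shows "distr T borel (\<lambda>z. fst (f z)) = U01"
proof -
  have "distr T borel (\<lambda>z. fst (f z)) = distr (distr T borel f) borel fst"
    by (subst distr_distr[OF measurable_fst_snd_borel(1) f]) (simp add: comp_def)
  also have "\<dots> = distr \<mu> borel fst"
    unfolding eq by (subst distr_distr[OF measurable_fst_snd_borel(1) P_L_D(4)[OF \<mu>]]) (simp add: comp_def)
  finally show ?thesis using P_L_D(7)[OF \<mu>] by simp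
qed

lemma AE_P_L_neq:
  assumes T: "prob_space T" and f: "f \<in> borel_measurable T"
    and U: "distr T borel (\<lambda>z. fst (f z)) = U01"
  shows "AE z in T \<Otimes>\<^sub>M T. snd (f (fst z)) \<noteq> fst (f (snd z))"
proof -
  note [measurable] = f
  show ?thesis by (rule AE_pair_uniform_neq[OF T _ _ U]) measurable
qed

text \<open>\<open>\<rho>\<close> undoes \<open>s\<close> on the space of \<open>\<mu>\<close>, so a
  real variable with the law of \<open>s\<close> encodes \<open>\<mu>\<close> completely.\<close>

lemma distr_curve:
  assumes \<mu>: "\<mu> \<in> P_L" and \<rho>: "\<rho> \<in> borel_measurable borel" and s: "s \<in> borel_measurable borel"
    and inv: "\<And>p. p \<in> S_I \<Longrightarrow> \<rho> (s p) = p"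
    and Y: "Y \<in> borel_measurable T" and eq: "distr T borel Y = distr \<mu> borel s"
  shows "distr T borel (\<lambda>z. \<rho> (Y z)) = distr \<mu> borel (\<lambda>p. p :: real \<times> real)"
proof -
  have s': "s \<in> borel_measurable \<mu>"
    using measurable_compose[OF P_L_D(4)[OF \<mu>] s] by simp
  have "distr T borel (\<lambda>z. \<rho> (Y z)) = distr (distr T borel Y) borel \<rho>"
    by (subst distr_distr[OF \<rho> Y]) (simp add: comp_def)
  also have "\<dots> = distr \<mu> borel (\<lambda>p. \<rho> (s p))"
    unfolding eq by (subst distr_distr[OF \<rho> s']) (simp add: comp_def)
  also have "\<dots> = distr \<mu> borel (\<lambda>p. p)"
    using inv P_L_D(3)[OF \<mu>] by (intro distr_cong) auto
  finally show ?thesis .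
qed

lemma distr_floor_uniform:
  fixes n :: nat
  assumes n: "0 < n"
  shows "distr (restrict_space lborel {0<..<1::real}) (uniform_count_measure {..<n}) (\<lambda>\<omega>. nat \<lfloor>real n *
    \<omega>\<rfloor>) = uniform_count_measure {..<n}"
    and "(\<lambda>\<omega>. nat \<lfloor>real n * \<omega>\<rfloor>) \<in> restrict_space lborel {0<..<1::real} \<rightarrow>\<^sub>M uniform_count_measure {..<n}"
proof -
  let ?\<Omega> = "restrict_space lborel {0<..<1::real}" and ?U = "uniform_count_measure {..<n}"
  let ?h = "\<lambda>\<omega>. nat \<lfloor>real n * \<omega>\<rfloor>"
  have iff: "?h \<omega> = l \<longleftrightarrow> real l / real n \<le> \<omega> \<and> \<omega> < real (Suc l) / real n" if "0 < \<omega>" for \<omega> :: real and l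
  proof -
    have "?h \<omega> = l \<longleftrightarrow> \<lfloor>real n * \<omega>\<rfloor> = int l"
      using that n by (auto simp: nat_eq_iff)
    also have "\<dots> \<longleftrightarrow> real l \<le> real n * \<omega> \<and> real n * \<omega> < real l + 1"
      by (simp add: floor_eq_iff)
    also have "\<dots> \<longleftrightarrow> real l / real n \<le> \<omega> \<and> \<omega> < real (Suc l) / real n"
      using n by (simp add: field_simps)
    finally show ?thesis .
  qed
  have lt: "?h \<omega> < n" if "0 < \<omega>" "\<omega> < 1" for \<omega> :: real
    using that n by (simp add: nat_less_iff floor_less_iff)
  have h: "?h \<in> ?\<Omega> \<rightarrow>\<^sub>M count_space UNIV"
  proof -
    have "(\<lambda>\<omega>::real. \<lfloor>real n * \<omega>\<rfloor>) \<in> borel \<rightarrow>\<^sub>M count_space UNIV" by measurable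
    from measurable_compose[OF this, of nat "count_space UNIV"]
    have "?h \<in> borel \<rightarrow>\<^sub>M count_space UNIV" by simp
    then show ?thesis by (intro measurable_restrict_space1) simp
  qed
  show h': "?h \<in> ?\<Omega> \<rightarrow>\<^sub>M ?U"
  proof (rule measurableI)
    fix A assume "A \<in> sets ?U"
    then show "?h -` A \<inter> space ?\<Omega> \<in> sets ?\<Omega>"
      using measurable_sets[OF h, of A] by simp
  qed (auto simp: space_restrict_space space_uniform_count_measure lt)
  show "distr ?\<Omega> ?U ?h = ?U"
  proof (rule measure_eqI_finite[of _ "{..<n}"])
    fix l assume "l \<in> {..<n}"
    then have l: "l < n" by simp
    have "emeasure (distr ?\<Omega> ?U ?h) {l} = emeasure ?\<Omega> (?h -` {l} \<inter> space ?\<Omega>)"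
      using l h' by (simp add: emeasure_distr sets_uniform_count_measure)
    also have "\<dots> = emeasure lborel (?h -` {l} \<inter> space ?\<Omega>)"
      by (subst emeasure_restrict_space) (auto simp: space_restrict_space)
    \<comment> \<open>The preimage and the cell differ at most in the point 0, which occurs for
      \<open>l = 0\<close>.\<close>
    also have "\<dots> = emeasure lborel {real l / real n..<real (Suc l) / real n}"
    proof (rule emeasure_eq_AE)
      show "AE x in lborel. x \<in> ?h -` {l} \<inter> space ?\<Omega> \<longleftrightarrow> x \<in> {real l / real n..<real (Suc l) / real n}"
        using AE_lborel_singleton[of 0]
      proof eventually_elim
        case (elim x)
        have "real (Suc l) / real n \<le> 1" "0 \<le> real l / real n"
          using l n by (auto simp: field_simps)
        moreover have "0 < x" if "real l / real n \<le> x"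
          using that elim \<open>0 \<le> real l / real n\<close> by linarith
        ultimately show ?case
          using iff[of x l] by (auto simp: space_restrict_space)
      qed
      have "?h -` {l} \<inter> space ?\<Omega> \<in> sets ?\<Omega>"
        using measurable_sets[OF h, of "{l}"] by simp
      then show "?h -` {l} \<inter> space ?\<Omega> \<in> sets lborel"
        by (subst (asm) sets_restrict_space_iff) auto
    qed simp
    also have "\<dots> = ennreal (1 / real n)"
      by (subst emeasure_lborel_Ico) (auto simp: divide_right_mono diff_divide_distrib[symmetric])
    also have "\<dots> = emeasure ?U {l}"
      using l by (subst emeasure_uniform_count_measure) auto
    finally show "emeasure (distr ?\<Omega> ?U ?h) {l} = emeasure ?U {l}" .
  qed (auto simp: sets_uniform_count_measure)
qed

text \<open>
  The measure is the image of a quantile function under the curve, and a quantile function is continuous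
  almost everywhere; hence sampling it at \<open>n\<close> equidistant points gives posets that converge.
\<close>

lemma P_L_approx:
  assumes \<mu>: "\<mu> \<in> P_L"
  obtains P where "\<And>n. has_interval_order (P n)"
    "filterlim (\<lambda>n. card (pcarrier (P n))) at_top sequentially"
    "\<And>Q. (\<lambda>n. order_density Q (P n)) \<longlonglongrightarrow> kernel_density W_I \<mu> Q"
proof -
  obtain \<rho> :: "real \<Rightarrow> real \<times> real" and s :: "real \<times> real \<Rightarrow> real"
    where \<rho>: "continuous_on UNIV \<rho>" "\<And>t. \<rho> t \<in> S_I" and s: "s \<in> borel_measurable borel"
    and inv: "\<And>p. p \<in> S_I \<Longrightarrow> \<rho> (s p) = p"
    using space_filling_curve by metis
  have \<rho>m [measurable]: "\<rho> \<in> borel_measurable borel"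
    by (rule borel_measurable_continuous_onI[OF \<rho>(1)])
  interpret \<mu>: prob_space \<mu> by (rule P_L_D[OF \<mu>])
  have s': "s \<in> borel_measurable \<mu>"
    using measurable_compose[OF P_L_D(4)[OF \<mu>] s] by simp
  interpret \<nu>: cdf_distribution "distr \<mu> borel s"
    unfolding cdf_distribution_def using s'
    by (intro real_distribution.intro) (auto intro: \<mu>.prob_space_distr simp: real_distribution_axioms_def)
  let ?\<Omega> = "restrict_space lborel {0<..<1} :: real measure"
  have \<Omega>: "prob_space ?\<Omega>"
    by (auto simp: space_restrict_space emeasure_restrict_space intro!: prob_spaceI)
  interpret \<Omega>: prob_space ?\<Omega> by fact
  have [simp]: "space ?\<Omega> = {0<..<1}" by (simp add: space_restrict_space)
  have I: "\<nu>.I \<in> borel_measurable ?\<Omega>"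
  proof -
    have eq: "sets ?\<Omega> = sets (restrict_space borel {0<..<1})"
      by (rule sets_restrict_space_cong) simp
    show ?thesis unfolding measurable_cong_sets[OF eq refl] by (rule \<nu>.measurable_CI)
  qed
  define g where "g \<omega> = \<rho> (\<nu>.I \<omega>)" for \<omega>
  have g: "g \<in> borel_measurable ?\<Omega>"
    unfolding g_def by (rule measurable_compose[OF I \<rho>m])
  have law: "distr ?\<Omega> borel g = distr \<mu> borel (\<lambda>p. p)"
    unfolding g_def by (rule distr_curve[OF \<mu> \<rho>m s inv I \<nu>.distr_I_eq_M])
  \<comment> \<open>Samples at the midpoints of \<open>n + 1\<close> equal cells,
    \<open>n + 1\<close> so that no poset is empty; \<open>h n \<omega>\<close> is the index of the
    cell that contains \<open>\<omega>\<close>.\<close>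
  define z where "z n l = g ((real l + 1 / 2) / real (Suc n))" for n l :: nat
  define h where "h n \<omega> = nat \<lfloor>real (Suc n) * \<omega>\<rfloor>" for n \<omega>
  define lt where "lt n i j \<longleftrightarrow> prec_I (z n i) (z n j)" for n i j
  define P where "P n = strict_poset {..<Suc n} (lt n)" for n
  have zS: "z n l \<in> S_I" for n l
    unfolding z_def g_def by (rule \<rho>)
  have zz: "fst (z n l) \<le> snd (z n l)" for n l
    using zS[of n l] by (auto simp: S_I_def)
  have irr: "\<not> lt n i i" and tr: "lt n i j \<Longrightarrow> lt n j k \<Longrightarrow> lt n i k" for n i j k
    using zz[of n i] zz[of n j] by (auto simp: lt_def prec_I_def)
  have P: "pcarrier (P n) = {..<Suc n}" "plt (P n) i j \<longleftrightarrow> i \<in> {..<Suc n} \<and> j \<in> {..<Suc n} \<and> lt n i j"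
    for n i j
  proof -
    note * = strict_poset[of "{..<Suc n}" "lt n", OF finite_lessThan _ irr tr]
    show "pcarrier (P n) = {..<Suc n}" unfolding P_def by (rule *) auto
    show "plt (P n) i j \<longleftrightarrow> i \<in> {..<Suc n} \<and> j \<in> {..<Suc n} \<and> lt n i j"
      unfolding P_def by (rule *) auto
  qed
  have io: "has_interval_order (P n)" for n
    unfolding has_interval_order_def
  proof (intro exI[of _ "\<lambda>l. {fst (z n l)..snd (z n l)}"] conjI ballI)
    fix p q assume "p \<in> pcarrier (P n)" "q \<in> pcarrier (P n)"
    then have "plt (P n) p q \<longleftrightarrow> snd (z n p) < fst (z n q)"
      by (simp add: P lt_def prec_I_def)
    moreover have "b < c \<longleftrightarrow> (\<forall>x\<in>{a..b}. \<forall>y\<in>{c..d}. x < y)" if "a \<le> b" "c \<le> d" for a b c d :: real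
      using that by (meson atLeastAtMost_iff le_less_trans less_le_trans order_refl)
    ultimately show "plt (P n) p q \<longleftrightarrow> (\<forall>x\<in>{fst (z n p)..snd (z n p)}. \<forall>y\<in>{fst (z n q)..snd (z n q)}. x < y)"
      using zz by simp
  qed (use zz in \<open>auto simp: is_interval_cc\<close>)
  have size: "filterlim (\<lambda>n. card (pcarrier (P n))) at_top sequentially"
    unfolding P by (simp add: filterlim_Suc)
  have hm: "h n \<in> ?\<Omega> \<rightarrow>\<^sub>M uniform_count_measure {..<Suc n}" for n
    unfolding h_def by (rule distr_floor_uniform) simp
  have hd: "distr ?\<Omega> (uniform_count_measure {..<Suc n}) (h n) = uniform_count_measure {..<Suc n}" for n
    unfolding h_def by (rule distr_floor_uniform) simp
  have zh: "(\<lambda>\<omega>. z n (h n \<omega>)) \<in> borel_measurable ?\<Omega>" for n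
  proof (rule measurable_compose[OF hm])
    show "z n \<in> borel_measurable (uniform_count_measure {..<Suc n})"
      by (rule measurableI) (auto simp: sets_uniform_count_measure space_uniform_count_measure)
  qed
  \<comment> \<open>A uniform element of \<open>P n\<close> is \<open>h n \<omega>\<close> with
    \<open>\<omega>\<close> uniform, so all \<open>P n\<close> are compared with
    \<open>\<mu>\<close> on one space.\<close>
  have dens: "order_density Q (P n) = kernel_density (\<lambda>p q. W_I (z n (h n p)) (z n (h n q))) ?\<Omega> Q" for n Q
  proof -
    let ?U = "uniform_count_measure {..<Suc n}"
    let ?w = "\<lambda>p q. if plt (P n) p q then 1 else 0 :: real"
    have w: "case_prod ?w \<in> borel_measurable (?U \<Otimes>\<^sub>M ?U)"
      by (rule measurable_uniform_count_pair) simp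
    have "order_density Q (P n) = kernel_density ?w (distr ?\<Omega> ?U (h n)) Q"
      unfolding order_density_kernel hd P(1) ..
    also have "\<dots> = kernel_density (\<lambda>p q. ?w (h n p) (h n q)) ?\<Omega> Q"
      by (rule kernel_density_distr[OF \<Omega> hm w])
    also have "\<dots> = kernel_density (\<lambda>p q. W_I (z n (h n p)) (z n (h n q))) ?\<Omega> Q"
    proof (rule kernel_density_cong_AE[OF \<Omega> _ W_I_comp_measurable[OF zh]])
      have "(\<lambda>x. (h n (fst x), h n (snd x))) \<in> ?\<Omega> \<Otimes>\<^sub>M ?\<Omega> \<rightarrow>\<^sub>M ?U \<Otimes>\<^sub>M ?U"
        using hm by measurable
      from measurable_compose[OF this w]
      show "(\<lambda>(p, q). ?w (h n p) (h n q)) \<in> borel_measurable (?\<Omega> \<Otimes>\<^sub>M ?\<Omega>)"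
        by (simp add: split_beta)
      show "AE x in ?\<Omega> \<Otimes>\<^sub>M ?\<Omega>. ?w (h n (fst x)) (h n (snd x)) = W_I (z n (h n (fst x))) (z n (h n (snd x)))"
      proof (rule AE_I2)
        fix x assume "x \<in> space (?\<Omega> \<Otimes>\<^sub>M ?\<Omega>)"
        then have "h n (fst x) \<in> {..<Suc n}" "h n (snd x) \<in> {..<Suc n}"
          using measurable_space[OF hm] by (auto simp: space_pair_measure space_uniform_count_measure)
        then show "?w (h n (fst x)) (h n (snd x)) = W_I (z n (h n (fst x))) (z n (h n (snd x)))"
          by (simp add: P lt_def W_I_def)
      qed
    qed
    finally show ?thesis .
  qed
  have conv: "AE \<omega> in ?\<Omega>. (\<lambda>n. z n (h n \<omega>)) \<longlonglongrightarrow> g \<omega>"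
  proof -
    let ?D = "{\<omega>\<in>{0<..<1}. \<not> isCont \<nu>.I \<omega>}"
    have D: "countable ?D"
      using mono_on_ctble_discont[OF \<nu>.mono_I] by (simp add: at_within_open[of _
        "{0 <..< 1}"] cong: conj_cong)
    then have "emeasure ?\<Omega> ?D = 0"
      using emeasure_lborel_countable[OF D] by (subst emeasure_restrict_space) auto
    moreover have "?D \<in> sets ?\<Omega>"
      using countable_imp_null_set_lborel[OF D] by (subst sets_restrict_space_iff) auto
    ultimately have "AE \<omega> in ?\<Omega>. isCont \<nu>.I \<omega>"
      by (intro AE_I[of _ _ ?D]) auto
    then show ?thesis
      using AE_space
    proof eventually_elim
      case (elim \<omega>)
      have "(\<lambda>n. (real (h n \<omega>) + 1 / 2) / real (Suc n)) \<longlonglongrightarrow> \<omega>"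
      proof (rule LIMSEQ_I)
        fix e :: real assume "0 < e"
        then obtain N where N: "inverse (real (Suc N)) < e" using reals_Archimedean by blast
        show "\<exists>N. \<forall>n\<ge>N. norm ((real (h n \<omega>) + 1 / 2) / real (Suc n) - \<omega>) < e"
        proof (intro exI[of _ N] allI impI)
          fix n assume n: "N \<le> n"
          have h: "real (h n \<omega>) = \<lfloor>real (Suc n) * \<omega>\<rfloor>"
            using elim by (simp add: h_def)
          have "\<bar>real (h n \<omega>) + 1 / 2 - real (Suc n) * \<omega>\<bar> \<le> 1"
            unfolding h by linarith
          then have "\<bar>(real (h n \<omega>) + 1 / 2 - real (Suc n) * \<omega>) / real (Suc n)\<bar> \<le> 1 / real (Suc n)"
            unfolding abs_divide by (intro divide_mono) auto
          also have "\<dots> \<le> inverse (real (Suc N))"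
            using n by (simp add: inverse_eq_divide divide_simps)
          finally show "norm ((real (h n \<omega>) + 1 / 2) / real (Suc n) - \<omega>) < e"
            using N by (simp add: diff_divide_distrib)
        qed
      qed
      then have "(\<lambda>n. \<nu>.I ((real (h n \<omega>) + 1 / 2) / real (Suc n))) \<longlonglongrightarrow> \<nu>.I \<omega>"
        using elim(1) by (rule isCont_tendsto_compose[rotated])
      then show ?case
        unfolding z_def g_def
        by (rule isCont_tendsto_compose[rotated]) (use \<rho>(1) in \<open>simp add: continuous_on_eq_continuous_at\<close>)
    qed
  qed
  have "(\<lambda>n. order_density Q (P n)) \<longlonglongrightarrow> kernel_density W_I \<mu> Q" for Q
    unfolding dens kernel_density_P_L_distr[OF \<mu> \<Omega> g law, symmetric]
    by (rule kernel_density_W_I_tendsto[OF \<Omega> zh g conv])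
      (rule AE_P_L_neq[OF \<Omega> g fst_uniform_P_L_distr[OF \<mu> g law]])
  then show ?thesis by (rule that[OF io size])
qed

text \<open>The laws of \<open>s\<close> live on \<open>[0, 1]\<close>, so they are tight and a
  subsequence converges; Skorohod realises it by variables that converge pointwise, and
  \<open>\<rho>\<close> turns these into converging intervals. The limit \<open>Y'\<close> may leave
  the range of \<open>s\<close>, but \<open>\<rho> (Y' x)\<close> is in \<open>S_I\<close>
  regardless.\<close>

lemma P_L_compact:
  assumes \<mu>: "\<And>n :: nat. \<mu> n \<in> P_L"
  obtains r \<mu>' where "strict_mono r" "\<mu>' \<in> P_L"
    "\<And>Q. (\<lambda>n. kernel_density W_I (\<mu> (r n)) Q) \<longlonglongrightarrow> kernel_density W_I \<mu>' Q"
proof -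
  obtain \<rho> :: "real \<Rightarrow> real \<times> real" and s :: "real \<times> real \<Rightarrow> real"
    where \<rho>: "continuous_on UNIV \<rho>" "\<And>t. \<rho> t \<in> S_I" and s: "s \<in> borel_measurable borel"
    and inv: "\<And>p. p \<in> S_I \<Longrightarrow> \<rho> (s p) = p" and sb: "\<And>p. 0 \<le> s p" "\<And>p. s p \<le> 1"
    using space_filling_curve by metis
  have \<rho>m [measurable]: "\<rho> \<in> borel_measurable borel"
    by (rule borel_measurable_continuous_onI[OF \<rho>(1)])
  have s': "s \<in> borel_measurable (\<mu> n)" for n
    using measurable_compose[OF P_L_D(4)[OF \<mu>] s] by simp
  define \<nu> where "\<nu> n = distr (\<mu> n) borel s" for n
  have rd: "real_distribution (\<nu> n)" for n
    unfolding \<nu>_def using s'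
    by (intro real_distribution.intro) (auto intro: prob_space.prob_space_distr P_L_D[OF \<mu>] simp:
      real_distribution_axioms_def)
  have "tight \<nu>"
    unfolding tight_def
  proof (intro conjI allI impI rd)
    fix e :: real assume "0 < e"
    \<comment> \<open>Tightness asks for half-open intervals; any one that contains
      \<open>[0, 1]\<close> serves for all \<open>e\<close> at once.\<close>
    show "\<exists>a b. a < b \<and> (\<forall>n. 1 - e < measure (\<nu> n) {a<..b})"
    proof (rule exI[of _ "-1"], rule exI[of _ 2], intro conjI allI)
      fix n
      interpret \<mu>n: prob_space "\<mu> n" by (rule P_L_D[OF \<mu>])
      have "measure (\<nu> n) {-1<..2} = measure (\<mu> n) (s -` {-1<..2} \<inter> space (\<mu> n))"
        unfolding \<nu>_def by (rule measure_distr[OF s']) simp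
      also have "s -` {-1<..2} \<inter> space (\<mu> n) = space (\<mu> n)"
      proof -
        have "s p \<in> {-1<..2}" for p using sb(1)[of p] sb(2)[of p] by simp
        then show ?thesis by blast
      qed
      finally show "1 - e < measure (\<nu> n) {-1<..2}" using \<open>0 < e\<close> \<mu>n.prob_space by simp
    qed simp
  qed
  from tight_imp_convergent_subsubsequence[OF this strict_mono_id]
  obtain r M where r: "strict_mono r" and M: "real_distribution M" and wc: "weak_conv_m (\<lambda>n. \<nu> (r n)) M"
    unfolding comp_def id_def by (elim exE conjE)
  from Skorohod[OF rd M wc] obtain \<Omega> :: "real measure" and Y and Y'
    where \<Omega>: "prob_space \<Omega>" and Y: "\<forall>n. Y n \<in> borel_measurable \<Omega>"
      "\<forall>n. distr \<Omega> borel (Y n) = \<nu> (r n)" "Y' \<in> \<Omega> \<rightarrow>\<^sub>M lborel"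
      "\<forall>x\<in>space \<Omega>. (\<lambda>n. Y n x) \<longlonglongrightarrow> Y' x"
    by (elim exE conjE)
  have Ym: "Y n \<in> borel_measurable \<Omega>" and Yd: "distr \<Omega> borel (Y n) = \<nu> (r n)" for n
    using Y by auto
  have Y'm: "Y' \<in> borel_measurable \<Omega>" and conv: "x \<in> space \<Omega> \<Longrightarrow> (\<lambda>n. Y n x) \<longlonglongrightarrow> Y' x" for x
    using Y by auto
  interpret \<Omega>: prob_space \<Omega> by fact
  define f where "f n x = \<rho> (Y n x)" for n x
  define g where "g x = \<rho> (Y' x)" for x
  have f: "f n \<in> borel_measurable \<Omega>" for n
    unfolding f_def by (rule measurable_compose[OF Ym \<rho>m])
  have g: "g \<in> borel_measurable \<Omega>"
    unfolding g_def by (rule measurable_compose[OF Y'm \<rho>m])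
  have law: "distr \<Omega> borel (f n) = distr (\<mu> (r n)) borel (\<lambda>p. p)" for n
    unfolding f_def by (rule distr_curve[OF \<mu> \<rho>m s inv Ym]) (simp_all add: Yd \<nu>_def)
  have fg: "(\<lambda>n. f n x) \<longlonglongrightarrow> g x" if "x \<in> space \<Omega>" for x
    unfolding f_def g_def using conv[OF that]
    by (rule isCont_tendsto_compose[rotated]) (use \<rho>(1) in \<open>simp add: continuous_on_eq_continuous_at\<close>)
  note [measurable] = f g
  have fU: "distr \<Omega> borel (\<lambda>x. fst (f n x)) = U01" for n
    by (rule fst_uniform_P_L_distr[OF \<mu> f law])
  \<comment> \<open>Uniformity passes to the limit through characteristic functions, which do not
    change along the sequence.\<close>
  have gU: "distr \<Omega> borel (\<lambda>x. fst (g x)) = U01"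
  proof (rule Levy_uniqueness[OF _ real_distribution_U01])
    show "real_distribution (distr \<Omega> borel (\<lambda>x. fst (g x)))"
      by (intro real_distribution.intro \<Omega>.prob_space_distr) (auto simp: real_distribution_axioms_def)
    show "char (distr \<Omega> borel (\<lambda>x. fst (g x))) = char U01"
    proof
      fix t
      have ch: "char (distr \<Omega> borel (\<lambda>x. fst (k x))) t = (\<integral>x. iexp (t * fst (k x)) \<partial>\<Omega>)"
        if "k \<in> borel_measurable \<Omega>" for k :: "real \<Rightarrow> real \<times> real"
        unfolding char_def
      proof (rule integral_distr)
        show "(\<lambda>x. fst (k x)) \<in> borel_measurable \<Omega>"
          using measurable_compose[OF that measurable_fst_snd_borel(1)] .
      qed (auto intro!: borel_measurable_continuous_onI continuous_intros)
      have "(\<lambda>n. \<integral>x. iexp (t * fst (f n x)) \<partial>\<Omega>) \<longlonglongrightarrow> (\<integral>x. iexp (t * fst (g x)) \<partial>\<Omega>)"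
        by (rule integral_dominated_convergence[where w="\<lambda>_. 1"])
          (auto intro!: AE_I2 tendsto_intros fg)
      moreover have "(\<integral>x. iexp (t * fst (f n x)) \<partial>\<Omega>) = char U01 t" for n
        using ch[OF f, of n] by (simp add: fU)
      ultimately show "char (distr \<Omega> borel (\<lambda>x. fst (g x))) t = char U01 t"
        using ch[OF g] by (simp add: LIMSEQ_const_iff)
    qed
  qed
  let ?\<mu> = "distr \<Omega> (restrict_space borel S_I) g"
  have S: "g x \<in> S_I" for x unfolding g_def by (rule \<rho>)
  have "(\<lambda>n. kernel_density W_I (\<mu> (r n)) Q) \<longlonglongrightarrow> kernel_density W_I ?\<mu> Q" for Q
    unfolding P_L_distr(2)[OF \<Omega> g S gU] kernel_density_P_L_distr[OF \<mu> \<Omega> f law, symmetric]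
    by (rule kernel_density_W_I_tendsto[OF \<Omega> f g AE_I2[OF fg]]) (auto intro: AE_P_L_neq[OF \<Omega> g gU])
  then show ?thesis by (rule that[OF r P_L_distr(1)[OF \<Omega> g S gU]])
qed

section \<open>Shuffling inside the gaps\<close>

lemma sets_pair_restrict_borel:
  fixes X Y :: "real set"
  shows "sets (restrict_space borel X \<Otimes>\<^sub>M restrict_space borel Y) = sets (restrict_space borel (X \<times> Y))"
    (is "sets ?P = sets ?R")
proof
  have sP: "space ?P = X \<times> Y" and sR: "space ?R = X \<times> Y"
    by (auto simp: space_pair_measure space_restrict_space)
  have "(\<lambda>z. (fst z, snd z)) \<in> ?R \<rightarrow>\<^sub>M ?P"
    by (intro measurable_Pair measurable_restrict_space2 measurable_restrict_space1
      measurable_fst_snd_borel)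
      (auto simp: sR)
  then have 1: "(\<lambda>z. z) \<in> ?R \<rightarrow>\<^sub>M ?P" by simp
  show "sets ?P \<subseteq> sets ?R"
  proof
    fix A assume A: "A \<in> sets ?P"
    then have "A \<subseteq> X \<times> Y" using sets.sets_into_space sP by blast
    then show "A \<in> sets ?R"
      using measurable_sets[OF 1 A] by (simp add: sR vimage_def Int_absorb2)
  qed
  have "(\<lambda>z. (fst z, snd z)) \<in> ?P \<rightarrow>\<^sub>M borel \<Otimes>\<^sub>M borel"
    by (intro measurable_Pair measurable_compose[OF measurable_fst] measurable_compose[OF measurable_snd]
        measurable_restrict_space1) auto
  then have "(\<lambda>z. z) \<in> ?P \<rightarrow>\<^sub>M borel" by (simp add: borel_prod)
  then have 2: "(\<lambda>z. z) \<in> ?P \<rightarrow>\<^sub>M ?R" by (intro measurable_restrict_space2) (auto simp: sP)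
  show "sets ?R \<subseteq> sets ?P"
  proof
    fix A assume A: "A \<in> sets ?R"
    then have "A \<subseteq> X \<times> Y" using sets.sets_into_space sR by blast
    then show "A \<in> sets ?P"
      using measurable_sets[OF 2 A] by (simp add: sP vimage_def Int_absorb2)
  qed
qed

section \<open>The product condition on gaps, tested on rectangles\<close>

lemma measurable_on_square:
  assumes "\<mu> \<in> P_L"
  shows "(\<lambda>p. p) \<in> \<mu> \<rightarrow>\<^sub>M restrict_space borel ({0..1} \<times> {0..1})"
  using P_L_D(3,4)[OF assms] by (intro measurable_restrict_space2) (auto simp: S_I_def)

lemma emeasure_on_square:
  assumes \<mu>: "\<mu> \<in> P_L" and ab: "0 \<le> a" "b \<le> 1"
    and A: "A \<in> sets borel" "A \<subseteq> {a<..<b}" and B: "B \<in> sets borel" "B \<subseteq> {0..1}"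
  shows "emeasure (restrict_space (on_square \<mu>) ({a<..<b} \<times> {0..1})) (A \<times> B) =
    emeasure \<mu> {p \<in> space \<mu>. fst p \<in> A \<and> snd p \<in> B}"
proof -
  let ?R = "restrict_space borel ({0..1} \<times> {0..1}) :: (real \<times> real) measure"
  have sq: "{a<..<b} \<times> {0..1} \<inter> space (on_square \<mu>) \<in> sets (on_square \<mu>)"
  proof -
    have "{a<..<b} \<times> {0..1} \<in> sets (borel :: (real \<times> real) measure)"
      unfolding borel_prod[symmetric] by auto
    then show ?thesis
      using ab by (auto simp: on_square_def sets_restrict_space space_restrict_space)
  qed
  have "A \<times> B \<in> sets (borel :: (real \<times> real) measure)"
    unfolding borel_prod[symmetric] using A B by auto
  then have AB: "A \<times> B \<in> sets ?R"
    using A B ab by (auto simp: sets_restrict_space image_iff intro!: bexI[of _ "A \<times> B"])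
  have "emeasure (restrict_space (on_square \<mu>) ({a<..<b} \<times> {0..1})) (A \<times> B)
    = emeasure (on_square \<mu>) (A \<times> B)"
    using A B by (intro emeasure_restrict_space sq) auto
  also have "\<dots> = emeasure \<mu> ((\<lambda>p. p) -` (A \<times> B) \<inter> space \<mu>)"
    unfolding on_square_def by (rule emeasure_distr[OF measurable_on_square[OF \<mu>] AB])
  also have "(\<lambda>p. p) -` (A \<times> B) \<inter> space \<mu> = {p \<in> space \<mu>. fst p \<in> A \<and> snd p \<in> B}"
    by auto
  finally show ?thesis .
qed

lemma emeasure_right_marginal:
  assumes \<mu>: "\<mu> \<in> P_L" and ab: "0 \<le> a" "b \<le> 1"
  shows "emeasure (right_marginal \<mu>) {a<..<b} = emeasure \<mu> {p \<in> space \<mu>. snd p \<in> {a<..<b}}"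
proof -
  have "snd \<in> \<mu> \<rightarrow>\<^sub>M restrict_space borel {0..1}"
    using P_L_D(3,6)[OF \<mu>] by (intro measurable_restrict_space2) (auto simp: S_I_def)
  moreover have "{a<..<b} \<in> sets (restrict_space borel {0..1})"
    using ab by (auto simp: sets_restrict_space image_iff intro!: bexI[of _ "{a<..<b}"])
  ultimately show ?thesis
    unfolding right_marginal_def
    by (subst emeasure_distr) (auto intro!: arg_cong[where f="emeasure \<mu>"])
qed

text \<open>Later arguments use the product measure on rectangles only; this form avoids the
  restricted spaces of the definition.\<close>

lemma P_L_star_gapD:
  assumes \<mu>: "\<mu> \<in> P_L_star" and ab: "0 \<le> a" "a < b" "b \<le> 1"
    and gap: "emeasure \<mu> {p \<in> space \<mu>. snd p \<in> {a<..<b}} = 0"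
  obtains \<kappa> where "\<And>A B. A \<in> sets borel \<Longrightarrow> A \<subseteq> {a<..<b} \<Longrightarrow> B \<in> sets borel \<Longrightarrow> B \<subseteq> {0..1} \<Longrightarrow>
    emeasure \<mu> {p \<in> space \<mu>. fst p \<in> A \<and> snd p \<in> B} = emeasure lborel A * \<kappa> B"
proof -
  have PL: "\<mu> \<in> P_L" using \<mu> by (simp add: P_L_star_def)
  have "emeasure (right_marginal \<mu>) {a<..<b} = 0"
    using gap emeasure_right_marginal[OF PL ab(1,3)] by simp
  then obtain \<nu> where \<nu>: "sigma_finite_measure \<nu>" "sets \<nu> = sets (restrict_space borel {0..1})"
    "restrict_space (on_square \<mu>) ({a<..<b} \<times> {0..1}) = restrict_space lborel {a<..<b} \<Otimes>\<^sub>M \<nu>"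
    using \<mu> ab unfolding P_L_star_def by blast
  interpret \<nu>: sigma_finite_measure \<nu> by fact
  show ?thesis
  proof (rule that[of "emeasure \<nu>"])
    fix A B :: "real set" assume A: "A \<in> sets borel" "A \<subseteq> {a<..<b}" and B: "B \<in> sets borel" "B \<subseteq> {0..1}"
    have A': "A \<in> sets (restrict_space lborel {a<..<b})" and B': "B \<in> sets \<nu>"
      unfolding \<nu>(2) using A B by (simp_all add: sets_restrict_space_iff)
    have "emeasure \<mu> {p \<in> space \<mu>. fst p \<in> A \<and> snd p \<in> B}
      = emeasure (restrict_space lborel {a<..<b} \<Otimes>\<^sub>M \<nu>) (A \<times> B)"
      using emeasure_on_square[OF PL ab(1,3) A B] \<nu>(3) by simp
    also have "\<dots> = emeasure (restrict_space lborel {a<..<b}) A * emeasure \<nu> B"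
      by (rule \<nu>.emeasure_pair_measure_Times[OF A' B'])
    also have "emeasure (restrict_space lborel {a<..<b}) A = emeasure lborel A"
      using A by (intro emeasure_restrict_space) auto
    finally show "emeasure \<mu> {p \<in> space \<mu>. fst p \<in> A \<and> snd p \<in> B} = emeasure lborel A * emeasure \<nu> B" .
  qed
qed

text \<open>Products of sigma-finite measures are determined by rectangles, so the factorisation has
  to be checked only there. \<open>\<kappa>\<close> is a measure on the whole line and is cut down
  to \<open>{0..1}\<close> in the proof.\<close>

lemma P_L_starI:
  assumes \<mu>: "\<mu> \<in> P_L"
    and gap: "\<And>a b. 0 \<le> a \<Longrightarrow> a < b \<Longrightarrow> b \<le> 1 \<Longrightarrow> emeasure \<mu> {p \<in> space \<mu>. snd p \<in> {a<..<b}} = 0 \<Longrightarrow>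
      \<exists>\<kappa>. prob_space \<kappa> \<and> sets \<kappa> = sets borel \<and> (\<forall>A B. A \<in> sets borel \<longrightarrow> A \<subseteq> {a<..<b} \<longrightarrow> B \<in> sets borel \<longrightarrow>
        emeasure \<mu> {p \<in> space \<mu>. fst p \<in> A \<and> snd p \<in> B} = emeasure lborel A * emeasure \<kappa> B)"
  shows "\<mu> \<in> P_L_star"
  unfolding P_L_star_def
proof (intro CollectI conjI \<mu> allI impI)
  fix a b :: real
  assume *: "0 \<le> a \<and> a < b \<and> b \<le> 1 \<and> emeasure (right_marginal \<mu>) {a<..<b} = 0"
  then have ab: "0 \<le> a" "a < b" "b \<le> 1" by auto
  then have "emeasure \<mu> {p \<in> space \<mu>. snd p \<in> {a<..<b}} = 0"
    using * emeasure_right_marginal[OF \<mu>, of a b] by simp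
  from gap[OF ab this] obtain \<kappa> where \<kappa>: "prob_space \<kappa>" "sets \<kappa> = sets borel"
    "\<And>A B. A \<in> sets borel \<Longrightarrow> A \<subseteq> {a<..<b} \<Longrightarrow> B \<in> sets borel \<Longrightarrow>
        emeasure \<mu> {p \<in> space \<mu>. fst p \<in> A \<and> snd p \<in> B} = emeasure lborel A * emeasure \<kappa> B"
    by auto
  interpret \<kappa>: prob_space \<kappa> by fact
  define \<nu> where "\<nu> = restrict_space \<kappa> {0..1}"
  have s\<nu>: "sets \<nu> = sets (restrict_space borel {0..1})"
    unfolding \<nu>_def by (rule sets_restrict_space_cong[OF \<kappa>(2)])
  have sf1: "sigma_finite_measure \<nu>"
    unfolding \<nu>_def by (intro finite_measure.sigma_finite_measure finite_measure_restrict_space)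
      (auto simp: \<kappa>(2) intro: \<kappa>.finite_measure_axioms)
  have sf2: "sigma_finite_measure (restrict_space lborel {a<..<b})"
    by (intro finite_measure.sigma_finite_measure finite_measureI)
      (use ab in \<open>simp add: space_restrict_space emeasure_restrict_space\<close>)
  have "restrict_space lborel {a<..<b} \<Otimes>\<^sub>M \<nu> = restrict_space (on_square \<mu>) ({a<..<b} \<times> {0..1})"
  proof (rule pair_measure_eqI[OF sf2 sf1])
    have "sets (restrict_space lborel {a<..<b} \<Otimes>\<^sub>M \<nu>)
      = sets (restrict_space borel {a<..<b} \<Otimes>\<^sub>M restrict_space borel {0..1})"
      by (intro sets_pair_measure_cong s\<nu> sets_restrict_space_cong) simp
    also have "\<dots> = sets (restrict_space borel ({a<..<b} \<times> {0..1}))"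
      by (rule sets_pair_restrict_borel)
    also have "\<dots> = sets (restrict_space (restrict_space borel ({0..1} \<times> {0..1})) ({a<..<b} \<times> {0..1}))"
    proof -
      have "({0..1} \<times> {0..1}) \<inter> ({a<..<b} \<times> {0..1::real}) = {a<..<b} \<times> {0..1}"
        using ab by auto
      then show ?thesis by (subst restrict_restrict_space) (auto simp: borel_prod[symmetric])
    qed
    also have "\<dots> = sets (restrict_space (on_square \<mu>) ({a<..<b} \<times> {0..1}))"
      by (intro sets_restrict_space_cong) (simp add: on_square_def)
    finally show "sets (restrict_space lborel {a<..<b} \<Otimes>\<^sub>M \<nu>)
      = sets (restrict_space (on_square \<mu>) ({a<..<b} \<times> {0..1}))" .
    fix A B assume "A \<in> sets (restrict_space lborel {a<..<b})" "B \<in> sets \<nu>"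
    then have A: "A \<in> sets borel" "A \<subseteq> {a<..<b}" and B: "B \<in> sets borel" "B \<subseteq> {0..1}"
      unfolding s\<nu> by (auto simp: sets_restrict_space)
    have "emeasure (restrict_space lborel {a<..<b}) A = emeasure lborel A"
      using A by (intro emeasure_restrict_space) auto
    moreover have "emeasure \<nu> B = emeasure \<kappa> B"
      unfolding \<nu>_def using B by (intro emeasure_restrict_space) (auto simp: \<kappa>(2))
    ultimately show "emeasure (restrict_space lborel {a<..<b}) A * emeasure \<nu> B
      = emeasure (restrict_space (on_square \<mu>) ({a<..<b} \<times> {0..1})) (A \<times> B)"
      using emeasure_on_square[OF \<mu> ab(1,3) A B] \<kappa>(3)[OF A B(1)] by simp
  qed
  then show "\<exists>\<nu>. sigma_finite_measure \<nu> \<and> sets \<nu> = sets (restrict_space borel {0..1}) \<and>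
     restrict_space (on_square \<mu>) ({a<..<b} \<times> {0..1}) = restrict_space lborel {a<..<b} \<Otimes>\<^sub>M \<nu>"
    using sf1 s\<nu> by (intro exI[of _ \<nu>]) simp
qed

lemma measure_fst_P_L:
  assumes \<mu>: "\<mu> \<in> P_L" and c: "0 \<le> c" "c \<le> 1"
  shows "measure \<mu> {p \<in> space \<mu>. fst p \<le> c} = c" "measure \<mu> {p \<in> space \<mu>. fst p < c} = c"
proof -
  note [measurable] = P_L_D(5)[OF \<mu>]
  interpret \<mu>: prob_space \<mu> by (rule P_L_D[OF \<mu>])
  have "measure \<mu> {p \<in> space \<mu>. fst p \<le> c} = measure (distr \<mu> borel fst) {..c}"
    by (subst measure_distr) (auto intro!: arg_cong[where f="measure \<mu>"])
  also have "\<dots> = c"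
    unfolding P_L_D(7)[OF \<mu>] using c
    by (subst measure_uniform_measure) (auto simp: Int_atLeastAtMostL1 atMost_def[symmetric])
  finally show *: "measure \<mu> {p \<in> space \<mu>. fst p \<le> c} = c" .
  have "AE u in distr \<mu> borel fst. u \<noteq> c"
    unfolding P_L_D(7)[OF \<mu>] by (rule AE_U01_neq)
  from AE_distrD[OF P_L_D(5)[OF \<mu>] this]
  have "measure \<mu> {p \<in> space \<mu>. fst p < c} = measure \<mu> {p \<in> space \<mu>. fst p \<le> c}"
    by (intro \<mu>.finite_measure_eq_AE) (auto elim!: eventually_mono)
  then show "measure \<mu> {p \<in> space \<mu>. fst p < c} = c" using * by simp
qed

section \<open>Level sets of \<open>G\<close> and ranks of \<open>Z\<close>\<close>

locale P_L_measure =
  fixes \<mu> :: "(real \<times> real) measure"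
  assumes P_L: "\<mu> \<in> P_L"
begin

sublocale prob_space \<mu> by (rule P_L_D[OF P_L])

lemma meas [measurable]: "fst \<in> borel_measurable \<mu>" "snd \<in> borel_measurable \<mu>"
  using P_L_D[OF P_L] by auto

lemma space_S_I: "p \<in> space \<mu> \<Longrightarrow> 0 \<le> fst p \<and> fst p \<le> snd p \<and> snd p \<le> 1"
  using P_L_D(3)[OF P_L] by (auto simp: S_I_def)

text \<open>
  \<open>G\<close> is constant exactly on the gaps of the right marginal, and \<open>Z\<close> is the expected proportion of
  intervals to the left of a given one.
\<close>

definition G :: "real \<Rightarrow> real" where "G = rank_below \<mu> snd"

definition Z :: "real \<times> real \<Rightarrow> real" where "Z p = G (fst p)"

lemma G_mono: "x \<le> y \<Longrightarrow> G x \<le> G y"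
  using monoD[OF rank_below_mono[OF meas(2)]] by (simp add: G_def)

lemma G_meas [measurable]: "G \<in> borel_measurable borel"
  by (intro borel_measurable_mono monoI G_mono)

lemma Z_meas [measurable]: "Z \<in> borel_measurable \<mu>"
  unfolding Z_def by measurable

text \<open>As \<open>fst\<close> is uniform and \<open>G\<close> monotone,
  \<open>rank_below \<mu> Z w\<close> is the length of the initial segment of \<open>[0, 1]\<close>
  where \<open>G < w\<close>, and \<open>rank_upto \<mu> Z w\<close> that of the one where
  \<open>G \<le> w\<close>. This and the next three lemmas bound these lengths by testing
  \<open>G\<close>. For \<open>w = G x\<close> the two ranks are the ends of the level set of
  \<open>G\<close> through \<open>x\<close>.\<close>

lemma rank_below_Z_le: "0 \<le> c \<Longrightarrow> c \<le> 1 \<Longrightarrow> (\<And>u. c < u \<Longrightarrow> w \<le> G u) \<Longrightarrow> rank_below \<mu> Z w \<le> c"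
  unfolding rank_below_def
proof -
  assume c: "0 \<le> c" "c \<le> 1" and u: "\<And>u. c < u \<Longrightarrow> w \<le> G u"
  have "measure \<mu> {q \<in> space \<mu>. Z q < w} \<le> measure \<mu> {p \<in> space \<mu>. fst p \<le> c}"
    using u by (intro finite_measure_mono) (auto simp: Z_def not_le[symmetric])
  then show "measure \<mu> {q \<in> space \<mu>. Z q < w} \<le> c" using measure_fst_P_L[OF P_L c] by simp
qed

lemma le_rank_below_Z: "0 \<le> c \<Longrightarrow> c \<le> 1 \<Longrightarrow> G c < w \<Longrightarrow> c \<le> rank_below \<mu> Z w"
  unfolding rank_below_def
proof -
  assume c: "0 \<le> c" "c \<le> 1" and u: "G c < w"
  have "measure \<mu> {p \<in> space \<mu>. fst p \<le> c} \<le> measure \<mu> {q \<in> space \<mu>. Z q < w}"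
    using u by (intro finite_measure_mono) (auto simp: Z_def intro: le_less_trans[OF G_mono])
  then show "c \<le> measure \<mu> {q \<in> space \<mu>. Z q < w}" using measure_fst_P_L[OF P_L c] by simp
qed

lemma le_rank_upto_Z: "0 \<le> c \<Longrightarrow> c \<le> 1 \<Longrightarrow> G c \<le> w \<Longrightarrow> c \<le> rank_upto \<mu> Z w"
  unfolding rank_upto_def
proof -
  assume c: "0 \<le> c" "c \<le> 1" and u: "G c \<le> w"
  have "measure \<mu> {p \<in> space \<mu>. fst p \<le> c} \<le> measure \<mu> {q \<in> space \<mu>. Z q \<le> w}"
    using u by (intro finite_measure_mono) (auto simp: Z_def intro: order_trans[OF G_mono])
  then show "c \<le> measure \<mu> {q \<in> space \<mu>. Z q \<le> w}" using measure_fst_P_L[OF P_L c] by simp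
qed

lemma rank_upto_Z_le: "0 \<le> c \<Longrightarrow> c \<le> 1 \<Longrightarrow> w < G c \<Longrightarrow> rank_upto \<mu> Z w \<le> c"
  unfolding rank_upto_def
proof -
  assume c: "0 \<le> c" "c \<le> 1" and u: "w < G c"
  have "measure \<mu> {q \<in> space \<mu>. Z q \<le> w} \<le> measure \<mu> {p \<in> space \<mu>. fst p < c}"
  proof (intro finite_measure_mono subsetI CollectI conjI)
    fix q assume q: "q \<in> {q \<in> space \<mu>. Z q \<le> w}"
    show "fst q < c"
    proof (rule ccontr)
      assume "\<not> fst q < c"
      then have "G c \<le> G (fst q)" by (intro G_mono) simp
      then show False using q u by (simp add: Z_def)
    qed
  qed auto
  then show "measure \<mu> {q \<in> space \<mu>. Z q \<le> w} \<le> c" using measure_fst_P_L[OF P_L c] by simp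
qed

text \<open>Almost every right endpoint is good: only countably many null intervals are excluded.\<close>

definition good :: "real \<Rightarrow> bool" where
  "good y \<longleftrightarrow> (\<forall>a\<in>\<rat>. \<forall>b\<in>\<rat>. G a = G b \<longrightarrow> \<not> (a < y \<and> y < b))"

text \<open>Strictly between the ends of a level set of \<open>G\<close>, there are rational points
  of the level set on both sides of \<open>y\<close>, which \<open>good\<close> forbids.\<close>

lemma good_not_between:
  assumes y: "good y" and x: "rank_below \<mu> Z (G x) < y" "y < rank_upto \<mu> Z (G x)"
  shows False
proof -
  obtain a where a: "a \<in> \<rat>" "rank_below \<mu> Z (G x) < a" "a < y"
    using Rats_dense_in_real[OF x(1)] by blast
  obtain b where b: "b \<in> \<rat>" "y < b" "b < rank_upto \<mu> Z (G x)"
    using Rats_dense_in_real[OF x(2)] by blast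
  have ab: "0 \<le> a" "a \<le> 1" "0 \<le> b" "b \<le> 1"
    using a b rank_bounds[of Z "G x"] by linarith+
  have "G x \<le> G a" using le_rank_below_Z[OF ab(1,2), of "G x"] a by linarith
  moreover have "G b \<le> G x" using rank_upto_Z_le[OF ab(3,4), of "G x"] b by linarith
  moreover have "G a \<le> G b" using a b by (intro G_mono) simp
  ultimately show False using y a b by (auto simp: good_def)
qed

text \<open>\<open>G b - G a\<close> is the mass of the right endpoints in \<open>[a, b)\<close>,
  closed on the left because \<open>G\<close> counts strictly smaller right endpoints.\<close>

lemma G_eq_iff: "a \<le> b \<Longrightarrow> G a = G b \<longleftrightarrow> measure \<mu> {p \<in> space \<mu>. snd p \<in> {a..<b}} = 0"
proof -
  assume ab: "a \<le> b"
  have "measure \<mu> {p \<in> space \<mu>. snd p < b}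
    = measure \<mu> ({p \<in> space \<mu>. snd p < a} \<union> {p \<in> space \<mu>. snd p \<in> {a..<b}})"
    using ab by (intro arg_cong[where f="measure \<mu>"]) auto
  also have "\<dots> = measure \<mu> {p \<in> space \<mu>. snd p < a} + measure \<mu> {p \<in> space \<mu>. snd p \<in> {a..<b}}"
    by (intro finite_measure_Union) auto
  finally show ?thesis by (simp add: G_def rank_below_def)
qed

lemma AE_good: "AE p in \<mu>. good (snd p)"
proof -
  have "AE p in \<mu>. \<forall>a\<in>\<rat>. \<forall>b\<in>\<rat>. G a = G b \<longrightarrow> \<not> (a < snd p \<and> snd p < b)"
  proof (intro AE_ball_countable[THEN iffD2] ballI countable_rat)
    fix a b :: real
    show "AE p in \<mu>. G a = G b \<longrightarrow> \<not> (a < snd p \<and> snd p < b)"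
    proof (cases "a \<le> b \<and> G a = G b")
      case True
      then have "AE p in \<mu>. p \<notin> {p \<in> space \<mu>. snd p \<in> {a..<b}}"
        using G_eq_iff[of a b] by (intro AE_not_in) (auto simp: null_sets_def emeasure_eq_measure)
      then show ?thesis using AE_space by eventually_elim auto
    next
      case False
      then show ?thesis by (intro AE_I2) auto
    qed
  qed
  then show ?thesis by (simp add: good_def)
qed

lemma AE_fst_neq: "AE p in \<mu>. fst p \<noteq> c"
proof -
  have "AE u in distr \<mu> borel fst. u \<noteq> c"
    unfolding P_L_D(7)[OF P_L] by (rule AE_U01_neq)
  from AE_distrD[OF meas(1) this] show ?thesis .
qed

text \<open>This excludes the left ends of the gaps, where an interval could consist of a single point.\<close>

lemma AE_not_endpoint: "AE p in \<mu>. \<forall>q\<in>\<rat>. fst p \<noteq> rank_below \<mu> Z (G q)"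
  by (intro AE_ball_countable[THEN iffD2] ballI countable_rat AE_fst_neq)

lemma fst_between:
  assumes p: "p \<in> space \<mu>"
  shows "rank_below \<mu> Z (Z p) \<le> fst p" "fst p \<le> rank_upto \<mu> Z (Z p)"
proof -
  have b: "0 \<le> fst p" "fst p \<le> 1" using space_S_I[OF p] by auto
  show "rank_below \<mu> Z (Z p) \<le> fst p"
    unfolding Z_def[of p] by (intro rank_below_Z_le b G_mono) simp
  show "fst p \<le> rank_upto \<mu> Z (Z p)"
    unfolding Z_def[of p] by (intro le_rank_upto_Z b) simp
qed

section \<open>The redistributed left endpoint\<close>

abbreviation "T \<equiv> \<mu> \<Otimes>\<^sub>M U01"
abbreviation "X \<equiv> random_rank \<mu> Z"

lemma prob_space_T: "prob_space T"
proof -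
  interpret U: prob_space U01 by (rule prob_space_U01)
  interpret T: pair_prob_space \<mu> U01 ..
  show ?thesis by (rule T.prob_space_axioms)
qed

lemma X_meas [measurable]: "X \<in> borel_measurable T"
  by (rule random_rank_measurable[OF Z_meas])

lemma snd_fst_meas [measurable]: "(\<lambda>z. snd (fst z)) \<in> borel_measurable T"
  by (rule measurable_compose[OF measurable_fst meas(2)])

lemma AE_T_fst: "AE p in \<mu>. P p \<Longrightarrow> AE z in T. P (fst z)"
  by (rule AE_pair_fst[OF U01_sigma_finite])

lemma AE_T_snd: "AE z in T. snd z \<in> {0..1}"
  by (rule AE_pair_snd[OF U01_sigma_finite AE_U01])

lemma X_between:
  assumes "snd z \<in> {0..1}"
  shows "rank_below \<mu> Z (Z (fst z)) \<le> X z" "X z \<le> rank_upto \<mu> Z (Z (fst z))"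
  using random_rank_between[OF Z_meas, of "snd z" "fst z"] assms by auto

text \<open>\<open>X z\<close> stays between the ends \<open>l\<close> and \<open>r\<close> of the
  level set of \<open>x\<close>, and a good \<open>y\<close> is not strictly inside. As
  \<open>l \<le> x \<le> y\<close>, either \<open>y \<ge> r \<ge> X z\<close>, or
  \<open>y = x = l < r\<close>. In the second case \<open>x\<close> is the left end of a level set
  of positive length, which \<open>AE_not_endpoint\<close> rules out.\<close>

lemma AE_X_S_I: "AE z in T. (X z, snd (fst z)) \<in> S_I"
  using AE_T_snd AE_T_fst[OF AE_good] AE_T_fst[OF AE_not_endpoint] AE_space
proof eventually_elim
  case (elim z)
  obtain x y u where z: "z = ((x, y), u)" by (cases z) auto
  have p: "(x, y) \<in> space \<mu>" using elim(4) z by (simp add: space_pair_measure)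
  have b: "0 \<le> x" "x \<le> y" "y \<le> 1" using space_S_I[OF p] by auto
  let ?l = "rank_below \<mu> Z (G x)" and ?r = "rank_upto \<mu> Z (G x)"
  have X: "?l \<le> X z" "X z \<le> ?r" using X_between[OF elim(1)] z by (auto simp: Z_def)
  have l: "?l \<le> x" using fst_between(1)[OF p] by (simp add: Z_def)
  have "X z \<le> y"
  proof (rule ccontr)
    assume "\<not> X z \<le> y"
    then have yr: "y < ?r" using X by simp
    then have "\<not> ?l < y" using good_not_between[of y x] elim(2) z by auto
    then have eq: "?l = x" "x = y" using l b by auto
    \<comment> \<open>A rational inside the level set names its left end, so only countably many
      values of \<open>x\<close> have to be excluded.\<close>
    obtain q where q: "q \<in> \<rat>" "y < q" "q < ?r"
      using Rats_dense_in_real[OF yr] by blast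
    have q1: "0 \<le> q" "q \<le> 1" using q b rank_bounds(4)[of Z "G x"] by linarith+
    have "G q \<le> G x" using rank_upto_Z_le[OF q1, of "G x"] q by linarith
    moreover have "G x \<le> G q" using q eq by (intro G_mono) simp
    ultimately have "G q = G x" by simp
    then show False using elim(3) q(1) eq z by auto
  qed
  then show ?case
    using X rank_bounds(1)[of Z "G x"] b z by (auto simp: S_I_def)
qed

text \<open>The guard matters on a null set only; it makes \<open>g\<close> map into
  \<open>S_I\<close> everywhere, as \<open>P_L_distr\<close> demands.\<close>

definition g :: "(real \<times> real) \<times> real \<Rightarrow> real \<times> real" where
  "g z = (if X z \<in> {0..snd (fst z)} \<and> snd (fst z) \<le> 1 then (X z, snd (fst z)) else (0, 0))"

lemma g_meas: "g \<in> borel_measurable T"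
  unfolding g_def atLeastAtMost_iff borel_prod[symmetric] by measurable

lemma AE_g: "AE z in T. g z = (X z, snd (fst z))"
  using AE_X_S_I by eventually_elim (simp add: g_def S_I_def)

lemma g_S_I: "g z \<in> S_I"
  by (auto simp: g_def S_I_def)

lemma g_uniform: "distr T borel (\<lambda>z. fst (g z)) = U01"
proof -
  have "distr T borel (\<lambda>z. fst (g z)) = distr T borel X"
    using AE_g measurable_compose[OF g_meas measurable_fst_snd_borel(1)]
    by (intro distr_cong_AE) (auto elim: eventually_mono)
  then show ?thesis using random_rank_uniform[OF Z_meas] by simp
qed

text \<open>Redistributes the left endpoints uniformly inside each gap of the right marginal.\<close>

definition shuffled :: "(real \<times> real) measure" where
  "shuffled = distr T (restrict_space borel S_I) g"

lemma shuffled_P_L: "shuffled \<in> P_L"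
  unfolding shuffled_def by (rule P_L_distr(1)[OF prob_space_T g_meas g_S_I g_uniform])

lemma emeasure_shuffled:
  assumes [measurable]: "A \<in> sets borel" "B \<in> sets borel"
  shows "emeasure shuffled {p \<in> space shuffled. fst p \<in> A \<and> snd p \<in> B} =
    emeasure T {z \<in> space T. X z \<in> A \<and> snd (fst z) \<in> B}"
proof -
  note [measurable] = g_meas
  have g': "g \<in> T \<rightarrow>\<^sub>M restrict_space borel S_I"
    using g_S_I by (intro measurable_restrict_space2 g_meas) auto
  have sets: "{p \<in> space shuffled. fst p \<in> A \<and> snd p \<in> B} \<in> sets (restrict_space borel S_I)"
  proof -
    have "{p \<in> space (borel :: (real \<times> real) measure). fst p \<in> A \<and> snd p \<in> B} \<in> sets borel"
      by measurable
    then show ?thesis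
      by (auto simp: shuffled_def space_restrict_space sets_restrict_space image_iff intro!: bexI[of _
        "{p. fst p \<in> A \<and> snd p \<in> B}"])
  qed
  have "emeasure shuffled {p \<in> space shuffled. fst p \<in> A \<and> snd p \<in> B}
    = emeasure T {z \<in> space T. fst (g z) \<in> A \<and> snd (g z) \<in> B}"
    unfolding shuffled_def using g_S_I
    by (subst emeasure_distr[OF g' sets[unfolded shuffled_def]])
      (auto intro!: arg_cong[where f="emeasure T"] simp: space_restrict_space)
  also have "\<dots> = emeasure T {z \<in> space T. X z \<in> A \<and> snd (fst z) \<in> B}"
  proof (rule emeasure_eq_AE)
    show "AE z in T. z \<in> {z \<in> space T. fst (g z) \<in> A \<and> snd (g z) \<in> B}
      \<longleftrightarrow> z \<in> {z \<in> space T. X z \<in> A \<and> snd (fst z) \<in> B}"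
      using AE_g by eventually_elim auto
    show "{z \<in> space T. fst (g z) \<in> A \<and> snd (g z) \<in> B} \<in> sets T"
      using measurable_compose[OF g_meas measurable_fst_snd_borel(1)] measurable_compose[OF g_meas
        measurable_fst_snd_borel(2)]
      by measurable
  qed measurable
  finally show ?thesis .
qed

end

lemma emeasure_lborel_affine:
  fixes A :: "real set"
  assumes c: "0 < c" and A: "A \<in> sets borel"
  shows "emeasure lborel A = ennreal c * emeasure lborel {u. t + u * c \<in> A}"
proof -
  have "emeasure lborel A = emeasure (density (distr lborel borel (\<lambda>x. t + c * x)) (\<lambda>_. ennreal \<bar>c\<bar>)) A"
    using lborel_real_affine[of c t] c by simp
  also have "\<dots> = ennreal c * emeasure (distr lborel borel (\<lambda>x. t + c * x)) A"
    using c A by (subst emeasure_density_const) auto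
  also have "emeasure (distr lborel borel (\<lambda>x. t + c * x)) A = emeasure lborel {u. t + u * c \<in> A}"
    using A by (subst emeasure_distr) (auto simp: vimage_def mult.commute)
  finally show ?thesis .
qed

context P_L_measure begin

text \<open>\<open>x\<close> and \<open>X z\<close> lie in the same closed level set, and almost no
  right endpoint is strictly inside it; so apart from ties, a right endpoint compares in the same
  way with both.\<close>

lemma kernel_density_shuffled: "kernel_density W_I shuffled Q = kernel_density W_I \<mu> Q"
proof -
  note T = prob_space_T
  have fm: "fst \<in> borel_measurable T"
    using measurable_compose[OF measurable_fst[of \<mu> U01] P_L_D(4)[OF P_L]] by simp
  have sfT: "sigma_finite_measure T" by (rule prob_space_imp_sigma_finite[OF T])
  have fstU: "distr T borel (\<lambda>z. fst (fst z)) = U01"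
  proof -
    interpret U: prob_space U01 by (rule prob_space_U01)
    have "distr T borel (\<lambda>z. fst (fst z)) = distr (distr T \<mu> fst) borel fst"
      by (subst distr_distr[OF meas(1) measurable_fst]) (simp add: comp_def)
    then show ?thesis by (simp add: U.distr_pair_fst P_L_D(7)[OF P_L])
  qed
  have "kernel_density W_I shuffled Q = kernel_density (\<lambda>p q. W_I (g p) (g q)) T Q"
    unfolding shuffled_def by (rule P_L_distr(2)[OF T g_meas g_S_I g_uniform])
  also have "\<dots> = kernel_density (\<lambda>p q. W_I (fst p) (fst q)) T Q"
  proof (rule kernel_density_cong_AE[OF T W_I_comp_measurable[OF g_meas] W_I_comp_measurable[OF fm]])
    have 1: "AE z in T \<Otimes>\<^sub>M T. snd (fst (fst z)) \<noteq> fst (fst (snd z))"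
      by (rule AE_P_L_neq[OF T fm fstU])
    have 2: "AE z in T \<Otimes>\<^sub>M T. snd (fst (fst z)) \<noteq> fst (g (snd z))"
      using measurable_compose[OF g_meas measurable_fst_snd_borel(1)]
      by (intro AE_pair_uniform_neq[OF T snd_fst_meas _ g_uniform])
    note 3 = AE_pair_fst[OF sfT AE_g]
    note 4 = AE_pair_snd[OF sfT AE_g, of T]
    note 5 = AE_pair_fst[OF sfT AE_T_fst[OF AE_good]]
    note 6 = AE_pair_snd[OF sfT AE_T_snd, of T]
    show "AE z in T \<Otimes>\<^sub>M T. W_I (g (fst z)) (g (snd z)) = W_I (fst (fst z)) (fst (snd z))"
      using 1 2 3 4 5 6 AE_space
    proof eventually_elim
      case (elim z)
      let ?y = "snd (fst (fst z))" and ?x = "fst (fst (snd z))" and ?x' = "X (snd z)"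
      have p: "fst (snd z) \<in> space \<mu>" using elim(7) by (auto simp: space_pair_measure)
      note b = fst_between[OF p] X_between[OF elim(6)]
      have ne: "?y \<noteq> ?x" "?y \<noteq> ?x'" using elim(1,2,4) by auto
      have nb: "\<not> (rank_below \<mu> Z (Z (fst (snd z))) < ?y \<and> ?y < rank_upto \<mu> Z (Z (fst (snd z))))"
        using good_not_between[OF elim(5), of ?x] by (auto simp: Z_def)
      have "?y < ?x' \<longleftrightarrow> ?y < ?x"
        using b ne nb by linarith
      then show ?case
        using elim(3,4) by (simp add: W_I_def prec_I_def)
    qed
  qed
  also have "\<dots> = kernel_density W_I (distr T \<mu> fst) Q"
    using W_I_comp_measurable[OF P_L_D(4)[OF P_L]]
      by (intro kernel_density_distr[OF T measurable_fst, symmetric]) simp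
  also have "distr T \<mu> fst = \<mu>"
    by (rule prob_space.distr_pair_fst[OF prob_space_U01])
  finally show ?thesis .
qed

text \<open>If \<open>X z\<close> is in the gap, the interval comes from the single level set around
  the gap, the event \<open>E\<close>. There \<open>X z = l + u * \<pi>\<close> with
  \<open>u\<close> independent of the interval, so the new left endpoint is uniform and independent
  of the right one; \<open>\<kappa>\<close> is the law of the right endpoint given
  \<open>E\<close>.\<close>

lemma shuffled_P_L_star: "shuffled \<in> P_L_star"
proof (rule P_L_starI[OF shuffled_P_L])
  fix a b :: real assume ab: "0 \<le> a" "a < b" "b \<le> 1"
    and gap0: "emeasure shuffled {p \<in> space shuffled. snd p \<in> {a<..<b}} = 0"
  have gap: "measure \<mu> {p \<in> space \<mu>. snd p \<in> {a<..<b}} = 0"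
  proof -
    have "emeasure T {z \<in> space T. snd (fst z) \<in> {a<..<b}} = 0"
      using emeasure_shuffled[of UNIV "{a<..<b}"] gap0 by simp
    moreover have "{z \<in> space T. snd (fst z) \<in> {a<..<b}} = {p \<in> space \<mu>. snd p \<in> {a<..<b}} \<times> UNIV"
      by (auto simp: space_pair_measure)
    moreover have "emeasure T ({p \<in> space \<mu>. snd p \<in> {a<..<b}} \<times> UNIV)
      = emeasure \<mu> {p \<in> space \<mu>. snd p \<in> {a<..<b}}"
      using prob_space.emeasure_space_1[OF prob_space_U01]
      by (subst sigma_finite_measure.emeasure_pair_measure_Times[OF U01_sigma_finite]) auto
    ultimately show ?thesis by (simp add: emeasure_eq_measure)
  qed
  have const: "G u = G v" if "a < u" "u \<le> v" "v \<le> b" for u v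
  proof -
    have "measure \<mu> {p \<in> space \<mu>. snd p \<in> {u..<v}} \<le> measure \<mu> {p \<in> space \<mu>. snd p \<in> {a<..<b}}"
      using that by (intro finite_measure_mono) auto
    then show ?thesis using gap G_eq_iff[OF that(2)] measure_nonneg[of \<mu>
      "{p \<in> space \<mu>. snd p \<in> {u..<v}}"] by linarith
  qed
  \<comment> \<open>Taken at \<open>b\<close> and not at \<open>a\<close>: an atom of the right
    marginal at \<open>a\<close> makes \<open>G\<close> jump right after \<open>a\<close>, while one
    at \<open>b\<close> is not yet counted by \<open>G b\<close>.\<close>
  define w where "w = G b"
  define l where "l = rank_below \<mu> Z w"
  define \<pi> where "\<pi> = rank_upto \<mu> Z w - l"
  have la: "l \<le> a"
    unfolding l_def
  proof (rule rank_below_Z_le)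
    fix u assume u: "a < u"
    show "w \<le> G u"
    proof (cases "u \<le> b")
      case True
      show ?thesis unfolding w_def const[OF u True order_refl] by (rule order_refl)
    next
      case False
      then show ?thesis unfolding w_def by (intro G_mono) simp
    qed
  qed (use ab in auto)
  have rb: "b \<le> rank_upto \<mu> Z w"
    unfolding w_def using ab by (intro le_rank_upto_Z) auto
  have \<pi>: "0 < \<pi>" using la rb ab by (simp add: \<pi>_def)
  define E where "E = {p \<in> space \<mu>. Z p = w}"
  have E [measurable]: "E \<in> sets \<mu>" unfolding E_def by measurable
  have mE: "measure \<mu> E = \<pi>"
  proof -
    have "measure \<mu> ({p \<in> space \<mu>. Z p \<le> w} - {p \<in> space \<mu>. Z p < w}) = \<pi>"
      unfolding \<pi>_def l_def rank_upto_def rank_below_def by (intro finite_measure_Diff) auto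
    moreover have "{p \<in> space \<mu>. Z p \<le> w} - {p \<in> space \<mu>. Z p < w} = E" by (auto simp: E_def)
    ultimately show ?thesis by simp
  qed
  have eE: "emeasure \<mu> E = ennreal \<pi>" using mE by (simp add: emeasure_eq_measure)
  define \<kappa> where "\<kappa> = distr (uniform_measure \<mu> E) borel snd"
  have "prob_space (uniform_measure \<mu> E)"
    using eE \<pi> by (intro prob_space_uniform_measure) auto
  then have \<kappa>: "prob_space \<kappa>" "sets \<kappa> = sets borel"
    unfolding \<kappa>_def by (auto intro!: prob_space.prob_space_distr)
  have Zw: "Z (fst z) = w" if X: "X z \<in> {a<..<b}" and u: "snd z \<in> {0..1}" for z
  proof (rule ccontr)
    assume "Z (fst z) \<noteq> w"
    then consider "Z (fst z) < w" | "w < Z (fst z)" by linarith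
    then show False
    proof cases
      case 1
      then have "X z \<le> a"
        using X_between(2)[OF u] rank_upto_le_below[OF Z_meas 1] la by (simp add: l_def)
      then show False using X by simp
    next
      case 2
      then have "b \<le> X z"
        using X_between(1)[OF u] rank_upto_le_below[OF Z_meas 2] rb by simp
      then show False using X by simp
    qed
  qed
  have XE: "X z = l + snd z * \<pi>" if "Z (fst z) = w" for z
    using that by (simp add: random_rank_def split_beta l_def \<pi>_def)
  show "\<exists>\<kappa>. prob_space \<kappa> \<and> sets \<kappa> = sets borel \<and> (\<forall>A B. A \<in> sets borel \<longrightarrow> A \<subseteq> {a<..<b} \<longrightarrow> B \<in> sets borel \<longrightarrow>
        emeasure shuffled {p \<in> space shuffled. fst p \<in> A \<and> snd p \<in> B} = emeasure lborel A * emeasure \<kappa> B)"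
  proof (intro exI[of _ \<kappa>] conjI allI impI \<kappa>)
    fix A B :: "real set" assume A [measurable]: "A \<in> sets borel" and Ab: "A \<subseteq> {a<..<b}"
      and B [measurable]: "B \<in> sets borel"
    let ?EB = "{p \<in> E. snd p \<in> B}" and ?UA = "{u. l + u * \<pi> \<in> A}"
    have EB: "?EB \<in> sets \<mu>"
    proof -
      have "?EB = E \<inter> {p \<in> space \<mu>. snd p \<in> B}" by (auto simp: E_def)
      also have "\<dots> \<in> sets \<mu>" by measurable
      finally show ?thesis .
    qed
    have UA: "?UA \<in> sets borel"
    proof -
      have "{u \<in> space borel. l + u * \<pi> \<in> A} \<in> sets borel" by measurable
      then show ?thesis by simp
    qed
    \<comment> \<open>\<open>U01\<close> is Lebesgue measure cut to \<open>[0, 1]\<close>; the cut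
      loses nothing here.\<close>
    have UA01: "?UA \<subseteq> {0..1}"
    proof
      fix u assume "u \<in> ?UA"
      then have u: "a < l + u * \<pi>" "l + u * \<pi> < b" using Ab by auto
      have "rank_upto \<mu> Z w = l + \<pi>" by (simp add: \<pi>_def)
      then have "0 < u * \<pi>" "u * \<pi> < 1 * \<pi>" using u la rb by linarith+
      then have "0 < u" "u < 1" using \<pi> by (simp_all add: zero_less_mult_iff)
      then show "u \<in> {0..1}" by simp
    qed
    have "emeasure shuffled {p \<in> space shuffled. fst p \<in> A \<and> snd p \<in> B}
      = emeasure T {z \<in> space T. X z \<in> A \<and> snd (fst z) \<in> B}"
      by (rule emeasure_shuffled[OF A B])
    also have "\<dots> = emeasure T (?EB \<times> ?UA)"
    proof (rule emeasure_eq_AE)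
      show "AE z in T. z \<in> {z \<in> space T. X z \<in> A \<and> snd (fst z) \<in> B} \<longleftrightarrow> z \<in> ?EB \<times> ?UA"
        using AE_T_snd AE_space
      proof eventually_elim
        case (elim z)
        have sp: "fst z \<in> space \<mu>" using elim(2) by (simp add: space_pair_measure mem_Times_iff)
        show ?case
        proof
          assume z: "z \<in> {z \<in> space T. X z \<in> A \<and> snd (fst z) \<in> B}"
          then have "Z (fst z) = w" using Zw[OF _ elim(1)] Ab by blast
          then show "z \<in> ?EB \<times> ?UA" using z sp XE[of z] by (simp add: mem_Times_iff E_def)
        next
          assume z: "z \<in> ?EB \<times> ?UA"
          then have "Z (fst z) = w" by (simp add: mem_Times_iff E_def)
          then show "z \<in> {z \<in> space T. X z \<in> A \<and> snd (fst z) \<in> B}"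
            using z elim(2) XE[of z] by (simp add: mem_Times_iff)
        qed
      qed
      show "?EB \<times> ?UA \<in> sets T" using EB UA by auto
    qed measurable
    also have "\<dots> = emeasure \<mu> ?EB * emeasure U01 ?UA"
      using EB UA by (subst sigma_finite_measure.emeasure_pair_measure_Times[OF U01_sigma_finite]) auto
    also have "emeasure U01 ?UA = emeasure lborel ?UA"
      using UA UA01 by (simp add: Int_absorb1 divide_ennreal_def)
    \<comment> \<open>The mass \<open>\<pi>\<close> of \<open>E\<close> equals the factor by which
      \<open>u\<close> is stretched, so the left coordinate gets plain Lebesgue measure.\<close>
    also have "emeasure \<mu> ?EB = ennreal \<pi> * emeasure \<kappa> B"
    proof -
      have "emeasure \<kappa> B = emeasure (uniform_measure \<mu> E) {p \<in> space \<mu>. snd p \<in> B}"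
      proof -
        have v: "snd -` B \<inter> space \<mu> = {p \<in> space \<mu>. snd p \<in> B}" by auto
        show ?thesis unfolding \<kappa>_def by (subst emeasure_distr) (simp_all add: v)
      qed
      also have "\<dots> = emeasure \<mu> (E \<inter> {p \<in> space \<mu>. snd p \<in> B}) / ennreal \<pi>"
        by (subst emeasure_uniform_measure) (auto simp: eE)
      also have "E \<inter> {p \<in> space \<mu>. snd p \<in> B} = ?EB" by (auto simp: E_def)
      finally have "ennreal \<pi> * emeasure \<kappa> B = ennreal \<pi> * emeasure \<mu> ?EB / ennreal \<pi>"
        by (simp add: ennreal_times_divide)
      also have "\<dots> = emeasure \<mu> ?EB"
        using \<pi> ennreal_mult_divide_eq[of "ennreal \<pi>" "emeasure \<mu> ?EB"] by (simp add: mult.commute)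
      finally show ?thesis ..
    qed
    also have "ennreal \<pi> * emeasure \<kappa> B * emeasure lborel ?UA = emeasure lborel A * emeasure \<kappa> B"
      unfolding emeasure_lborel_affine[OF \<pi> A, of l] by (simp only: mult_ac)
    finally show "emeasure shuffled {p \<in> space shuffled. fst p \<in> A \<and> snd p \<in> B}
      = emeasure lborel A * emeasure \<kappa> B" .
  qed
qed

end

lemma P_L_normalise:
  assumes "\<mu> \<in> P_L"
  obtains \<mu>' where "\<mu>' \<in> P_L_star" "\<And>Q. kernel_density W_I \<mu>' Q = kernel_density W_I \<mu> Q"
proof -
  interpret P_L_measure \<mu> by (rule P_L_measure.intro[OF assms])
  show ?thesis by (rule that[OF shuffled_P_L_star kernel_density_shuffled])
qed

section \<open>Reconstruction of the measure\<close>

text \<open>The element \<open>a\<close> lies above \<open>a\<close> minimal and below \<open>b\<close> maximal elements.\<close>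

definition hub_poset :: "nat \<Rightarrow> nat \<Rightarrow> fposet" where
  "hub_poset a b = strict_poset {..a + b} (\<lambda>i j. i < j \<and> i \<le> a \<and> a \<le> j)"

lemma hub_poset:
  "pcarrier (hub_poset a b) = {..a + b}"
  "plt (hub_poset a b) i j \<longleftrightarrow> i \<in> {..a + b} \<and> j \<in> {..a + b} \<and> i < j \<and> i \<le> a \<and> a \<le> j"
proof -
  note * = strict_poset[of "{..a + b}" "\<lambda>i j. i < j \<and> i \<le> a \<and> a \<le> j"]
  show "pcarrier (hub_poset a b) = {..a + b}"
    unfolding hub_poset_def by (rule *(1)) auto
  show "plt (hub_poset a b) i j \<longleftrightarrow> i \<in> {..a + b} \<and> j \<in> {..a + b} \<and> i < j \<and> i \<le> a \<and> a \<le> j"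
    unfolding hub_poset_def by (rule *(2)) auto
qed

context P_L_measure begin

lemma nn_integral_W_I_left:
  assumes "p \<in> space \<mu>"
  shows "(\<integral>\<^sup>+q. ennreal (W_I q p) \<partial>\<mu>) = ennreal (Z p)"
proof -
  have "(\<integral>\<^sup>+q. ennreal (W_I q p) \<partial>\<mu>) = (\<integral>\<^sup>+q. indicator {q \<in> space \<mu>. snd q < fst p} q \<partial>\<mu>)"
    by (intro nn_integral_cong) (auto simp: W_I_def prec_I_def indicator_def)
  also have "\<dots> = emeasure \<mu> {q \<in> space \<mu>. snd q < fst p}"
    by (intro nn_integral_indicator) measurable
  finally show ?thesis by (simp add: Z_def G_def rank_below_def emeasure_eq_measure)
qed

text \<open>The value is linear in \<open>snd p\<close> because the left marginal is
  uniform.\<close>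

lemma nn_integral_W_I_right:
  assumes p: "p \<in> space \<mu>"
  shows "(\<integral>\<^sup>+q. ennreal (W_I p q) \<partial>\<mu>) = ennreal (1 - snd p)"
proof -
  have b: "0 \<le> snd p" "snd p \<le> 1" using space_S_I[OF p] by auto
  have "(\<integral>\<^sup>+q. ennreal (W_I p q) \<partial>\<mu>) = (\<integral>\<^sup>+q. indicator {q \<in> space \<mu>. snd p < fst q} q \<partial>\<mu>)"
    by (intro nn_integral_cong) (auto simp: W_I_def prec_I_def indicator_def)
  also have "\<dots> = emeasure \<mu> {q \<in> space \<mu>. snd p < fst q}"
    by (intro nn_integral_indicator) measurable
  also have "\<dots> = ennreal (1 - measure \<mu> {q \<in> space \<mu>. fst q \<le> snd p})"
    using prob_neg[of "\<lambda>q. fst q \<le> snd p"] by (simp add: emeasure_eq_measure not_le)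
  finally show ?thesis using measure_fst_P_L(1)[OF P_L b] by simp
qed

lemma W_I_pair_meas: "case_prod W_I \<in> borel_measurable (\<mu> \<Otimes>\<^sub>M \<mu>)"
  using W_I_comp_measurable[OF P_L_D(4)[OF P_L]] by simp

text \<open>Given the interval \<open>p\<close> of the hub, the other elements are independent:
  \<open>a\<close> of them must lie to its left and \<open>b\<close> to its right. Relations between
  the two groups then hold by themselves since \<open>fst p \<le> snd p\<close>.\<close>

lemma kernel_density_hub:
  "kernel_density W_I \<mu> (hub_poset a b) = (\<integral>p. Z p ^ a * (1 - snd p) ^ b \<partial>\<mu>)"
proof -
  interpret product_sigma_finite "\<lambda>_ :: nat. \<mu>"
    by (intro product_sigma_finite.intro prob_space_imp_sigma_finite prob_space_axioms)
  let ?Q = "hub_poset a b"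
  let ?I = "{..<a} \<union> {a<..a + b}"
  have I: "{..a + b} = insert a ?I" by auto
  define F where "F x = (\<Prod>(i, j)\<in>{(i, j). plt ?Q i j}. W_I (x i) (x j))" for x
  have Fm: "F \<in> borel_measurable (PiM (insert a ?I) (\<lambda>_. \<mu>))"
    using measurable_kernel_prod[OF W_I_pair_meas, of ?Q] unfolding hub_poset(1) I F_def .
  have F0: "F y = 0" if "plt ?Q i j" "W_I (y i) (y j) = 0" for y i j
    unfolding F_def by (rule prod_zero[OF finite_plt], rule bexI[of _ "(i, j)"]) (use that in simp_all)
  have F01: "F x = 0 \<or> F x = 1" for x
  proof (cases "\<exists>i j. plt ?Q i j \<and> W_I (x i) (x j) = 0")
    case True
    then show ?thesis using F0 by blast
  next
    case False
    then have "W_I (x i) (x j) = 1" if "plt ?Q i j" for i j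
      using that by (metis W_I_def)
    then have "F x = 1" unfolding F_def by (intro prod.neutral) auto
    then show ?thesis ..
  qed
  define f where "f p i q = (if i < a then W_I q p else W_I p q)" for p q :: "real \<times> real" and i
  \<comment> \<open>Both products consist of zeros and ones, so it suffices to see that they are 1
    under the same condition.\<close>
  have Fx: "F (x(a := p)) = (\<Prod>i\<in>?I. f p i (x i))" if p: "p \<in> space \<mu>" for x p
  proof (cases "\<forall>i\<in>?I. f p i (x i) = 1")
    case True
    have "W_I ((x(a := p)) i) ((x(a := p)) j) = 1" if ij: "plt ?Q i j" for i j
    proof -
      have ij': "i \<le> a + b" "j \<le> a + b" "i < j" "i \<le> a" "a \<le> j" using ij by (auto simp: hub_poset(2))
      have L: "snd (x i) < fst p" if "i < a"
      proof -
        have "f p i (x i) = 1" using True that by blast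
        then show ?thesis using that by (simp add: f_def W_I_def prec_I_def split: if_splits)
      qed
      have R: "snd p < fst (x j)" if "a < j"
      proof -
        have "f p j (x j) = 1" using True that ij' by simp
        then show ?thesis using that by (simp add: f_def W_I_def prec_I_def split: if_splits)
      qed
      have pp: "fst p \<le> snd p" using space_S_I[OF p] by simp
      consider "i < a" "a < j" | "i = a" "a < j" | "i < a" "a = j" using ij' by linarith
      then show ?thesis
      proof cases
        case 1
        then have "snd (x i) < fst (x j)" using L R pp by linarith
        then show ?thesis using 1 by (simp add: W_I_def prec_I_def)
      qed (use L R in \<open>simp_all add: W_I_def prec_I_def\<close>)
    qed
    then have "F (x(a := p)) = 1" unfolding F_def by (intro prod.neutral) (simp add: case_prod_beta)
    then show ?thesis using True by simp
  next
    case False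
    then obtain i where i: "i \<in> ?I" "f p i (x i) \<noteq> 1" by blast
    then have f0: "f p i (x i) = 0" by (auto simp: f_def W_I_def split: if_splits)
    have "F (x(a := p)) = 0"
    proof (cases "i < a")
      case True
      then have "plt ?Q i a" by (simp add: hub_poset(2))
      moreover have "W_I ((x(a := p)) i) ((x(a := p)) a) = 0" using True f0 by (simp add: f_def)
      ultimately show ?thesis by (rule F0)
    next
      case ia: False
      then have "plt ?Q a i" using i(1) by (simp add: hub_poset(2))
      moreover have "W_I ((x(a := p)) a) ((x(a := p)) i) = 0" using ia i(1) f0 by (simp add: f_def)
      ultimately show ?thesis by (rule F0)
    qed
    moreover have "(\<Prod>i\<in>?I. f p i (x i)) = 0"
      using i(1) f0 by (intro prod_zero) auto
    ultimately show ?thesis by simp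
  qed
  have f0: "0 \<le> f p i q" for p i q by (simp add: f_def W_I_def)
  have inner: "(\<integral>\<^sup>+x. ennreal (F (x(a := p))) \<partial>PiM ?I (\<lambda>_. \<mu>)) = ennreal (Z p ^ a * (1 - snd p) ^ b)"
    if p: "p \<in> space \<mu>" for p
  proof -
    have fm: "(\<lambda>q. ennreal (f p i q)) \<in> borel_measurable \<mu>" for i
      unfolding f_def W_I_def prec_I_def by measurable
    have Zp: "0 \<le> Z p" by (simp add: Z_def G_def rank_bounds)
    have yp: "0 \<le> 1 - snd p" using space_S_I[OF p] by simp
    have "(\<integral>\<^sup>+x. ennreal (F (x(a := p))) \<partial>PiM ?I (\<lambda>_. \<mu>))
      = (\<integral>\<^sup>+x. (\<Prod>i\<in>?I. ennreal (f p i (x i))) \<partial>PiM ?I (\<lambda>_. \<mu>))"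
      unfolding Fx[OF p] by (simp only: prod_ennreal f0)
    also have "\<dots> = (\<Prod>i\<in>?I. \<integral>\<^sup>+q. ennreal (f p i q) \<partial>\<mu>)"
      using fm by (intro product_nn_integral_prod) auto
    also have "\<dots> = (\<Prod>i\<in>{..<a}. \<integral>\<^sup>+q. ennreal (f p i q) \<partial>\<mu>) * (\<Prod>i\<in>{a<..a + b}. \<integral>\<^sup>+q. ennreal (f p i q) \<partial>\<mu>)"
      by (intro prod.union_disjoint) auto
    also have "(\<Prod>i\<in>{..<a}. \<integral>\<^sup>+q. ennreal (f p i q) \<partial>\<mu>) = (\<Prod>i\<in>{..<a}. ennreal (Z p))"
      by (intro prod.cong) (auto simp: f_def nn_integral_W_I_left[OF p])
    also have "(\<Prod>i\<in>{a<..a + b}. \<integral>\<^sup>+q. ennreal (f p i q) \<partial>\<mu>) = (\<Prod>i\<in>{a<..a + b}. ennreal (1 - snd p))"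
      by (intro prod.cong) (auto simp: f_def nn_integral_W_I_right[OF p])
    also have "(\<Prod>i\<in>{..<a}. ennreal (Z p)) * (\<Prod>i\<in>{a<..a + b}. ennreal (1 - snd p))
      = ennreal (Z p ^ a * (1 - snd p) ^ b)"
      using Zp yp by (simp add: ennreal_power ennreal_mult)
    finally show ?thesis .
  qed
  have "kernel_density W_I \<mu> ?Q = (\<integral>x. F x \<partial>PiM (insert a ?I) (\<lambda>_. \<mu>))"
    unfolding kernel_density_def hub_poset(1) I F_def ..
  also have "\<dots> = enn2real (\<integral>\<^sup>+x. ennreal (F x) \<partial>PiM (insert a ?I) (\<lambda>_. \<mu>))"
    using F01 Fm by (intro integral_eq_nn_integral) (auto intro!: AE_I2, metis zero_le_one order_refl)
  also have "(\<integral>\<^sup>+x. ennreal (F x) \<partial>PiM (insert a ?I) (\<lambda>_. \<mu>))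
    = (\<integral>\<^sup>+p. \<integral>\<^sup>+x. ennreal (F (x(a := p))) \<partial>PiM ?I (\<lambda>_. \<mu>) \<partial>\<mu>)"
    using Fm by (intro product_nn_integral_insert_rev) auto
  also have "\<dots> = (\<integral>\<^sup>+p. ennreal (Z p ^ a * (1 - snd p) ^ b) \<partial>\<mu>)"
    by (intro nn_integral_cong inner)
  also have "enn2real \<dots> = (\<integral>p. Z p ^ a * (1 - snd p) ^ b \<partial>\<mu>)"
  proof (intro integral_eq_nn_integral[symmetric] AE_I2)
    fix p assume p: "p \<in> space \<mu>"
    show "0 \<le> Z p ^ a * (1 - snd p) ^ b"
      using space_S_I[OF p] by (intro mult_nonneg_nonneg zero_le_power) (auto simp: Z_def G_def rank_bounds)
  qed measurable
  finally show ?thesis .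
qed

end

text \<open>Weierstrass approximates \<open>\<phi>\<close> and \<open>\<psi>\<close> separately by
  polynomials on \<open>[0, 1]\<close>; the integral of a product of polynomials is a finite
  combination of mixed moments, and dominated convergence passes to the limit.\<close>

lemma moments_continuous:
  fixes \<phi> \<psi> :: "real \<Rightarrow> real" and M N :: "'a measure"
  assumes M: "prob_space M" and N: "prob_space N"
    and [measurable]: "f \<in> borel_measurable M" "h \<in> borel_measurable M" "f' \<in> borel_measurable N"
      "h' \<in> borel_measurable N"
    and bd: "\<And>p. p \<in> space M \<Longrightarrow> f p \<in> {0..1} \<and> h p \<in> {0..1}" "\<And>p. p \<in> space N
      \<Longrightarrow> f' p \<in> {0..1} \<and> h' p \<in> {0..1}"
    and mom: "\<And>a b. (\<integral>p. f p ^ a * h p ^ b \<partial>M) = (\<integral>p. f' p ^ a * h' p ^ b \<partial>N)"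
    and cont: "continuous_on UNIV \<phi>" "continuous_on UNIV \<psi>"
  shows "(\<integral>p. \<phi> (f p) * \<psi> (h p) \<partial>M) = (\<integral>p. \<phi> (f' p) * \<psi> (h' p) \<partial>N)"
proof -
  have poly: "\<exists>c n. \<forall>x\<in>{0..1}. \<bar>\<phi> x - (\<Sum>i\<le>n. c i * x ^ i)\<bar> < 1 / real (Suc k)" if cont:
    "continuous_on UNIV \<phi>"
    for \<phi> :: "real \<Rightarrow> real" and k :: nat
  proof -
    obtain g where g: "real_polynomial_function g" "\<And>x. x \<in> {0..1} \<Longrightarrow> \<bar>\<phi> x - g x\<bar> < 1 / real (Suc k)"
      using Stone_Weierstrass_real_polynomial_function[of "{0..1::real}" \<phi> "1 / real (Suc k)"]
        continuous_on_subset[OF cont] by auto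
    then obtain c n where "g = (\<lambda>x. \<Sum>i\<le>n. c i * x ^ i)"
      unfolding real_polynomial_function_iff_sum by blast
    then show ?thesis using g(2) by blast
  qed
  obtain c m where c: "\<And>k x. x \<in> {0..1} \<Longrightarrow> \<bar>\<phi> x - (\<Sum>i\<le>m k. c k i * x ^ i)\<bar> < 1 / real (Suc k)"
    using poly[OF cont(1)] by metis
  obtain d n where d: "\<And>k x. x \<in> {0..1} \<Longrightarrow> \<bar>\<psi> x - (\<Sum>i\<le>n k. d k i * x ^ i)\<bar> < 1 / real (Suc k)"
    using poly[OF cont(2)] by metis
  define P where "P k x = (\<Sum>i\<le>m k. c k i * x ^ i)" for k x
  define R where "R k x = (\<Sum>i\<le>n k. d k i * x ^ i)" for k x
  have lim: "(\<lambda>k. q k x) \<longlonglongrightarrow> \<eta> x" if "\<And>k. \<bar>\<eta> x - q k x\<bar> < 1 / real (Suc k)"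
    for q :: "nat \<Rightarrow> real \<Rightarrow> real" and \<eta> x
  proof (rule LIMSEQ_I)
    fix e :: real assume "0 < e"
    then obtain K where K: "inverse (real (Suc K)) < e" using reals_Archimedean by blast
    show "\<exists>K. \<forall>k\<ge>K. norm (q k x - \<eta> x) < e"
    proof (intro exI[of _ K] allI impI)
      fix k assume "K \<le> k"
      then have "1 / real (Suc k) \<le> inverse (real (Suc K))" by (simp add: inverse_eq_divide divide_simps)
      then show "norm (q k x - \<eta> x) < e" using that[of k] K by (simp add: abs_minus_commute)
    qed
  qed
  have bnd: "\<exists>B. \<forall>x\<in>{0..1}. \<bar>\<eta> x\<bar> \<le> B" if "continuous_on UNIV \<eta>" for \<eta> :: "real \<Rightarrow> real"
  proof -
    have "compact (\<eta> ` {0..1})"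
      by (intro compact_continuous_image continuous_on_subset[OF that]) auto
    then have "bounded (\<eta> ` {0..1})" by (rule compact_imp_bounded)
    then show ?thesis by (auto simp: bounded_iff)
  qed
  obtain B1 where B1: "\<And>x. x \<in> {0..1} \<Longrightarrow> \<bar>\<phi> x\<bar> \<le> B1" using bnd[OF cont(1)] by blast
  obtain B2 where B2: "\<And>x. x \<in> {0..1} \<Longrightarrow> \<bar>\<psi> x\<bar> \<le> B2" using bnd[OF cont(2)] by blast
  have small: "1 / real (Suc k) \<le> 1" for k by simp
  have PB: "\<bar>P k x\<bar> \<le> B1 + 1" if "x \<in> {0..1}" for k x
    using c[OF that, of k] B1[OF that] small[of k] unfolding P_def by linarith
  have RB: "\<bar>R k x\<bar> \<le> B2 + 1" if "x \<in> {0..1}" for k x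
    using d[OF that, of k] B2[OF that] small[of k] unfolding R_def by linarith
  have cm [measurable]: "\<phi> \<in> borel_measurable borel" "\<psi> \<in> borel_measurable borel"
    by (intro borel_measurable_continuous_onI cont)+
  have conv: "(\<lambda>k. \<integral>p. P k (f p) * R k (h p) \<partial>M) \<longlonglongrightarrow> (\<integral>p. \<phi> (f p) * \<psi> (h p) \<partial>M)"
    if M: "prob_space M" and [measurable]: "f \<in> borel_measurable M" "h \<in> borel_measurable M"
      and bd: "\<And>p. p \<in> space M \<Longrightarrow> f p \<in> {0..1} \<and> h p \<in> {0..1}" for M :: "'a measure" and f h
  proof (rule integral_dominated_convergence[where w="\<lambda>_. (B1 + 1) * (B2 + 1)"])
    interpret prob_space M by fact
    show "integrable M (\<lambda>_. (B1 + 1) * (B2 + 1))" by simp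
    show "AE p in M. (\<lambda>k. P k (f p) * R k (h p)) \<longlonglongrightarrow> \<phi> (f p) * \<psi> (h p)"
      using bd c d by (intro AE_I2 tendsto_mult lim) (auto simp: P_def R_def)
    show "AE p in M. norm (P k (f p) * R k (h p)) \<le> (B1 + 1) * (B2 + 1)" for k
    proof (rule AE_I2)
      fix p assume "p \<in> space M"
      then have P: "\<bar>P k (f p)\<bar> \<le> B1 + 1" and R: "\<bar>R k (h p)\<bar> \<le> B2 + 1"
        using PB RB bd by blast+
      have "0 \<le> B1 + 1" using order_trans[OF abs_ge_zero P] .
      then show "norm (P k (f p) * R k (h p)) \<le> (B1 + 1) * (B2 + 1)"
        unfolding real_norm_def abs_mult by (intro mult_mono P R abs_ge_zero)
    qed
    show "(\<lambda>p. P k (f p) * R k (h p)) \<in> borel_measurable M" for k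
      unfolding P_def R_def by measurable
  qed measurable
  have polyint: "(\<integral>p. P k (f p) * R k (h p) \<partial>M)
    = (\<Sum>i\<le>m k. \<Sum>j\<le>n k. c k i * d k j * (\<integral>p. f p ^ i * h p ^ j \<partial>M))"
    if M: "prob_space M" and [measurable]: "f \<in> borel_measurable M" "h \<in> borel_measurable M"
      and bd: "\<And>p. p \<in> space M \<Longrightarrow> f p \<in> {0..1} \<and> h p \<in> {0..1}" for M :: "'a measure" and f h k
  proof -
    interpret prob_space M by fact
    have int: "integrable M (\<lambda>p. f p ^ i * h p ^ j)" for i j
    proof (rule integrable_const_bound[where B=1])
      show "AE p in M. norm (f p ^ i * h p ^ j) \<le> 1"
      proof (rule AE_I2)
        fix p assume "p \<in> space M"
        then have "0 \<le> f p" "f p \<le> 1" "0 \<le> h p" "h p \<le> 1" using bd by auto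
        then show "norm (f p ^ i * h p ^ j) \<le> 1"
          by (simp add: abs_mult power_abs mult_le_one power_le_one)
      qed
    qed measurable
    have "(\<integral>p. P k (f p) * R k (h p) \<partial>M) = (\<integral>p. (\<Sum>i\<le>m k. \<Sum>j\<le>n k. c k i * d k j * (f p ^ i * h p ^ j)) \<partial>M)"
      unfolding P_def R_def by (simp add: sum_product mult_ac)
    also have "\<dots> = (\<Sum>i\<le>m k. \<Sum>j\<le>n k. c k i * d k j * (\<integral>p. f p ^ i * h p ^ j \<partial>M))"
      using int by (simp add: Bochner_Integration.integral_sum)
    finally show ?thesis .
  qed
  have "(\<integral>p. P k (f p) * R k (h p) \<partial>M) = (\<integral>p. P k (f' p) * R k (h' p) \<partial>N)" for k
    using polyint[OF M, of f h k] polyint[OF N, of f' h' k] bd mom by simp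
  moreover have "(\<lambda>k. \<integral>p. P k (f p) * R k (h p) \<partial>M) \<longlonglongrightarrow> (\<integral>p. \<phi> (f p) * \<psi> (h p) \<partial>M)"
    by (rule conv[OF M]) (use bd in auto)
  moreover have "(\<lambda>k. \<integral>p. P k (f' p) * R k (h' p) \<partial>N) \<longlonglongrightarrow> (\<integral>p. \<phi> (f' p) * \<psi> (h' p) \<partial>N)"
    by (rule conv[OF N]) (use bd in auto)
  ultimately show ?thesis using LIMSEQ_unique by simp
qed

text \<open>A second limit, from continuous functions to indicators. The approximation converges at
  every point, boundary points of \<open>A\<close> and \<open>B\<close> included, so atoms of the
  laws do no harm.\<close>

lemma moments_indicator:
  fixes \<phi> \<psi> :: "nat \<Rightarrow> real \<Rightarrow> real" and M N :: "'a measure"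
  assumes M: "prob_space M" and N: "prob_space N"
    and [measurable]: "f \<in> borel_measurable M" "h \<in> borel_measurable M" "f' \<in> borel_measurable N"
      "h' \<in> borel_measurable N"
    and bd: "\<And>p. p \<in> space M \<Longrightarrow> f p \<in> {0..1} \<and> h p \<in> {0..1}" "\<And>p. p \<in> space N
      \<Longrightarrow> f' p \<in> {0..1} \<and> h' p \<in> {0..1}"
    and mom: "\<And>a b. (\<integral>p. f p ^ a * h p ^ b \<partial>M) = (\<integral>p. f' p ^ a * h' p ^ b \<partial>N)"
    and cont: "\<And>k. continuous_on UNIV (\<phi> k)" "\<And>k. continuous_on UNIV (\<psi> k)"
    and le1: "\<And>k x. \<bar>\<phi> k x\<bar> \<le> 1" "\<And>k x. \<bar>\<psi> k x\<bar> \<le> 1"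
    and lim: "\<And>x. (\<lambda>k. \<phi> k x) \<longlonglongrightarrow> indicator A x" "\<And>x. (\<lambda>k. \<psi> k x) \<longlonglongrightarrow> indicator B x"
    and [measurable]: "A \<in> sets borel" "B \<in> sets borel"
  shows "measure M {p \<in> space M. f p \<in> A \<and> h p \<in> B} = measure N {p \<in> space N. f' p \<in> A \<and> h' p \<in> B}"
proof -
  have [measurable]: "\<phi> k \<in> borel_measurable borel" "\<psi> k \<in> borel_measurable borel" for k
    by (intro borel_measurable_continuous_onI cont)+
  have conv: "(\<lambda>k. \<integral>p. \<phi> k (f p) * \<psi> k (h p) \<partial>M) \<longlonglongrightarrow> measure M {p \<in> space M. f p \<in> A \<and> h p \<in> B}"
    if M: "prob_space M" and [measurable]: "f \<in> borel_measurable M" "h \<in> borel_measurable M" for M ::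
      "'a measure" and f h
  proof -
    interpret prob_space M by fact
    have "(\<lambda>k. \<integral>p. \<phi> k (f p) * \<psi> k (h p) \<partial>M) \<longlonglongrightarrow> (\<integral>p. indicator A (f p) * indicator B (h p) \<partial>M)"
    proof (rule integral_dominated_convergence[where w="\<lambda>_. 1"])
      show "AE p in M. (\<lambda>k. \<phi> k (f p) * \<psi> k (h p)) \<longlonglongrightarrow> indicator A (f p) * indicator B (h p)"
        by (intro AE_I2 tendsto_mult lim)
      show "AE p in M. norm (\<phi> k (f p) * \<psi> k (h p)) \<le> 1" for k
        using le1 by (intro AE_I2) (simp add: abs_mult mult_le_one)
    qed auto
    also have "(\<integral>p. indicator A (f p) * indicator B (h p) \<partial>M)
      = (\<integral>p. indicator {p \<in> space M. f p \<in> A \<and> h p \<in> B} p \<partial>M :: real)"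
      by (intro Bochner_Integration.integral_cong) (auto simp: indicator_def)
    also have "\<dots> = measure M {p \<in> space M. f p \<in> A \<and> h p \<in> B}"
      by (subst Bochner_Integration.integral_indicator) (simp_all add: Int_absorb2 Collect_conj_eq)
    finally show ?thesis .
  qed
  have "(\<integral>p. \<phi> k (f p) * \<psi> k (h p) \<partial>M) = (\<integral>p. \<phi> k (f' p) * \<psi> k (h' p) \<partial>N)" for k
    by (rule moments_continuous[OF M N _ _ _ _ bd mom cont]) measurable
  moreover have "(\<lambda>k. \<integral>p. \<phi> k (f p) * \<psi> k (h p) \<partial>M) \<longlonglongrightarrow> measure M {p \<in> space M. f p \<in> A \<and> h p \<in> B}"
    by (rule conv[OF M]) measurable
  moreover have "(\<lambda>k. \<integral>p. \<phi> k (f' p) * \<psi> k (h' p) \<partial>N) \<longlonglongrightarrow> measure N {p \<in> space N. f' p \<in> A \<and> h' p \<in> B}"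
    by (rule conv[OF N]) measurable
  ultimately show ?thesis using LIMSEQ_unique by simp
qed

section \<open>Continuous approximation of half-lines\<close>

lemma cts_step_continuous: "a < b \<Longrightarrow> continuous_on UNIV (cts_step a b)"
  using uniformly_continuous_imp_continuous[OF cts_step_uniformly_continuous] .

lemma cts_step_abs_le: "a < b \<Longrightarrow> \<bar>cts_step a b x\<bar> \<le> 1"
  by (auto simp: cts_step_def divide_simps)

lemma eventually_inverse_Suc_less:
  assumes "0 < e"
  shows "\<forall>\<^sub>F k in sequentially. inverse (real (Suc k)) < e"
  using order_tendstoD(2)[OF LIMSEQ_inverse_real_of_nat assms] .

text \<open>The ramp descends to the right of \<open>w\<close> here and to its left in the next
  lemma; this decides whether \<open>w\<close> itself belongs to the limit set.\<close>

lemma cts_step_tendsto_atMost: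
  "(\<lambda>k. cts_step w (w + inverse (real (Suc k))) x) \<longlonglongrightarrow> indicator {..w} x"
proof (cases "x \<le> w")
  case True
  then show ?thesis by (simp add: cts_step_def)
next
  case False
  then have "\<forall>\<^sub>F k in sequentially. inverse (real (Suc k)) < x - w"
    by (intro eventually_inverse_Suc_less) simp
  then show ?thesis
    using False by (intro tendsto_eventually) (auto simp: cts_step_def elim!: eventually_mono)
qed

lemma cts_step_tendsto_lessThan:
  "(\<lambda>k. cts_step (w - inverse (real (Suc k))) w x) \<longlonglongrightarrow> indicator {..<w} x"
proof (cases "x < w")
  case True
  then have "\<forall>\<^sub>F k in sequentially. inverse (real (Suc k)) < w - x"
    by (intro eventually_inverse_Suc_less) simp
  then show ?thesis
    using True by (intro tendsto_eventually) (auto simp: cts_step_def elim!: eventually_mono)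
next
  case False
  have "cts_step (w - inverse (real (Suc k))) w x = 0" for k
  proof -
    have "\<not> x \<le> w - inverse (real (Suc k))"
      using False inverse_positive_iff_positive[of "real (Suc k)"] by linarith
    then show ?thesis using False by (simp add: cts_step_def)
  qed
  then show ?thesis using False by simp
qed

text \<open>The hub densities are the mixed moments of \<open>Z\<close> and \<open>1 - snd\<close>,
  so the joint law of the two is determined. Strict and weak bounds on \<open>Z\<close> together
  isolate its atoms, which are the gaps.\<close>

lemma Z_snd_determined:
  assumes \<mu>: "\<mu> \<in> P_L" and \<mu>': "\<mu>' \<in> P_L"
    and eq: "\<And>Q. kernel_density W_I \<mu> Q = kernel_density W_I \<mu>' Q"
  shows "measure \<mu> {p \<in> space \<mu>. P_L_measure.Z \<mu> p < w \<and> snd p \<le> d}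
    = measure \<mu>' {p \<in> space \<mu>'. P_L_measure.Z \<mu>' p < w \<and> snd p \<le> d}" (is ?A)
    and "measure \<mu> {p \<in> space \<mu>. P_L_measure.Z \<mu> p \<le> w \<and> snd p \<le> d}
      = measure \<mu>' {p \<in> space \<mu>'. P_L_measure.Z \<mu>' p \<le> w \<and> snd p \<le> d}" (is ?B)
    and "P_L_measure.G \<mu> = P_L_measure.G \<mu>'" (is ?C)
proof -
  interpret M: P_L_measure \<mu> by (rule P_L_measure.intro[OF \<mu>])
  interpret N: P_L_measure \<mu>' by (rule P_L_measure.intro[OF \<mu>'])
  have bd: "M.Z p \<in> {0..1} \<and> 1 - snd p \<in> {0..1}" if "p \<in> space \<mu>" for p
    using M.space_S_I[OF that] by (auto simp: M.Z_def M.G_def M.rank_bounds)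
  have bd': "N.Z p \<in> {0..1} \<and> 1 - snd p \<in> {0..1}" if "p \<in> space \<mu>'" for p
    using N.space_S_I[OF that] by (auto simp: N.Z_def N.G_def N.rank_bounds)
  have mom: "(\<integral>p. M.Z p ^ a * (1 - snd p) ^ b \<partial>\<mu>) = (\<integral>p. N.Z p ^ a * (1 - snd p) ^ b \<partial>\<mu>')" for a b
    using eq[of "hub_poset a b"] by (simp add: M.kernel_density_hub N.kernel_density_hub)
  have meas: "(\<lambda>p. 1 - snd p) \<in> borel_measurable \<mu>" "(\<lambda>p. 1 - snd p) \<in> borel_measurable \<mu>'"
    by measurable
  have key: "measure \<mu> {p \<in> space \<mu>. M.Z p \<in> A \<and> 1 - snd p \<in> B}
    = measure \<mu>' {p \<in> space \<mu>'. N.Z p \<in> A \<and> 1 - snd p \<in> B}"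
    if "\<And>k. continuous_on UNIV (\<phi> k)" "\<And>k. continuous_on UNIV (\<psi> k)"
      "\<And>k x. \<bar>\<phi> k x\<bar> \<le> 1" "\<And>k x. \<bar>\<psi> k x\<bar> \<le> 1"
      "\<And>x. (\<lambda>k. \<phi> k x) \<longlonglongrightarrow> indicator A x" "\<And>x. (\<lambda>k. \<psi> k x) \<longlonglongrightarrow> indicator B x"
      "A \<in> sets borel" "B \<in> sets borel" for \<phi> \<psi> :: "nat \<Rightarrow> real \<Rightarrow> real" and A B
    by (rule moments_indicator[OF M.prob_space_axioms N.prob_space_axioms M.Z_meas meas(1) N.Z_meas
      meas(2) bd bd' mom that])
  \<comment> \<open>The moments are those of \<open>1 - snd\<close>, so the steps are
    reflected.\<close>
  have c1: "continuous_on UNIV (\<lambda>x. cts_step (w - inverse (real (Suc k))) w (1 - x))" for w k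
    by (rule continuous_on_compose2[OF cts_step_continuous]) (auto intro!: continuous_intros)
  have c2: "continuous_on UNIV (\<lambda>x. cts_step w (w + inverse (real (Suc k))) (1 - x))" for w k
    by (rule continuous_on_compose2[OF cts_step_continuous]) (auto intro!: continuous_intros)
  have i1: "(\<lambda>k. cts_step (u - inverse (real (Suc k))) u (1 - x)) \<longlonglongrightarrow> indicator {1 - u<..} x" for u x
    using cts_step_tendsto_lessThan[of u "1 - x"] by (simp add: indicator_def algebra_simps)
  have i2: "(\<lambda>k. cts_step u (u + inverse (real (Suc k))) (1 - x)) \<longlonglongrightarrow> indicator {1 - u..} x" for u x
    using cts_step_tendsto_atMost[of u "1 - x"] by (simp add: indicator_def algebra_simps)
  have "measure \<mu> {p \<in> space \<mu>. M.Z p \<in> {..<w} \<and> 1 - snd p \<in> {1 - d..}}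
    = measure \<mu>' {p \<in> space \<mu>'. N.Z p \<in> {..<w} \<and> 1 - snd p \<in> {1 - d..}}"
    by (rule key[OF _ c2 _ _ cts_step_tendsto_lessThan i2]) (auto intro!: cts_step_continuous
      cts_step_abs_le)
  then show ?A by simp
  have "measure \<mu> {p \<in> space \<mu>. M.Z p \<in> {..w} \<and> 1 - snd p \<in> {1 - d..}}
    = measure \<mu>' {p \<in> space \<mu>'. N.Z p \<in> {..w} \<and> 1 - snd p \<in> {1 - d..}}"
    by (rule key[OF _ c2 _ _ cts_step_tendsto_atMost i2]) (auto intro!: cts_step_continuous cts_step_abs_le)
  then show ?B by simp
  \<comment> \<open>With the constant 1 as the first approximating function, only the law of the
    right endpoint remains.\<close>
  show ?C
  proof
    fix u
    have "measure \<mu> {p \<in> space \<mu>. M.Z p \<in> UNIV \<and> 1 - snd p \<in> {1 - u<..}}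
      = measure \<mu>' {p \<in> space \<mu>'. N.Z p \<in> UNIV \<and> 1 - snd p \<in> {1 - u<..}}"
      by (rule key[OF _ c1 _ _ _ i1, of "\<lambda>_ _. 1"]) (auto intro!: cts_step_abs_le)
    then show "M.G u = N.G u" by (simp add: M.G_def N.G_def rank_below_def)
  qed
qed

context P_L_measure begin

text \<open>
  This expresses the law of \<open>\<mu>\<close> through that of \<open>(Z, snd)\<close>, since inside a gap the left endpoint is uniform.
  If \<open>l = r\<close> the quotient is \<open>0\<close>, which is the correct value.
\<close>

lemma P_L_star_reconstruct:
  assumes star: "\<mu> \<in> P_L_star" and c: "0 \<le> c" "c \<le> 1"
  defines "l \<equiv> rank_below \<mu> Z (G c)" and "r \<equiv> rank_upto \<mu> Z (G c)"
  shows "measure \<mu> {p \<in> space \<mu>. fst p \<le> c \<and> snd p \<le> d} =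
    measure \<mu> {p \<in> space \<mu>. Z p < G c \<and> snd p \<le> d} + (c - l) / (r - l) *
      (measure \<mu> {p \<in> space \<mu>. Z p \<le> G c \<and> snd p \<le> d} - measure \<mu> {p \<in> space \<mu>. Z p < G c \<and> snd p \<le> d})"
proof -
  have lc: "l \<le> c" unfolding l_def by (intro rank_below_Z_le c G_mono) simp
  have cr: "c \<le> r" unfolding r_def by (intro le_rank_upto_Z c) simp
  have l0: "0 \<le> l" and r1: "r \<le> 1" unfolding l_def r_def by (rule rank_bounds)+
  let ?E = "{p \<in> space \<mu>. Z p = G c \<and> snd p \<le> d}"
  have E: "measure \<mu> {p \<in> space \<mu>. Z p \<le> G c \<and> snd p \<le> d} - measure \<mu> {p \<in> space \<mu>. Z p < G c \<and> snd p
    \<le> d} = measure \<mu> ?E"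
  proof -
    have "measure \<mu> ({p \<in> space \<mu>. Z p < G c \<and> snd p \<le> d} \<union> ?E)
      = measure \<mu> {p \<in> space \<mu>. Z p < G c \<and> snd p \<le> d} + measure \<mu> ?E"
      by (intro finite_measure_Union) auto
    moreover have "{p \<in> space \<mu>. Z p < G c \<and> snd p \<le> d} \<union> ?E = {p \<in> space \<mu>. Z p \<le> G c \<and> snd p \<le> d}" by auto
    ultimately show ?thesis by simp
  qed
  have Zc: "fst p \<le> c" if "Z p < G c" for p
    using that G_mono[of c "fst p"] unfolding Z_def by linarith
  have Zc': "Z p \<le> G c" if "fst p \<le> c" for p
    using that G_mono[of "fst p" c] unfolding Z_def by linarith
  have split: "measure \<mu> {p \<in> space \<mu>. fst p \<le> c \<and> snd p \<le> d}
    = measure \<mu> {p \<in> space \<mu>. Z p < G c \<and> snd p \<le> d}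
      + measure \<mu> {p \<in> space \<mu>. fst p \<le> c \<and> Z p = G c \<and> snd p \<le> d}"
  proof -
    have "measure \<mu> ({p \<in> space \<mu>. Z p < G c \<and> snd p \<le> d} \<union> {p \<in> space \<mu>. fst p \<le> c \<and> Z p
      = G c \<and> snd p \<le> d})
      = measure \<mu> {p \<in> space \<mu>. Z p < G c \<and> snd p \<le> d} + measure \<mu> {p \<in> space \<mu>. fst p \<le> c \<and> Z p
        = G c \<and> snd p \<le> d}"
      by (intro finite_measure_Union) auto
    moreover have "{p \<in> space \<mu>. Z p < G c \<and> snd p \<le> d} \<union> {p \<in> space \<mu>. fst p \<le> c \<and> Z p
      = G c \<and> snd p \<le> d} = {p \<in> space \<mu>. fst p \<le> c \<and> snd p \<le> d}"
      using Zc Zc' by (auto simp: less_le)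
    ultimately show ?thesis by simp
  qed
  have "measure \<mu> {p \<in> space \<mu>. fst p \<le> c \<and> Z p = G c \<and> snd p \<le> d} = (c - l) / (r - l) * measure \<mu> ?E"
  proof (cases "l = r")
    case True
    have "measure \<mu> {p \<in> space \<mu>. Z p = G c} = r - l"
    proof -
      have "measure \<mu> ({p \<in> space \<mu>. Z p \<le> G c} - {p \<in> space \<mu>. Z p < G c}) = r - l"
        unfolding r_def l_def rank_upto_def rank_below_def by (intro finite_measure_Diff) auto
      moreover have "{p \<in> space \<mu>. Z p \<le> G c} - {p \<in> space \<mu>. Z p < G c} = {p \<in> space \<mu>. Z p = G c}" by auto
      ultimately show ?thesis by simp
    qed
    moreover have "measure \<mu> {p \<in> space \<mu>. fst p \<le> c \<and> Z p
      = G c \<and> snd p \<le> d} \<le> measure \<mu> {p \<in> space \<mu>. Z p = G c}"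
      by (intro finite_measure_mono) auto
    ultimately show ?thesis
      using True measure_nonneg[of \<mu> "{p \<in> space \<mu>. fst p \<le> c \<and> Z p = G c \<and> snd p \<le> d}"] by simp
  next
    case False
    then have lr: "l < r" using lc cr by linarith
    \<comment> \<open>The interior of a level set of \<open>G\<close> is a gap, so the product form
      holds on all of it.\<close>
    have "AE p in \<mu>. \<not> (l < snd p \<and> snd p < r)"
      using AE_good by eventually_elim (use good_not_between[of _ c] in \<open>auto simp: l_def r_def\<close>)
    then have gap: "emeasure \<mu> {p \<in> space \<mu>. snd p \<in> {l<..<r}} = 0"
      by (subst AE_iff_measurable[symmetric, where P="\<lambda>p. \<not> (l < snd p \<and> snd p < r)"]) auto
    obtain \<kappa> where \<kappa>:
      "\<And>A B. A \<in> sets borel \<Longrightarrow> A \<subseteq> {l<..<r} \<Longrightarrow> B \<in> sets borel \<Longrightarrow> B \<subseteq> {0..1} \<Longrightarrow>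
        emeasure \<mu> {p \<in> space \<mu>. fst p \<in> A \<and> snd p \<in> B} = emeasure lborel A * \<kappa> B"
      by (rule P_L_star_gapD[OF star l0 lr r1 gap]) (rule that)
    let ?B = "{0..1} \<inter> {..d}"
    have Zlr: "Z p = G c" if "l < fst p" "fst p < r" "p \<in> space \<mu>" for p
    proof -
      have b: "0 \<le> fst p" "fst p \<le> 1" using space_S_I[OF that(3)] by auto
      have "G c \<le> G (fst p)" using le_rank_below_Z[OF b, of "G c"] that(1) unfolding l_def by linarith
      moreover have "G (fst p) \<le> G c" using rank_upto_Z_le[OF b, of "G c"] that(2) unfolding r_def
        by linarith
      ultimately show ?thesis by (simp add: Z_def)
    qed
    \<comment> \<open>The ends of the level set are null for the left endpoint, so membership can be
      tested on the open interval.\<close>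
    have lZr: "AE p in \<mu>. Z p = G c \<longrightarrow> l < fst p \<and> fst p < r"
      using AE_fst_neq[of l] AE_fst_neq[of r] AE_space
    proof eventually_elim
      case (elim p)
      then show ?case using fst_between[OF elim(3)] by (auto simp: l_def r_def less_le)
    qed
    have yB: "snd p \<le> d \<longleftrightarrow> snd p \<in> ?B" if "p \<in> space \<mu>" for p
      using space_S_I[OF that] by auto
    \<comment> \<open>The product form makes mass proportional to length in the left coordinate; the
      part up to \<open>c\<close> has the share \<open>(c - l) / (r - l)\<close>.\<close>
    have 1: "emeasure \<mu> {p \<in> space \<mu>. fst p \<le> c \<and> Z p = G c \<and> snd p \<le> d} = ennreal (c - l) * \<kappa> ?B"
    proof -
      have "emeasure \<mu> {p \<in> space \<mu>. fst p \<le> c \<and> Z p = G c \<and> snd p \<le> d}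
        = emeasure \<mu> {p \<in> space \<mu>. fst p \<in> {l<..<c} \<and> snd p \<in> ?B}"
      proof (rule emeasure_eq_AE)
        show "AE p in \<mu>. p \<in> {p \<in> space \<mu>. fst p \<le> c \<and> Z p = G c \<and> snd p \<le> d}
          \<longleftrightarrow> p \<in> {p \<in> space \<mu>. fst p \<in> {l<..<c} \<and> snd p \<in> ?B}"
          using lZr AE_fst_neq[of c] AE_space
        proof eventually_elim
          case (elim p)
          then show ?case using Zlr[of p] yB[of p] cr by auto
        qed
      qed measurable
      also have "\<dots> = emeasure lborel {l<..<c} * \<kappa> ?B"
        using cr by (intro \<kappa>) auto
      finally show ?thesis using lc by simp
    qed
    have 2: "emeasure \<mu> ?E = ennreal (r - l) * \<kappa> ?B"
    proof -
      have "emeasure \<mu> ?E = emeasure \<mu> {p \<in> space \<mu>. fst p \<in> {l<..<r} \<and> snd p \<in> ?B}"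
      proof (rule emeasure_eq_AE)
        show "AE p in \<mu>. p \<in> ?E \<longleftrightarrow> p \<in> {p \<in> space \<mu>. fst p \<in> {l<..<r} \<and> snd p \<in> ?B}"
          using lZr AE_space
        proof eventually_elim
          case (elim p)
          then show ?case using Zlr[of p] yB[of p] by auto
        qed
      qed measurable
      also have "\<dots> = emeasure lborel {l<..<r} * \<kappa> ?B"
        by (intro \<kappa>) auto
      finally show ?thesis using lr by simp
    qed
    have "measure \<mu> {p \<in> space \<mu>. fst p \<le> c \<and> Z p = G c \<and> snd p \<le> d} = (c - l) * enn2real (\<kappa> ?B)"
      using 1 lc by (simp add: measure_def enn2real_mult)
    moreover have "measure \<mu> ?E = (r - l) * enn2real (\<kappa> ?B)"
      using 2 lr by (simp add: measure_def enn2real_mult)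
    ultimately show ?thesis using lr by simp
  qed
  then show ?thesis unfolding split E by simp
qed

end

text \<open>Quadrants are closed under intersection and generate the Borel sets of the plane. Bounds
  \<open>c\<close> outside \<open>[0, 1]\<close> add nothing, since left endpoints are in
  \<open>[0, 1]\<close>.\<close>

lemma P_L_eqI:
  assumes \<mu>: "\<mu> \<in> P_L" and \<mu>': "\<mu>' \<in> P_L"
    and eq: "\<And>c d. 0 \<le> c \<Longrightarrow> c \<le> 1 \<Longrightarrow>
      measure \<mu> {p \<in> space \<mu>. fst p \<le> c \<and> snd p \<le> d} = measure \<mu>' {p \<in> space \<mu>'. fst p \<le> c \<and> snd p \<le> d}"
  shows "\<mu> = \<mu>'"
proof -
  interpret M: P_L_measure \<mu> by (rule P_L_measure.intro[OF \<mu>])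
  interpret N: P_L_measure \<mu>' by (rule P_L_measure.intro[OF \<mu>'])
  have sp: "space \<mu> = S_I" "space \<mu>' = S_I" using P_L_D(3) \<mu> \<mu>' by auto
  have eq': "measure \<mu> {p \<in> S_I. fst p \<le> c \<and> snd p \<le> d} = measure \<mu>' {p \<in> S_I. fst p \<le> c \<and> snd p \<le> d}"
    for c d
  proof -
    consider "c < 0" | "0 \<le> c" "c \<le> 1" | "1 < c" by linarith
    then show ?thesis
    proof cases
      case 1
      then have e: "{p \<in> S_I. fst p \<le> c \<and> snd p \<le> d} = {}" by (auto simp: S_I_def)
      show ?thesis unfolding e by simp
    next
      case 2
      then show ?thesis using eq[of c d] by (simp add: sp)
    next
      case 3
      then have "{p \<in> S_I. fst p \<le> c \<and> snd p \<le> d} = {p \<in> S_I. fst p \<le> 1 \<and> snd p \<le> d}"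
        by (auto simp: S_I_def)
      then show ?thesis using eq[of 1 d] by (simp add: sp)
    qed
  qed
  let ?m = "distr \<mu> borel (\<lambda>p. p)" and ?m' = "distr \<mu>' borel (\<lambda>p. p)"
  have "?m = ?m'"
  proof (rule measure_eqI_generator_eq[where \<Omega>=UNIV and E="range (\<lambda>a :: real \<times> real. {..a})"
    and A="\<lambda>i. {..(real i, real i)}"])
    show "Int_stable (range (\<lambda>a :: real \<times> real. {..a}))"
    proof (rule Int_stableI, clarify)
      fix a b a' b' :: real
      have "{..(a, b)} \<inter> {..(a', b')} = {..(min a a', min b b')}" by auto
      then show "{..(a, b)} \<inter> {..(a', b')} \<in> range (\<lambda>a :: real \<times> real. {..a})" by simp
    qed
    show "sets ?m = sigma_sets UNIV (range (\<lambda>a. {..a}))" "sets ?m' = sigma_sets UNIV (range (\<lambda>a. {..a}))"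
      by (simp_all add: borel_eq_atMost)
    fix X assume "X \<in> range (\<lambda>a :: real \<times> real. {..a})"
    then obtain a b where X: "X = {..(a, b)}" by auto
    have Xs: "{p. fst p \<le> a \<and> snd p \<le> b} = X" unfolding X by auto
    have Xb: "X \<in> sets borel" unfolding X by simp
    have v: "(\<lambda>p. p) -` X \<inter> S_I = {p \<in> S_I. fst p \<le> a \<and> snd p \<le> b}" unfolding Xs[symmetric] by auto
    show "emeasure ?m X = emeasure ?m' X"
      unfolding emeasure_distr[OF P_L_D(4)[OF \<mu>] Xb] emeasure_distr[OF P_L_D(4)[OF \<mu>'] Xb] sp v
        M.emeasure_eq_measure N.emeasure_eq_measure eq' ..
  next
    show "(\<Union>i. {..(real i, real i)}) = UNIV"
    proof (intro equalityI subset_UNIV subsetI UN_I[OF UNIV_I])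
      fix p :: "real \<times> real"
      have "fst p \<le> real (nat \<lceil>max (fst p) (snd p)\<rceil>)" "snd p \<le> real (nat \<lceil>max (fst p) (snd p)\<rceil>)"
        by linarith+
      then show "p \<in> {..(real (nat \<lceil>max (fst p) (snd p)\<rceil>), real (nat \<lceil>max (fst p) (snd p)\<rceil>))}"
        by (simp add: less_eq_prod_def)
    qed
    show "emeasure ?m {..(real i, real i)} \<noteq> \<infinity>" for i
      using P_L_D(4)[OF \<mu>] by (simp add: emeasure_distr M.emeasure_eq_measure)
  qed auto
  then have e: "emeasure \<mu> A = emeasure \<mu>' A" if "A \<in> sets borel" "A \<subseteq> S_I" for A
  proof -
    have v: "(\<lambda>p. p) -` A \<inter> S_I = A" using that by auto
    have "emeasure \<mu> A = emeasure ?m A"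
      unfolding emeasure_distr[OF P_L_D(4)[OF \<mu>] that(1)] sp v ..
    also have "\<dots> = emeasure \<mu>' A"
      unfolding \<open>?m = ?m'\<close> emeasure_distr[OF P_L_D(4)[OF \<mu>'] that(1)] sp v ..
    finally show ?thesis .
  qed
  show ?thesis
  proof (rule measure_eqI)
    show "sets \<mu> = sets \<mu>'" using P_L_D(2)[OF \<mu>] P_L_D(2)[OF \<mu>'] by simp
    fix A assume "A \<in> sets \<mu>"
    then have "A \<in> sets borel" "A \<subseteq> S_I"
      unfolding P_L_D(2)[OF \<mu>] by (auto simp: sets_restrict_space)
    then show "emeasure \<mu> A = emeasure \<mu>' A" by (rule e)
  qed
qed

text \<open>The reconstruction formula involves only \<open>G\<close> and the joint law of
  \<open>Z\<close> and \<open>snd\<close>. The ends \<open>l\<close> and \<open>r\<close> come from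
  that law at \<open>d = 1\<close>, where the bound on \<open>snd\<close> is void.\<close>

lemma P_L_star_determined:
  assumes \<mu>: "\<mu> \<in> P_L_star" and \<mu>': "\<mu>' \<in> P_L_star"
    and eq: "\<And>Q. kernel_density W_I \<mu> Q = kernel_density W_I \<mu>' Q"
  shows "\<mu> = \<mu>'"
proof -
  have PL: "\<mu> \<in> P_L" "\<mu>' \<in> P_L" using \<mu> \<mu>' by (auto simp: P_L_star_def)
  interpret M: P_L_measure \<mu> by (rule P_L_measure.intro[OF PL(1)])
  interpret N: P_L_measure \<mu>' by (rule P_L_measure.intro[OF PL(2)])
  note det = Z_snd_determined[OF PL eq]
  have one: "{p \<in> space \<mu>. P p \<and> snd p \<le> 1} = {p \<in> space \<mu>. P p}" "{p \<in> space \<mu>'. P p \<and> snd p \<le> 1}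
    = {p \<in> space \<mu>'. P p}" for P
    using M.space_S_I N.space_S_I by auto
  have l: "rank_below \<mu> M.Z w = rank_below \<mu>' N.Z w" for w
    using det(1)[of w 1] by (simp add: one rank_below_def)
  have r: "rank_upto \<mu> M.Z w = rank_upto \<mu>' N.Z w" for w
    using det(2)[of w 1] by (simp add: one rank_upto_def)
  show ?thesis
    by (rule P_L_eqI[OF PL])
      (simp add: M.P_L_star_reconstruct[OF \<mu>] N.P_L_star_reconstruct[OF \<mu>'] det l r)
qed

text \<open>Approximation by finite interval orders makes the definite description in
  \<open>kernel_limit\<close> well defined for every member of \<open>P_L\<close>.\<close>

lemma interval_limit_P_L:
  assumes "\<mu> \<in> P_L"
  shows "interval_limit \<mu> \<in> interval_order_limits"
    and "t_ext (abs_uposet Q) (interval_limit \<mu>) = kernel_density W_I \<mu> Q"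
    and "\<And>X. X \<in> poset_limits \<Longrightarrow> (\<And>Q. t_ext (abs_uposet Q) X = kernel_density W_I \<mu> Q)
      \<Longrightarrow> X = interval_limit \<mu>"
proof -
  obtain P where P: "\<And>n. has_interval_order (P n)"
    "filterlim (\<lambda>n. card (pcarrier (P n))) at_top sequentially"
    "\<And>Q. (\<lambda>n. order_density Q (P n)) \<longlonglongrightarrow> kernel_density W_I \<mu> Q"
    by (rule P_L_approx[OF assms]) (rule that)
  note * = interval_order_limitI[OF P]
  show "interval_limit \<mu> \<in> interval_order_limits"
    unfolding interval_limit_def by (rule *(1))
  show "t_ext (abs_uposet Q) (interval_limit \<mu>) = kernel_density W_I \<mu> Q"
    unfolding interval_limit_def by (rule *(2))
  show "\<And>X. X \<in> poset_limits \<Longrightarrow> (\<And>Q. t_ext (abs_uposet Q) X = kernel_density W_I \<mu> Q) \<Longrightarrow> X = interval_limit \<mu>"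
    unfolding interval_limit_def by (rule *(3))
qed

text \<open>The densities converge to those of \<open>X\<close> along the whole sequence, so the
  limit of any subsequence of representing measures has the densities of \<open>X\<close>.\<close>

lemma interval_order_limit_represented:
  assumes X: "X \<in> interval_order_limits"
  obtains \<mu> where "\<mu> \<in> P_L" "\<And>Q. t_ext (abs_uposet Q) X = kernel_density W_I \<mu> Q"
proof -
  obtain P where P: "\<And>n. interval_order (P n)" "(\<lambda>n. poset_embed (P n)) \<longlonglongrightarrow> X"
    using X unfolding interval_order_limits_def by blast
  have rep: "abs_uposet (rep_uposet u) = u" for u
    by (rule Quotient_abs_rep[OF Quotient_uposet])
  have io: "has_interval_order (rep_uposet (P n))" for n
    using P(1)[of n] interval_order.abs_eq[of "rep_uposet (P n)"] by (simp add: rep)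
  have "\<exists>\<mu>. \<mu> \<in> P_L \<and> (\<forall>Q. kernel_density W_I \<mu> Q = order_density Q (rep_uposet (P n)))" for n
    using interval_order_in_P_L[OF io[of n]] by metis
  then obtain \<mu> where \<mu>: "\<And>n. \<mu> n \<in> P_L" "\<And>n Q. kernel_density W_I (\<mu> n) Q
    = order_density Q (rep_uposet (P n))"
    by metis
  obtain r \<mu>' where r: "strict_mono r" and \<mu>': "\<mu>' \<in> P_L"
    and conv: "\<And>Q. (\<lambda>n. kernel_density W_I (\<mu> (r n)) Q) \<longlonglongrightarrow> kernel_density W_I \<mu>' Q"
    by (rule P_L_compact[of \<mu>, OF \<mu>(1)]) (rule that)
  have "t_ext (abs_uposet Q) X = kernel_density W_I \<mu>' Q" for Q
  proof (rule LIMSEQ_unique)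
    have t: "t_poset (abs_uposet Q) (P n) = order_density Q (rep_uposet (P n))" for n
      using t_poset.abs_eq[of Q "rep_uposet (P n)"] by (simp add: rep)
    have "(\<lambda>n. fst (poset_embed (P n))) \<longlonglongrightarrow> fst X" by (intro tendsto_fst P(2))
    then have "limitin (product_topology (\<lambda>_. euclidean) UNIV) (\<lambda>n. fst (poset_embed (P n))) (fst X)
      sequentially"
      by (simp only: euclidean_product_topology limitin_canonical_iff)
    then have "(\<lambda>n. fst (poset_embed (P n)) (abs_uposet Q)) \<longlonglongrightarrow> fst X (abs_uposet Q)"
      unfolding limitin_componentwise by simp
    then have "(\<lambda>n. order_density Q (rep_uposet (P n))) \<longlonglongrightarrow> t_ext (abs_uposet Q) X"
      by (simp add: poset_embed_def t t_ext_def)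
    from LIMSEQ_subseq_LIMSEQ[OF this r]
    show "(\<lambda>n. order_density Q (rep_uposet (P (r n)))) \<longlonglongrightarrow> t_ext (abs_uposet Q) X"
      by (simp add: comp_def)
    show "(\<lambda>n. order_density Q (rep_uposet (P (r n)))) \<longlonglongrightarrow> kernel_density W_I \<mu>' Q"
      using conv[of Q] by (simp add: \<mu>(2))
  qed
  then show ?thesis by (rule that[OF \<mu>'])
qed

theorem theorem4p7: "bij_betw interval_limit P_L_star interval_order_limits"
  unfolding bij_betw_def
proof
  have sub: "P_L_star \<subseteq> P_L" by (auto simp: P_L_star_def)
  show "inj_on interval_limit P_L_star"
  proof (rule inj_onI)
    fix \<mu> \<mu>' assume \<mu>: "\<mu> \<in> P_L_star" "\<mu>' \<in> P_L_star" "interval_limit \<mu> = interval_limit \<mu>'"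
    then have "kernel_density W_I \<mu> Q = kernel_density W_I \<mu>' Q" for Q
      using interval_limit_P_L(2)[of \<mu> Q] interval_limit_P_L(2)[of \<mu>' Q] subsetD[OF sub] by simp
    then show "\<mu> = \<mu>'" by (rule P_L_star_determined[OF \<mu>(1,2)])
  qed
  show "interval_limit ` P_L_star = interval_order_limits"
  proof
    show "interval_limit ` P_L_star \<subseteq> interval_order_limits"
      using interval_limit_P_L(1) sub by blast
    show "interval_order_limits \<subseteq> interval_limit ` P_L_star"
    proof
      fix X assume X: "X \<in> interval_order_limits"
      obtain \<mu> where \<mu>: "\<mu> \<in> P_L" "\<And>Q. t_ext (abs_uposet Q) X = kernel_density W_I \<mu> Q"
        using interval_order_limit_represented[OF X] by metis
      obtain \<mu>' where \<mu>': "\<mu>' \<in> P_L_star" "\<And>Q. kernel_density W_I \<mu>' Q = kernel_density W_I \<mu> Q"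
        by (rule P_L_normalise[OF \<mu>(1)]) (rule that)
      \<comment> \<open>Normalising keeps the densities, and these determine a poset limit.\<close>
      have "X = interval_limit \<mu>'"
        using \<mu>' \<mu>(2) X sub by (intro interval_limit_P_L(3)) (auto simp: interval_order_limits_def)
      then show "X \<in> interval_limit ` P_L_star" using \<mu>'(1) by blast
    qed
  qed
qed

end
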